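(* Let $d\ge 3$ and let $V:\mathbb Z^d\to\mathbb C$ be a potential with $V\in\ell^p(\mathbb Z^d)$, where $1\le p<\frac65$ if $d=3$ and $1\le p<\frac43$ if $d\ge4$. Then there exists a singular measure $\sigma\ge0$ on $[-\pi,\pi]$ such that the determinant $D$ has the canonical factorization, for all $|z|<1$, $$D(z)=B(z)e^{-K_\sigma(z)}e^{K_D(z)},$$ $$K_\sigma(z)=\frac1{2\pi}\int_{-\pi}^{\pi}\frac{e^{it}+z}{e^{it}-z}\,d\sigma(t),\qquad K_D(z)=\frac1{2\pi}\int_{-\pi}^{\pi}\frac{e^{it}+z}{e^{it}-z}\log|D(e^{it})|\,dt,$$ where $\log|D(e^{it})|\in L^1(-\pi,\pi)$ and the measure $\sigma$ satisfies $$\operatorname{supp}\sigma\subset\{t\in[-\pi,\pi]:D(e^{it})=0\}.$$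
   Context: The discrete Laplacian on $\ell^2(\mathbb Z^d)$ is $(\Delta f)(n)=\frac12\sum_{|n-m|=1}f_m$; its spectrum is $[-d,d]$. $V$ acts as multiplication, $(Vf)(n)=V_nf_n$. Let $\Lambda=\mathbb C\setminus[-d,d]$, $\mathbb D=\{|z|<1\}$. The map $\lambda(z)=\frac d2\left(z+\frac1z\right)$ is a conformal bijection $\mathbb D\to\Lambda$ (with $0\mapsto\infty$). With $R_0(\lambda)=(\Delta-\lambda)^{-1}$, set $\mathcal D(\lambda)=\det\big[(I+VR_0(\lambda))e^{-VR_0(\lambda)}\big]$ for $\lambda\in\Lambda$ (regularized determinant; $VR_0(\lambda)$ is Hilbert–Schmidt), and $D(z)=\mathcal D(\lambda(z))$ for $z\in\mathbb D$, with $D(0)=1$. The function $D$ is bounded and analytic in $\mathbb D$ and extends continuously to $\overline{\mathbb D}$; $D(e^{it})$ denotes the boundary values. Let $\{z_j\}_{j=1}^N$, $N\le\infty$, be the zeros of $D$ in $\mathbb D$ counted with multiplicity. The Blaschke product is $B=1$ if $N=0$ and $B(z)=\prod_{j=1}^N\frac{|z_j|}{z_j}\frac{z_j-z}{1-\overline{z_j}z}$ if $N\ge1$. "Singular" means singular with respect to Lebesgue measure. *)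

theory Defs
  imports
    "HOL-Complex_Analysis.Complex_Analysis"
    "HOL-Combinatorics.Permutations"
begin

definition lspace :: "real \<Rightarrow> ('i \<Rightarrow> complex) set" where
  "lspace p = {f. (\<lambda>i. norm (f i) powr p) summable_on UNIV}"

text \<open>Operators on \<open>\<ell>\<^sup>2\<close> are rendered as maps on all functions of the index set; only their
  values on \<^term>\<open>lspace 2\<close> matter.\<close>

type_synonym 'i oper = "('i \<Rightarrow> complex) \<Rightarrow> ('i \<Rightarrow> complex)"

definition unit_fun :: "'i \<Rightarrow> 'i \<Rightarrow> complex" where
  "unit_fun j = (\<lambda>i. if i = j then 1 else 0)"

definition matrix_entry :: "'i oper \<Rightarrow> 'i \<Rightarrow> 'i \<Rightarrow> complex" where
  "matrix_entry T i j = T (unit_fun j) i"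

definition principal_minor :: "'i oper \<Rightarrow> 'i set \<Rightarrow> complex" where
  "principal_minor T S =
     (\<Sum>\<pi> | \<pi> permutes S. of_int (sign \<pi>) * (\<Prod>i\<in>S. matrix_entry T i (\<pi> i)))"

text \<open>The trace of the \<open>k\<close>-th exterior power of a trace class operator \<open>T\<close>, computed in the
  orthonormal basis \<open>e\<^bsub>i\<^sub>1\<^esub> \<and> \<dots> \<and> e\<^bsub>i\<^sub>k\<^esub>\<close> of the \<open>k\<close>-th exterior power of \<open>\<ell>\<^sup>2\<close>.\<close>

definition trace_ext_power :: "nat \<Rightarrow> 'i oper \<Rightarrow> complex" where
  "trace_ext_power k T = (\<Sum>\<^sub>\<infinity>S | finite S \<and> card S = k. principal_minor T S)"

text \<open>The Fredholm determinant \<open>det W = \<Sum>k. Tr (\<Lambda>\<^sup>k (W - I))\<close> of an operator \<open>W\<close> that differs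
  from the identity by a trace class operator.\<close>

definition fredholm_det :: "'i oper \<Rightarrow> complex" where
  "fredholm_det W = (\<Sum>k. trace_ext_power k (\<lambda>f i. W f i - f i))"

text \<open>For bounded \<open>A\<close> the exponential series converges in operator norm, in particular
  coordinatewise on every vector of \<open>\<ell>\<^sup>2\<close>.\<close>

definition oper_exp :: "'i oper \<Rightarrow> 'i oper" where
  "oper_exp A = (\<lambda>f i. \<Sum>k. (A ^^ k) f i / fact k)"

text \<open>\<open>det ((I + A) exp (-A))\<close>\<close>

definition regularized_det :: "'i oper \<Rightarrow> complex" where
  "regularized_det A =
     fredholm_det ((\<lambda>f i. f i + A f i) \<circ> oper_exp (\<lambda>f i. - A f i))"

definition lattice_norm :: "int ^ 'd::finite \<Rightarrow> real" where
  "lattice_norm n = norm (\<chi> i. real_of_int (n $ i))"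

definition laplacian :: "(int ^ 'd::finite) oper" where
  "laplacian f = (\<lambda>n. (\<Sum>m | lattice_norm (n - m) = 1. f m) / 2)"

definition free_resolvent :: "complex \<Rightarrow> (int ^ 'd::finite) oper" where
  "free_resolvent w = inv_into (lspace 2) (\<lambda>f n. laplacian f n - w * f n)"

definition schroedinger_det :: "(int ^ 'd::finite \<Rightarrow> complex) \<Rightarrow> complex \<Rightarrow> complex" where
  "schroedinger_det V w = regularized_det (\<lambda>f n. V n * free_resolvent w f n)"

definition spectral_param :: "nat \<Rightarrow> complex \<Rightarrow> complex" where
  "spectral_param d z = of_nat d / 2 * (z + 1 / z)"

text \<open>Only the values for \<open>\<bar>z\<bar> < 1\<close> are meaningful; the boundary values are taken separately,
  since the resolvent does not exist on the spectrum.\<close>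

definition disc_det :: "(int ^ 'd::finite \<Rightarrow> complex) \<Rightarrow> complex \<Rightarrow> complex" where
  "disc_det V z =
     (if z = 0 then 1 else schroedinger_det V (spectral_param CARD('d) z))"

text \<open>The value at \<open>e\<^sup>i\<^sup>t\<close> of the continuous extension of \<open>D\<close> to the closed disc.\<close>

definition boundary_value :: "(complex \<Rightarrow> complex) \<Rightarrow> real \<Rightarrow> complex" where
  "boundary_value D t = Lim (at (cis t) within ball 0 1) D"

text \<open>\<open>zs 0, zs 1, \<dots>\<close> (\<open>N \<le> \<infinity>\<close> terms) lists the zeros of \<open>D\<close> in the open unit disc, each
  repeated according to its multiplicity. The values \<open>zs j\<close> with \<open>j \<ge> N\<close> are irrelevant.\<close>

definition enumerates_zeros :: "(complex \<Rightarrow> complex) \<Rightarrow> enat \<Rightarrow> (nat \<Rightarrow> complex) \<Rightarrow> bool" where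
  "enumerates_zeros D N zs \<longleftrightarrow>
     (\<forall>j. enat j < N \<longrightarrow> zs j \<in> ball 0 1 \<and> D (zs j) = 0) \<and>
     (\<forall>w\<in>ball 0 1. D w = 0 \<longrightarrow>
        finite {j. enat j < N \<and> zs j = w} \<and>
        int (card {j. enat j < N \<and> zs j = w}) = zorder D w)"

definition blaschke_product :: "enat \<Rightarrow> (nat \<Rightarrow> complex) \<Rightarrow> complex \<Rightarrow> complex" where
  "blaschke_product N zs z =
     (\<Prod>j. if enat j < N
           then of_real (norm (zs j)) / zs j * ((zs j - z) / (1 - cnj (zs j) * z))
           else 1)"

definition finite_borel_measure_on :: "real set \<Rightarrow> real measure \<Rightarrow> bool" where
  "finite_borel_measure_on X \<sigma> \<longleftrightarrow> finite_measure \<sigma> \<and> sets \<sigma> = sets (restrict_space borel X)"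

definition lebesgue_singular :: "real measure \<Rightarrow> bool" where
  "lebesgue_singular \<sigma> \<longleftrightarrow> (\<exists>N\<in>null_sets lborel. emeasure \<sigma> (space \<sigma> - N) = 0)"

definition measure_support :: "real measure \<Rightarrow> real set" where
  "measure_support \<sigma> =
     {t \<in> space \<sigma>. \<forall>U. open U \<and> t \<in> U \<longrightarrow> emeasure \<sigma> (U \<inter> space \<sigma>) > 0}"

definition K_sing :: "real measure \<Rightarrow> complex \<Rightarrow> complex" where
  "K_sing \<sigma> z = 1 / (2 * of_real pi) * (LINT t|\<sigma>. (cis t + z) / (cis t - z))"

definition K_outer :: "(complex \<Rightarrow> complex) \<Rightarrow> complex \<Rightarrow> complex" where
  "K_outer D z = 1 / (2 * of_real pi) *
     (LINT t:{-pi..pi}|lborel.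
        (cis t + z) / (cis t - z) * of_real (ln (norm (boundary_value D t))))"

text \<open>\<open>log \<bar>D(e\<^sup>i\<^sup>t)\<bar> \<in> L\<^sup>1(-\<pi>, \<pi>)\<close>. Since \<open>ln 0 = 0\<close> in HOL, whereas \<open>log 0 = -\<infinity>\<close> here, the
  requirement that the function is finite almost everywhere has to be stated explicitly.\<close>

definition log_boundary_L1 :: "(complex \<Rightarrow> complex) \<Rightarrow> bool" where
  "log_boundary_L1 D \<longleftrightarrow>
     (AE t in lborel. t \<in> {-pi<..<pi} \<longrightarrow> boundary_value D t \<noteq> 0) \<and>
     set_integrable lborel {-pi<..<pi} (\<lambda>t. ln (norm (boundary_value D t)))"

end

theory Submission
  imports Defs "Jordan_Normal_Form.Schur_Decomposition" "HOL-Probability.Probability"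
begin

text \<open>The resolvent kernel is \<open>R\<^sub>0(\<lambda>) = - i \<integral> exp (- i t \<lambda>) exp (i t \<Delta>) dt\<close> over \<open>[0, \<infinity>)\<close> for
  \<open>Im \<lambda> \<le> 0\<close>, and \<open>exp (i t \<Delta>)\<close> is a product of Bessel functions. Each dyadic time interval
  contributes a kernel with a small supremum, by the decay of the Bessel functions, and a moderate
  \<open>\<ell>\<^sup>2\<close> norm. Interpolating between the two bounds shows that \<open>\<bar>V\<bar>\<^sup>1\<^sup>/\<^sup>2 R\<^sub>0(\<lambda>) \<bar>V\<bar>\<^sup>1\<^sup>/\<^sup>2\<close> is dominated,
  uniformly up to the spectrum, by one Hilbert--Schmidt kernel. Hadamard's inequality then
  dominates the series of the regularized determinant, which therefore lies in the disc algebra.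

  A function \<open>F\<close> of the disc algebra with \<open>F(0) = 1\<close> satisfies the Poisson--Jensen formula on the
  circles of radius \<open>r < 1\<close>. By Jensen's formula the positive measures
  \<open>(C - log \<bar>F(r e\<^sup>i\<^sup>t)\<bar>) dt\<close> have bounded mass, so they have a weak limit as \<open>r\<close> tends to \<open>1\<close>. Uniform
  convergence identifies this limit with \<open>(C - log \<bar>F(e\<^sup>i\<^sup>t)\<bar>) dt\<close> off the zero set of \<open>F\<close> on the
  circle, and that zero set is null by Fatou's lemma. The restriction of the limit to the zero set
  is \<open>\<sigma>\<close>.\<close>

section \<open>Hadamard's inequality\<close>

text \<open>The bounds on p come from the dyadic interpolation. If the j-th piece has supremum of
  order \<open>2^(-a*j)\<close> and l2 norm of order \<open>2^j\<close>, then with x = 1 - 1/p its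
  squared Hilbert-Schmidt norm is of order \<open>2^(-(2*a*(1-2*x) - 4*x)*j)\<close>. Three Bessel
  factors allow a = 1/2, hence x < 1/6 and p < 6/5. Four factors allow every a < 1 (a = 1 is lost to
  a logarithm), hence x < 1/4 and p < 4/3. The operators are defined on arbitrary functions, but a
  determinant reads only matrix entries: every vector that arises from a unit vector is absolutely
  summable, and there the operators act through matrices. The Hilbert-Schmidt bound is for the
  symmetrized kernel, not for \<open>V R_0\<close>. The two are conjugate by a diagonal matrix,
  which leaves all principal minors unchanged. Hadamard's inequality costs a factor
  \<open>sqrt (k^k)\<close> at order k, against a decay of order 1/k! of the elementary symmetric
  functions of a summable sequence; hence the determinant series converges.\<close>

lemma trace_mult_commute:
  fixes A B :: "complex mat"
  assumes "A \<in> carrier_mat n n" "B \<in> carrier_mat n n"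
  shows "(\<Sum>i<n. (A * B) $$ (i,i)) = (\<Sum>i<n. (B * A) $$ (i,i))"
proof -
  have "(\<Sum>i<n. (A * B) $$ (i,i)) = (\<Sum>i<n. \<Sum>j<n. A $$ (i,j) * B $$ (j,i))"
    using assms by (intro sum.cong refl) (simp add: scalar_prod_def lessThan_atLeast0)
  also have "\<dots> = (\<Sum>j<n. \<Sum>i<n. A $$ (i,j) * B $$ (j,i))"
    by (rule sum.swap)
  also have "\<dots> = (\<Sum>i<n. (B * A) $$ (i,i))"
    using assms by (intro sum.cong refl) (simp add: scalar_prod_def mult.commute lessThan_atLeast0)
  finally show ?thesis .
qed

lemma trace_similar:
  fixes A B :: "complex mat"
  assumes "similar_mat_wit A B P Q" "A \<in> carrier_mat n n"
  shows "(\<Sum>i<n. A $$ (i,i)) = (\<Sum>i<n. B $$ (i,i))"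
proof -
  note D = similar_mat_witD2[OF assms(2,1)]
  have "(\<Sum>i<n. A $$ (i,i)) = (\<Sum>i<n. (P * (B * Q)) $$ (i,i))"
    using D(3) assoc_mult_mat[OF D(6,5,7)] by simp
  also have "\<dots> = (\<Sum>i<n. ((B * Q) * P) $$ (i,i))"
    using D by (intro trace_mult_commute) auto
  also have "(B * Q) * P = B"
    using D(2) assoc_mult_mat[OF D(5,7,6)] right_mult_one_mat[OF D(5)] by simp
  finally show ?thesis .
qed

text \<open>Let B be A times its adjoint. Its eigenvalues are nonnegative, their product is the
  squared modulus of the determinant of A, and their sum is the sum of all squared entries, at most
  \<open>n * n\<close>. The arithmetic-geometric mean inequality does the rest.\<close>

theorem hadamard_inequality:
  fixes A :: "complex mat"
  assumes A: "A \<in> carrier_mat n n" and le: "\<And>i j. i < n \<Longrightarrow> j < n \<Longrightarrow> norm (A $$ (i,j)) \<le> 1"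
  shows "(norm (Determinant.det A))\<^sup>2 \<le> real n ^ n"
proof (cases "n = 0")
  case True
  then show ?thesis using A by (simp add: Determinant.det_def)
next
  case n: False
  define AH where "AH = Matrix.mat n n (\<lambda>(i,j). cnj (A $$ (j,i)))"
  have AH: "AH \<in> carrier_mat n n" by (simp add: AH_def)
  define B where "B = A * AH"
  have B: "B \<in> carrier_mat n n" using A AH by (simp add: B_def)
  have det_AH: "Determinant.det AH = cnj (Determinant.det A)"
  proof -
    have AT: "transpose_mat A \<in> carrier_mat n n" using A by simp
    have "Determinant.det AH = cnj (Determinant.det (transpose_mat A))"
      unfolding det_def'[OF AH] det_def'[OF AT] using A
      by (auto simp: AH_def permutes_in_image intro!: sum.cong prod.cong)
    then show ?thesis by (simp add: Determinant.det_transpose[OF A])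
  qed
  have det_B: "Determinant.det B = of_real ((norm (Determinant.det A))\<^sup>2)"
    unfolding B_def Determinant.det_mult[OF A AH] det_AH by (rule complex_norm_square[symmetric])
  have Bij: "B $$ (i,j) = (\<Sum>k<n. A $$ (i,k) * cnj (A $$ (j,k)))" if "i < n" "j < n" for i j
    unfolding B_def using A that by (simp add: scalar_prod_def AH_def lessThan_atLeast0)
  \<comment> \<open>A triangular form shows the eigenvalues with multiplicity on its diagonal, so
    that both trace and determinant of B can be read off from \<open>es\<close>.\<close>
  obtain es where es: "char_poly B = (\<Prod>a\<leftarrow>es. [:- a, 1:])" and len: "length es = n"
    using char_poly_factorized[OF B] by blast
  obtain U P Q where U: "schur_decomposition B es = (U, P, Q)" by (metis prod_cases3)
  have wit: "similar_mat_wit B U P Q" and ut: "upper_triangular U" and dg: "diag_mat U = es"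
    using schur_decomposition[OF B es U] by auto
  have Uc: "U \<in> carrier_mat n n" using similar_mat_witD2[OF B wit] by simp
  have es_nth: "es ! i = U $$ (i,i)" if "i < n" for i
    using that Uc by (simp add: dg[symmetric] diag_mat_def)
  \<comment> \<open>Pairing the eigenvalue equation with the eigenvector v gives e times the squared
    norm of v on one side and the squared norm of (adjoint of A) v, here \<open>R\<close>, on the
    other.\<close>
  have nonneg: "\<exists>r\<ge>0. e = of_real r" if "e \<in> set es" for e
  proof -
    have "poly (char_poly B) e = 0"
      unfolding es poly_prod_list prod_list_zero_iff using that by force
    then have "eigenvalue B e" using eigenvalue_root_char_poly[OF B] by simp
    then obtain v where v: "v \<in> carrier_vec n" "v \<noteq> 0\<^sub>v n" "B *\<^sub>v v = e \<cdot>\<^sub>v v"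
      using B unfolding eigenvalue_def eigenvector_def by auto
    define N where "N = (\<Sum>i<n. (norm (v $ i))\<^sup>2)"
    have "\<exists>i<n. v $ i \<noteq> 0" using v(1,2) by (metis eq_vecI carrier_vecD index_zero_vec)
    then obtain i0 where i0: "i0 < n" "v $ i0 \<noteq> 0" by blast
    have "0 < (norm (v $ i0))\<^sup>2" using i0 by simp
    also have "\<dots> \<le> N" unfolding N_def using i0 by (intro member_le_sum) auto
    finally have "N > 0" .
    have row: "e * v $ i = (\<Sum>j<n. B $$ (i,j) * v $ j)" if "i < n" for i
    proof -
      have "(B *\<^sub>v v) $ i = (\<Sum>j<n. B $$ (i,j) * v $ j)"
        using that B v(1) by (simp add: scalar_prod_def lessThan_atLeast0)
      then show ?thesis using v that by simp
    qed
    define R where "R = (\<Sum>k<n. (norm (\<Sum>j<n. cnj (A $$ (j,k)) * v $ j))\<^sup>2)"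
    have "e * of_real N = (\<Sum>i<n. e * v $ i * cnj (v $ i))"
      unfolding N_def of_real_sum sum_distrib_left
      by (intro sum.cong refl) (simp add: complex_norm_square mult.assoc del: of_real_power)
    also have "\<dots> = (\<Sum>i<n. \<Sum>j<n. \<Sum>k<n. A $$ (i,k) * cnj (A $$ (j,k)) * v $ j * cnj (v $ i))"
      by (intro sum.cong refl) (simp add: row Bij sum_distrib_right)
    also have "\<dots> = (\<Sum>k<n. \<Sum>i<n. \<Sum>j<n. A $$ (i,k) * cnj (A $$ (j,k)) * v $ j * cnj (v $ i))"
      by (subst sum.swap[of _ "{..<n}" "{..<n}"], subst (2) sum.swap, subst sum.swap) (rule sum.swap)
    also have "\<dots> = (\<Sum>k<n. (\<Sum>j<n. cnj (A $$ (j,k)) * v $ j) * cnj (\<Sum>j<n. cnj (A $$ (j,k)) * v $ j))"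
      by (intro sum.cong refl) (simp add: sum_product mult_ac, rule sum.swap)
    also have "\<dots> = of_real R"
      unfolding R_def of_real_sum by (intro sum.cong refl) (simp add: complex_norm_square del: of_real_power)
    finally have "e = of_real (R / N)" using \<open>N > 0\<close> by (simp add: field_simps)
    moreover have "R / N \<ge> 0" using \<open>N > 0\<close> by (simp add: R_def sum_nonneg)
    ultimately show ?thesis by blast
  qed
  define d where "d = (\<lambda>i. Re (es ! i))"
  have d: "es ! i = of_real (d i)" "d i \<ge> 0" if "i < n" for i
    using nonneg[of "es ! i"] that len by (auto simp: d_def)
  have "of_real (\<Sum>i<n. d i) = (\<Sum>i<n. B $$ (i,i))"
    using trace_similar[OF wit B] d es_nth by simp
  also have "\<dots> = of_real (\<Sum>i<n. \<Sum>k<n. (norm (A $$ (i,k)))\<^sup>2)"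
    unfolding of_real_sum by (intro sum.cong refl) (simp add: Bij complex_norm_square del: of_real_power)
  finally have tr: "(\<Sum>i<n. d i) = (\<Sum>i<n. \<Sum>k<n. (norm (A $$ (i,k)))\<^sup>2)"
    using of_real_eq_iff by blast
  also have "\<dots> \<le> (\<Sum>i<n. \<Sum>k<n. 1)"
    using le by (intro sum_mono) (simp add: power_le_one)
  finally have tr_le: "(\<Sum>i<n. d i) \<le> real n * real n" by simp
  have "of_real ((norm (Determinant.det A))\<^sup>2) = Determinant.det U"
    using det_B det_similar wit unfolding similar_mat_def by metis
  also have "\<dots> = prod_list es" using det_upper_triangular[OF ut Uc] dg by simp
  also have "\<dots> = (\<Prod>i<n. es ! i)" using len by (simp add: prod.list_conv_set_nth lessThan_atLeast0)
  also have "\<dots> = of_real (\<Prod>i<n. d i)" using d by simp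
  finally have "(norm (Determinant.det A))\<^sup>2 = (\<Prod>i<n. d i)"
    using of_real_eq_iff by blast
  \<comment> \<open>Arithmetic-geometric mean through x <= exp (x - 1) at x =
    \<open>d i / n\<close>; the exponents add up to trace / n - n, which is at most 0.\<close>
  also have "\<dots> = real n ^ n * (\<Prod>i<n. d i / n)"
    using n by (simp add: prod_dividef)
  also have "\<dots> \<le> real n ^ n * (\<Prod>i<n. exp (d i / n - 1))"
    using d by (intro mult_left_mono prod_mono conjI) (auto simp: exp_ge_add_one_self[of "_ - 1", simplified])
  also have "(\<Prod>i<n. exp (d i / n - 1)) = exp ((\<Sum>i<n. d i) / n - n)"
    by (simp add: exp_sum[symmetric] sum_subtractf sum_divide_distrib)
  also have "\<dots> \<le> 1" using tr_le n by (simp add: field_simps)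
  finally show ?thesis by (simp add: mult_left_mono)
qed

text \<open>An enumeration of S conjugates the permutations of S into those of
  \<open>{0..<n}\<close> and preserves signs, so the minor is an ordinary n by n
  determinant.\<close>

lemma norm_principal_minor_le_card:
  assumes "finite S" and le: "\<And>i j. i \<in> S \<Longrightarrow> j \<in> S \<Longrightarrow> norm (t i j) \<le> 1"
  shows "norm (\<Sum>\<pi> | \<pi> permutes S. of_int (sign \<pi>) * (\<Prod>i\<in>S. t i (\<pi> i)) :: complex)
    \<le> sqrt (real (card S) ^ card S)"
proof -
  define n where "n = card S"
  obtain f where f: "bij_betw f {0..<n} S"
    using ex_bij_betw_nat_finite[OF assms(1)] unfolding n_def by blast
  define A where "A = Matrix.mat n n (\<lambda>(i,j). t (f i) (f j))"
  have A: "A \<in> carrier_mat n n" by (simp add: A_def)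
  have fS: "f i \<in> S" if "i < n" for i using f that by (auto simp: bij_betw_def)
  have inj: "inj_on f {0..<n}" and img: "f ` {0..<n} = S" using f by (auto simp: bij_betw_def)
  have "(\<Sum>\<pi> | \<pi> permutes S. of_int (sign \<pi>) * (\<Prod>i\<in>S. t i (\<pi> i)))
      = (\<Sum>p | p permutes {0..<n}. of_int (sign p) * (\<Prod>i=0..<n. t (f i) (f (p i))))"
  proof (rule sum.reindex_bij_witness[where j = "map_permutation S (inv_into {0..<n} f)" and i = "map_permutation {0..<n} f"])
    show "map_permutation {0..<n} f (map_permutation S (inv_into {0..<n} f) \<pi>) = \<pi>" if "\<pi> \<in> {\<pi>. \<pi> permutes S}" for \<pi>
      using that f by (intro map_permutation_compose_inv[where A=S])
        (auto intro: bij_betw_inv_into simp: bij_betw_inv_into_right[OF f])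
    show "map_permutation S (inv_into {0..<n} f) \<pi> \<in> {p. p permutes {0..<n}}" if "\<pi> \<in> {\<pi>. \<pi> permutes S}" for \<pi>
      using that f by (auto intro!: map_permutation_permutes bij_betw_inv_into)
    show "map_permutation S (inv_into {0..<n} f) (map_permutation {0..<n} f p) = p" if "p \<in> {p. p permutes {0..<n}}" for p
      using that f by (intro map_permutation_compose_inv[where A="{0..<n}"])
        (auto intro: bij_betw_inv_into simp: bij_betw_inv_into_left[OF f])
    show "map_permutation {0..<n} f p \<in> {\<pi>. \<pi> permutes S}" if "p \<in> {p. p permutes {0..<n}}" for p
      using that f by (auto intro!: map_permutation_permutes)
    fix \<pi> assume "\<pi> \<in> {\<pi>. \<pi> permutes S}"
    then have \<pi>: "\<pi> permutes S" by simp
    let ?p = "map_permutation S (inv_into {0..<n} f) \<pi>"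
    have ib: "bij_betw (inv_into {0..<n} f) S {0..<n}" using f by (rule bij_betw_inv_into)
    have s: "sign ?p = sign \<pi>"
      using ib by (intro sign_map_permutation \<pi> assms(1)) (auto simp: bij_betw_def)
    have "(\<Prod>i\<in>S. t i (\<pi> i)) = (\<Prod>i=0..<n. t (f i) (\<pi> (f i)))"
      using prod.reindex_bij_betw[OF f, of "\<lambda>i. t i (\<pi> i)"] by simp
    also have "\<dots> = (\<Prod>i=0..<n. t (f i) (f (?p i)))"
    proof (intro prod.cong refl)
      fix i assume i: "i \<in> {0..<n}"
      have "?p i = ?p (inv_into {0..<n} f (f i))" using i f by (simp add: bij_betw_inv_into_left)
      also have "\<dots> = inv_into {0..<n} f (\<pi> (f i))"
        using ib fS i by (intro map_permutation_apply) (auto simp: bij_betw_def)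
      finally have "f (?p i) = \<pi> (f i)"
        using fS[of i] i \<pi> f by (simp add: bij_betw_inv_into_right permutes_in_image)
      then show "t (f i) (\<pi> (f i)) = t (f i) (f (?p i))" by simp
    qed
    finally show "of_int (sign ?p) * (\<Prod>i=0..<n. t (f i) (f (?p i))) = of_int (sign \<pi>) * (\<Prod>i\<in>S. t i (\<pi> i))"
      by (simp add: s)
  qed
  also have "\<dots> = Determinant.det A"
    unfolding det_def'[OF A] by (intro sum.cong refl arg_cong2[of _ _ _ _ "(*)"] prod.cong)
      (auto simp: A_def permutes_in_image)
  finally have eq: "(\<Sum>\<pi> | \<pi> permutes S. of_int (sign \<pi>) * (\<Prod>i\<in>S. t i (\<pi> i))) = Determinant.det A" .
  have "(norm (Determinant.det A))\<^sup>2 \<le> real n ^ n"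
    by (rule hadamard_inequality[OF A]) (auto simp: A_def intro!: le fS)
  then show ?thesis unfolding eq n_def[symmetric] by (rule real_le_rsqrt)
qed

text \<open>The factors \<open>x i\<close> and \<open>y j\<close> of a rank one majorant can be
  pulled out of rows and columns; what remains has entries of modulus at most 1.\<close>

lemma norm_principal_minor_le:
  assumes S: "finite S" and le: "\<And>i j. i \<in> S \<Longrightarrow> j \<in> S \<Longrightarrow> norm (t i j) \<le> x i * y j"
    and "\<And>i. x i \<ge> 0" "\<And>i. y i \<ge> 0"
  shows "norm (\<Sum>\<pi> | \<pi> permutes S. of_int (sign \<pi>) * (\<Prod>i\<in>S. t i (\<pi> i)) :: complex)
    \<le> sqrt (real (card S) ^ card S) * (\<Prod>i\<in>S. x i * y i)"
proof -
  \<comment> \<open>Where \<open>x i * y j = 0\<close> the entry \<open>t i j\<close> vanishes as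
    well, and division by zero gives \<open>s i j = 0\<close>, so the factorization \<open>t\<close>
    below still holds.\<close>
  define s where "s = (\<lambda>i j. t i j / of_real (x i * y j))"
  have t: "t i j = of_real (x i) * of_real (y j) * s i j" if "i \<in> S" "j \<in> S" for i j
    using le[OF that] by (auto simp: s_def)
  have "(\<Sum>\<pi> | \<pi> permutes S. of_int (sign \<pi>) * (\<Prod>i\<in>S. t i (\<pi> i))) =
    (\<Sum>\<pi> | \<pi> permutes S. of_real (\<Prod>i\<in>S. x i * y i) * (of_int (sign \<pi>) * (\<Prod>i\<in>S. s i (\<pi> i))))"
  proof (intro sum.cong refl)
    fix \<pi> assume "\<pi> \<in> {\<pi>. \<pi> permutes S}"
    then have \<pi>: "\<pi> permutes S" by simp
    have "(\<Prod>i\<in>S. t i (\<pi> i)) = (\<Prod>i\<in>S. of_real (x i) * of_real (y (\<pi> i)) * s i (\<pi> i))"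
      using \<pi> by (intro prod.cong refl t) (auto simp: permutes_in_image)
    also have "\<dots> = (\<Prod>i\<in>S. of_real (x i)) * (\<Prod>i\<in>S. of_real (y (\<pi> i))) * (\<Prod>i\<in>S. s i (\<pi> i))"
      by (simp add: prod.distrib)
    also have "(\<Prod>i\<in>S. of_real (y (\<pi> i))) = (\<Prod>i\<in>S. of_real (y i) :: complex)"
      by (rule prod.permute[OF \<pi>, of "\<lambda>i. of_real (y i)", unfolded o_def, symmetric])
    finally show "of_int (sign \<pi>) * (\<Prod>i\<in>S. t i (\<pi> i)) =
        of_real (\<Prod>i\<in>S. x i * y i) * (of_int (sign \<pi>) * (\<Prod>i\<in>S. s i (\<pi> i)))"
      by (simp add: prod.distrib)
  qed
  also have "norm \<dots> = (\<Prod>i\<in>S. x i * y i) * norm (\<Sum>\<pi> | \<pi> permutes S. of_int (sign \<pi>) * (\<Prod>i\<in>S. s i (\<pi> i)))"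
    unfolding sum_distrib_left[symmetric] norm_mult using assms(3,4) by (simp add: norm_of_real prod_nonneg flip: of_real_mult of_real_prod)
  also have "\<dots> \<le> (\<Prod>i\<in>S. x i * y i) * sqrt (real (card S) ^ card S)"
    using assms by (intro mult_left_mono norm_principal_minor_le_card prod_nonneg)
      (auto simp: s_def norm_divide norm_mult divide_le_eq_1 order.not_eq_order_implies_strict)
  finally show ?thesis by (simp add: mult.commute)
qed

section \<open>Decay of Bessel functions\<close>

text \<open>Bessel's integral for J_m. The argument is complex so that complex derivatives can be
  used for products of such functions.\<close>

definition bessel :: "int \<Rightarrow> complex \<Rightarrow> complex" where
  "bessel m t = 1 / (2 * of_real pi) *
     integral {-pi..pi} (\<lambda>\<theta>. exp (\<i> * (t * of_real (sin \<theta>) - of_int m * of_real \<theta>)))"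

text \<open>Differentiation under the integral brings down i sin theta, and Euler's formula turns it
  into the two neighbouring frequencies. This recurrence is what makes products of Bessel functions
  solve the lattice Schroedinger equation.\<close>

lemma has_field_derivative_bessel:
  "(bessel m has_field_derivative (bessel (m - 1) t - bessel (m + 1) t) / 2) (at t)"
proof -
  let ?f = "\<lambda>m t \<theta>. exp (\<i> * (t * of_real (sin \<theta>) - of_int m * of_real \<theta>))"
  have int: "?f m t integrable_on {-pi..pi}" for m t
    by (intro integrable_continuous_interval continuous_intros)
  have sinE: "\<i> * of_real (sin \<theta>) = (exp (\<i> * of_real \<theta>) - exp (- (\<i> * of_real \<theta>))) / 2" for \<theta>
    by (simp add: sin_of_real[symmetric] sin_exp_eq field_simps)
  have "((\<lambda>t. integral (cbox (-pi) pi) (?f m t)) has_field_derivative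
      integral (cbox (-pi) pi) (\<lambda>\<theta>. \<i> * of_real (sin \<theta>) * ?f m t \<theta>)) (at t within UNIV)"
  proof (rule leibniz_rule_field_derivative)
    show "((\<lambda>t. ?f m t \<theta>) has_field_derivative \<i> * of_real (sin \<theta>) * ?f m t \<theta>) (at t within UNIV)" for t \<theta>
      by (auto intro!: derivative_eq_intros)
    show "continuous_on (UNIV \<times> cbox (-pi) pi) (\<lambda>(t, \<theta>). \<i> * of_real (sin \<theta>) * ?f m t \<theta>)"
      by (auto simp: split_beta intro!: continuous_intros)
  qed (use int in auto)
  also have "(\<lambda>\<theta>. \<i> * of_real (sin \<theta>) * ?f m t \<theta>) = (\<lambda>\<theta>. (?f (m - 1) t \<theta> - ?f (m + 1) t \<theta>) / 2)"
    unfolding sinE by (auto simp: fun_eq_iff exp_diff exp_add[symmetric] exp_minus field_simps)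
  also have "integral (cbox (-pi) pi) (\<lambda>\<theta>. (?f (m - 1) t \<theta> - ?f (m + 1) t \<theta>) / 2)
      = (integral {-pi..pi} (?f (m - 1) t) - integral {-pi..pi} (?f (m + 1) t)) / 2"
    using integral_diff[OF int[where m="m - 1" and t=t] int[where m="m + 1" and t=t]] by simp
  finally have "((\<lambda>t. 1 / (2 * of_real pi) * integral {-pi..pi} (?f m t)) has_field_derivative
      1 / (2 * of_real pi) * ((integral {-pi..pi} (?f (m - 1) t) - integral {-pi..pi} (?f (m + 1) t)) / 2)) (at t)"
    by (intro DERIV_cmult) simp
  then show ?thesis unfolding bessel_def[abs_def] by (simp add: field_simps)
qed

lemma has_integral_exp_int:
  "((\<lambda>\<theta>. exp (\<i> * (of_int m * of_real \<theta>))) has_integral (if m = 0 then 2 * of_real pi else 0)) {-pi..pi}"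
proof (cases "m = 0")
  case True
  then show ?thesis using has_integral_const_real[of "1::complex" "-pi" pi] by (simp add: scaleR_conv_of_real)
next
  case False
  let ?F = "\<lambda>\<theta>. exp (\<i> * (of_int m * of_real \<theta>)) / (\<i> * of_int m)"
  have "((\<lambda>\<theta>. exp (\<i> * (of_int m * of_real \<theta>))) has_integral ?F pi - ?F (-pi)) {-pi..pi}"
  proof (rule fundamental_theorem_of_calculus)
    fix \<theta> :: real
    have "((\<lambda>z. exp (\<i> * (of_int m * z)) / (\<i> * of_int m)) has_field_derivative exp (\<i> * (of_int m * of_real \<theta>))) (at (of_real \<theta>))"
      using False by (auto intro!: derivative_eq_intros simp: field_simps)
    then show "(?F has_vector_derivative exp (\<i> * (of_int m * of_real \<theta>))) (at \<theta> within {-pi..pi})"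
      using has_vector_derivative_real_field has_vector_derivative_at_within by blast
  qed simp
  moreover have "?F pi = ?F (-pi)"
  proof -
    have "exp (\<i> * (of_int m * of_real pi)) = exp (\<i> * (of_int m * of_real (-pi))) * exp (2 * of_int m * of_real pi * \<i>)"
      unfolding exp_add[symmetric] by (simp add: algebra_simps)
    then show ?thesis by (simp add: exp_eq_1)
  qed
  ultimately show ?thesis using False by simp
qed

lemma bessel_at_0: "bessel m 0 = (if m = 0 then 1 else 0)"
  using has_integral_exp_int[of "-m"] by (auto simp: bessel_def integral_unique)

text \<open>The numbers J_m(t) are the Fourier coefficients of the unimodular function
  \<open>u\<close>, so this is Bessel's inequality: the integral of |u - s|^2 equals 2 pi (1 -
  N).\<close>

lemma sum_norm_bessel_le:
  assumes "finite F"
  shows "(\<Sum>m\<in>F. (norm (bessel m (of_real t)))\<^sup>2) \<le> 1"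
proof -
  define u where "u = (\<lambda>\<theta>. exp (\<i> * of_real (t * sin \<theta>)))"
  define e where "e = (\<lambda>m \<theta>. exp (\<i> * (of_int m * of_real \<theta>)))"
  define b where "b = (\<lambda>m. bessel m (of_real t))"
  define s where "s = (\<lambda>\<theta>. \<Sum>m\<in>F. b m * e m \<theta>)"
  define N where "N = (\<Sum>m\<in>F. (norm (b m))\<^sup>2)"
  have cont: "continuous_on {-pi..pi} u" "continuous_on {-pi..pi} (e m)" "continuous_on {-pi..pi} s" for m
    unfolding u_def e_def s_def by (intro continuous_intros)+
  have cnje: "cnj (e m \<theta>) = e (- m) \<theta>" for m \<theta> by (simp add: e_def exp_cnj)
  have ie: "((\<lambda>\<theta>. e m \<theta> * cnj (e k \<theta>)) has_integral (if m = k then 2 * of_real pi else 0)) {-pi..pi}" for m k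
    using has_integral_exp_int[of "m - k"] unfolding cnje by (simp add: e_def exp_add[symmetric] algebra_simps)
  have iu: "((\<lambda>\<theta>. u \<theta> * cnj (e m \<theta>)) has_integral (2 * of_real pi * b m)) {-pi..pi}" for m
  proof -
    have "(\<lambda>\<theta>. u \<theta> * cnj (e m \<theta>)) = (\<lambda>\<theta>. exp (\<i> * (of_real t * of_real (sin \<theta>) - of_int m * of_real \<theta>)))"
      unfolding cnje by (auto simp: u_def e_def exp_add[symmetric] algebra_simps)
    moreover have "\<dots> integrable_on {-pi..pi}"
      by (intro integrable_continuous_interval continuous_intros)
    ultimately show ?thesis by (simp add: b_def bessel_def integrable_integral)
  qed
  have ius: "((\<lambda>\<theta>. u \<theta> * cnj (s \<theta>)) has_integral (2 * of_real pi * of_real N)) {-pi..pi}"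
  proof -
    have "((\<lambda>\<theta>. \<Sum>m\<in>F. cnj (b m) * (u \<theta> * cnj (e m \<theta>))) has_integral (\<Sum>m\<in>F. cnj (b m) * (2 * of_real pi * b m))) {-pi..pi}"
      using assms by (intro has_integral_sum has_integral_mult_right iu) auto
    moreover have "(\<Sum>m\<in>F. cnj (b m) * (2 * of_real pi * b m)) = 2 * of_real pi * of_real N"
      by (simp add: N_def sum_distrib_left complex_norm_square mult_ac del: of_real_power)
    moreover have "(\<lambda>\<theta>. \<Sum>m\<in>F. cnj (b m) * (u \<theta> * cnj (e m \<theta>))) = (\<lambda>\<theta>. u \<theta> * cnj (s \<theta>))"
      by (auto simp: s_def sum_distrib_left mult_ac)
    ultimately show ?thesis by simp
  qed
  have iss: "((\<lambda>\<theta>. s \<theta> * cnj (s \<theta>)) has_integral (2 * of_real pi * of_real N)) {-pi..pi}"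
  proof -
    have "((\<lambda>\<theta>. \<Sum>m\<in>F. \<Sum>k\<in>F. b m * cnj (b k) * (e m \<theta> * cnj (e k \<theta>))) has_integral
        (\<Sum>m\<in>F. \<Sum>k\<in>F. b m * cnj (b k) * (if m = k then 2 * of_real pi else 0))) {-pi..pi}"
      using assms by (intro has_integral_sum has_integral_mult_right ie) auto
    moreover have "(\<Sum>m\<in>F. \<Sum>k\<in>F. b m * cnj (b k) * (if m = k then 2 * of_real pi else 0)) = 2 * of_real pi * of_real N"
      using assms by (simp add: N_def sum_distrib_left complex_norm_square mult_ac if_distrib cong: if_cong del: of_real_power)
    moreover have "(\<lambda>\<theta>. \<Sum>m\<in>F. \<Sum>k\<in>F. b m * cnj (b k) * (e m \<theta> * cnj (e k \<theta>))) = (\<lambda>\<theta>. s \<theta> * cnj (s \<theta>))"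
      by (auto simp: s_def sum_product mult_ac)
    ultimately show ?thesis by simp
  qed
  have isu: "((\<lambda>\<theta>. s \<theta> * cnj (u \<theta>)) has_integral (2 * of_real pi * of_real N)) {-pi..pi}"
    using has_integral_cnj[of "\<lambda>\<theta>. u \<theta> * cnj (s \<theta>)" "2 * of_real pi * of_real N"] ius by (simp add: o_def mult.commute)
  have uu: "u \<theta> * cnj (u \<theta>) = 1" for \<theta>
    by (simp add: u_def exp_cnj exp_add[symmetric])
  have iuu: "((\<lambda>\<theta>. u \<theta> * cnj (u \<theta>)) has_integral 2 * of_real pi) {-pi..pi}"
    using has_integral_const_real[of "1::complex" "-pi" pi] by (simp add: uu scaleR_conv_of_real)
  have "((\<lambda>\<theta>. u \<theta> * cnj (u \<theta>) - u \<theta> * cnj (s \<theta>) - s \<theta> * cnj (u \<theta>) + s \<theta> * cnj (s \<theta>)) has_integral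
      (2 * of_real pi - 2 * of_real pi * of_real N - 2 * of_real pi * of_real N + 2 * of_real pi * of_real N)) {-pi..pi}"
    by (intro has_integral_add has_integral_diff iuu ius isu iss)
  then have "((\<lambda>\<theta>. Re (u \<theta> * cnj (u \<theta>) - u \<theta> * cnj (s \<theta>) - s \<theta> * cnj (u \<theta>) + s \<theta> * cnj (s \<theta>))) has_integral
     Re (2 * of_real pi - 2 * of_real pi * of_real N - 2 * of_real pi * of_real N + 2 * of_real pi * of_real N)) {-pi..pi}"
    by (rule has_integral_Re)
  moreover have "Re (u \<theta> * cnj (u \<theta>) - u \<theta> * cnj (s \<theta>) - s \<theta> * cnj (u \<theta>) + s \<theta> * cnj (s \<theta>)) = (norm (u \<theta> - s \<theta>))\<^sup>2" for \<theta>
    unfolding cmod_power2 by (simp add: power2_eq_square algebra_simps)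
  ultimately have "((\<lambda>\<theta>. (norm (u \<theta> - s \<theta>))\<^sup>2) has_integral (2 * pi - 2 * pi * N)) {-pi..pi}" by (simp add: algebra_simps)
  then have "0 \<le> 2 * pi - 2 * pi * N" by (rule has_integral_nonneg) simp
  then have "2 * pi * N \<le> 2 * pi * 1" by simp
  then have "N \<le> 1" using pi_gt_zero by (subst (asm) mult_le_cancel_left_pos) auto
  then show ?thesis by (simp add: N_def b_def)
qed

lemma norm_bessel_le_1: "norm (bessel m (of_real t)) \<le> 1"
  using sum_norm_bessel_le[of "{m}" t] by (simp add: power2_le_imp_le abs_square_le_1)

text \<open>Van der Corput: integrate by parts against \<open>w = 1 / phi'\<close>. Concavity makes
  w nondecreasing, so its total variation is \<open>w b - w a\<close>, and everything reduces to
  four boundary terms of size at most \<open>1 / mu\<close>.\<close>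

lemma van_der_Corput_first:
  fixes \<phi> \<phi>' \<phi>'' :: "real \<Rightarrow> real"
  assumes ab: "a \<le> b" and \<mu>: "\<mu> > 0"
    and d1: "\<And>x. x \<in> {a..b} \<Longrightarrow> (\<phi> has_real_derivative \<phi>' x) (at x)"
    and d2: "\<And>x. x \<in> {a..b} \<Longrightarrow> (\<phi>' has_real_derivative \<phi>'' x) (at x)"
    and conc: "\<And>x. x \<in> {a..b} \<Longrightarrow> \<phi>'' x \<le> 0"
    and cont: "continuous_on {a..b} \<phi>''"
    and lower: "\<And>x. x \<in> {a..b} \<Longrightarrow> \<mu> \<le> \<bar>\<phi>' x\<bar>"
  shows "norm (integral {a..b} (\<lambda>x. cis (\<phi> x))) \<le> 4 / \<mu>"
proof -
  define w where "w = (\<lambda>x. 1 / \<phi>' x)"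
  define w' where "w' = (\<lambda>x. - \<phi>'' x / (\<phi>' x)\<^sup>2)"
  have nz: "\<phi>' x \<noteq> 0" if "x \<in> {a..b}" for x using lower[OF that] \<mu> by auto
  have cont1: "continuous_on {a..b} \<phi>" "continuous_on {a..b} \<phi>'"
    using d1 d2 by (meson DERIV_isCont continuous_at_imp_continuous_on)+
  have dw: "(w has_real_derivative w' x) (at x)" if "x \<in> {a..b}" for x
    unfolding w_def w'_def using d2[OF that] nz[OF that]
    by (auto intro!: derivative_eq_intros simp: power2_eq_square)
  have cw': "continuous_on {a..b} w'" unfolding w'_def
    using cont cont1 nz by (intro continuous_intros) auto
  have cis_cont: "continuous_on {a..b} (\<lambda>x. cis (\<phi> x))"
    using cont1 by (intro continuous_intros)
  have FTC: "((\<lambda>x. \<i> * cis (\<phi> x) + cis (\<phi> x) * of_real (w' x)) has_integral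
      cis (\<phi> b) * of_real (w b) - cis (\<phi> a) * of_real (w a)) {a..b}"
  proof (rule fundamental_theorem_of_calculus[OF ab])
    fix x assume x: "x \<in> {a..b}"
    have "((\<lambda>x. cis (\<phi> x) * of_real (w x)) has_vector_derivative
       cis (\<phi> x) * of_real (w' x) + (\<phi>' x *\<^sub>R (\<i> * cis (\<phi> x))) * of_real (w x)) (at x)"
    proof (intro has_vector_derivative_mult)
      show "((\<lambda>x. of_real (w x)) has_vector_derivative (of_real (w' x) :: complex)) (at x)"
        using dw[OF x] has_vector_derivative_of_real has_real_derivative_iff_has_vector_derivative by blast
      have "((cis \<circ> \<phi>) has_vector_derivative \<phi>' x *\<^sub>R (\<i> * cis (\<phi> x))) (at x)"
        using d1[OF x] unfolding has_real_derivative_iff_has_vector_derivative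
        by (rule vector_diff_chain_at)
          (auto simp: has_vector_derivative_def intro!: derivative_eq_intros)
      then show "((\<lambda>x. cis (\<phi> x)) has_vector_derivative \<phi>' x *\<^sub>R (\<i> * cis (\<phi> x))) (at x)"
        by (simp add: o_def)
    qed
    moreover have "(\<phi>' x *\<^sub>R (\<i> * cis (\<phi> x))) * of_real (w x) = \<i> * cis (\<phi> x)"
      using nz[OF x] by (simp add: w_def scaleR_conv_of_real field_simps)
    ultimately show "((\<lambda>x. cis (\<phi> x) * of_real (w x)) has_vector_derivative
       \<i> * cis (\<phi> x) + cis (\<phi> x) * of_real (w' x)) (at x within {a..b})"
      by (simp add: has_vector_derivative_at_within add.commute)
  qed
  have i1: "(\<lambda>x. \<i> * cis (\<phi> x)) integrable_on {a..b}"
    using cont1 by (intro integrable_continuous_interval continuous_intros)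
  have i2: "(\<lambda>x. cis (\<phi> x) * of_real (w' x)) integrable_on {a..b}"
    using cont1 cw' by (intro integrable_continuous_interval continuous_intros)
  have w'i: "(w' has_integral (w b - w a)) {a..b}"
    using ab dw by (intro fundamental_theorem_of_calculus)
      (auto simp: has_real_derivative_iff_has_vector_derivative[symmetric] intro: DERIV_subset)
  have "\<i> * integral {a..b} (\<lambda>x. cis (\<phi> x)) = integral {a..b} (\<lambda>x. \<i> * cis (\<phi> x))"
    by simp
  also have "\<dots> = cis (\<phi> b) * of_real (w b) - cis (\<phi> a) * of_real (w a) - integral {a..b} (\<lambda>x. cis (\<phi> x) * of_real (w' x))"
    using integral_unique[OF FTC] integral_add[OF i1 i2] by (simp add: algebra_simps)
  finally have "norm (integral {a..b} (\<lambda>x. cis (\<phi> x))) =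
     norm (cis (\<phi> b) * of_real (w b) - cis (\<phi> a) * of_real (w a) - integral {a..b} (\<lambda>x. cis (\<phi> x) * of_real (w' x)))"
    by (metis norm_ii norm_mult mult_1)
  also have "\<dots> \<le> \<bar>w b\<bar> + \<bar>w a\<bar> + norm (integral {a..b} (\<lambda>x. cis (\<phi> x) * of_real (w' x)))"
    by (intro order.trans[OF norm_triangle_ineq4] add_mono order.refl) (auto simp: norm_mult)
  also have "norm (integral {a..b} (\<lambda>x. cis (\<phi> x) * of_real (w' x))) \<le> integral {a..b} w'"
    using i2 w'i conc by (intro integral_norm_bound_integral)
      (auto simp: norm_mult norm_divide norm_power w'_def has_integral_integrable)
  also have "\<dots> = w b - w a" using w'i by (rule integral_unique)
  also have "\<bar>w b\<bar> + \<bar>w a\<bar> + (w b - w a) \<le> 1 / \<mu> + 1 / \<mu> + (1 / \<mu> + 1 / \<mu>)"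
  proof -
    have "\<bar>w x\<bar> \<le> 1 / \<mu>" if "x \<in> {a..b}" for x
      using lower[OF that] \<mu> by (simp add: w_def frac_le)
    from this[of a] this[of b] show ?thesis using ab by simp
  qed
  finally show ?thesis by simp
qed


text \<open>The integral over the negative half is the conjugate of the one over the positive half,
  and theta -> pi - theta changes the sign of m up to a unimodular factor. On \<open>{0..pi}\<close>
  the sine is nonnegative, so the phase is concave there.\<close>

lemma norm_bessel_le_half_integral:
  "norm (bessel m (of_real t)) \<le> norm (integral {0..pi} (\<lambda>\<theta>. cis (t * sin \<theta> - real_of_int \<bar>m\<bar> * \<theta>)))"
proof -
  let ?f = "\<lambda>m \<theta>. cis (t * sin \<theta> - real_of_int m * \<theta>)"
  have i: "?f m integrable_on {a..b}" for m a b
    by (intro integrable_continuous_interval continuous_intros)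
  have refl: "norm (integral {0..pi} (?f (-m))) = norm (integral {0..pi} (?f m))" for m
  proof -
    have "integral {0..pi} (?f (-m)) = integral {-pi..0} (\<lambda>\<theta>. ?f (-m) (- \<theta>))"
      using Henstock_Kurzweil_Integration.integral_reflect_real[of 0 "- pi" "\<lambda>\<theta>. ?f (-m) (- \<theta>)"] by simp
    also have "\<dots> = integral {0..pi} (\<lambda>\<theta>. ?f (-m) (- (\<theta> - pi)))"
      using integral_shift_Icc_real[of "- pi" 0 "\<lambda>\<theta>. ?f (-m) (- (\<theta> - pi))" pi] by (simp add: o_def)
    also have "(\<lambda>\<theta>. ?f (-m) (- (\<theta> - pi))) = (\<lambda>\<theta>. cis (real_of_int m * pi) * ?f m \<theta>)"
    proof
      fix \<theta>
      have "sin (- (\<theta> - pi)) = sin \<theta>" by simp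
      then show "?f (-m) (- (\<theta> - pi)) = cis (real_of_int m * pi) * ?f m \<theta>"
        unfolding cis_mult by (simp add: algebra_simps)
    qed
    finally show ?thesis by (simp add: norm_mult)
  qed
  have e: "exp (\<i> * (of_real t * of_real (sin \<theta>) - of_int m * of_real \<theta>)) = ?f m \<theta>" for \<theta>
    by (simp add: cis_conv_exp)
  have "bessel m (of_real t) = 1 / (2 * of_real pi) * integral {-pi..pi} (?f m)"
    by (simp only: bessel_def e)
  also have "integral {-pi..pi} (?f m) = integral {-pi..0} (?f m) + integral {0..pi} (?f m)"
    by (rule Henstock_Kurzweil_Integration.integral_combine[symmetric]) (use i in auto)
  also have "integral {-pi..0} (?f m) = integral {0..pi} (\<lambda>\<theta>. ?f m (- \<theta>))"
    using Henstock_Kurzweil_Integration.integral_reflect_real[of 0 "- pi" "?f m"] by simp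
  also have "(\<lambda>\<theta>. ?f m (- \<theta>)) = (\<lambda>\<theta>. cnj (?f m \<theta>))"
    by (auto simp: cis_cnj)
  also have "integral {0..pi} (\<lambda>\<theta>. cnj (?f m \<theta>)) = cnj (integral {0..pi} (?f m))"
    by (rule integral_cnj[symmetric])
  finally have eq: "bessel m (of_real t) = 1 / (2 * of_real pi) * (cnj (integral {0..pi} (?f m)) + integral {0..pi} (?f m))" .
  have "norm (bessel m (of_real t)) \<le> 1 / (2 * pi) * (norm (integral {0..pi} (?f m)) + norm (integral {0..pi} (?f m)))"
    using norm_triangle_ineq[of "cnj (integral {0..pi} (?f m))" "integral {0..pi} (?f m)"]
    unfolding eq norm_mult by (intro mult_mono) (auto simp: norm_divide norm_mult)
  also have "\<dots> = norm (integral {0..pi} (?f m)) / pi" by simp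
  also have "\<dots> \<le> norm (integral {0..pi} (?f m)) / 1"
    using pi_gt3 by (intro divide_left_mono) auto
  also have "\<dots> = norm (integral {0..pi} (?f m))" by simp
  also have "norm (integral {0..pi} (?f m)) = norm (integral {0..pi} (?f \<bar>m\<bar>))"
    using refl[of m] by (auto simp: abs_if)
  finally show ?thesis .
qed

text \<open>The window of radius \<open>eta\<close> around \<open>alpha\<close> contributes at most
  its length; on each of the two remaining intervals van der Corput gives
  \<open>4 / mu\<close>.\<close>

lemma oscillatory_integral_le:
  assumes t: "t > 0" and \<mu>: "\<mu> > 0" and \<eta>: "\<eta> \<ge> 0" and \<alpha>: "\<alpha> \<in> {0..pi}"
    and lower: "\<And>\<theta>. \<theta> \<in> {0..pi} \<Longrightarrow> \<eta> \<le> \<bar>\<theta> - \<alpha>\<bar> \<Longrightarrow> \<mu> \<le> \<bar>t * cos \<theta> - c\<bar>"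
  shows "norm (integral {0..pi} (\<lambda>\<theta>. cis (t * sin \<theta> - c * \<theta>))) \<le> 2 * \<eta> + 8 / \<mu>"
proof -
  let ?f = "\<lambda>\<theta>. cis (t * sin \<theta> - c * \<theta>)"
  define a where "a = max 0 (\<alpha> - \<eta>)"
  define b where "b = min pi (\<alpha> + \<eta>)"
  have ab: "0 \<le> a" "a \<le> b" "b \<le> pi" using \<eta> \<alpha> by (auto simp: a_def b_def)
  have i: "?f integrable_on {u..v}" for u v
    by (intro integrable_continuous_interval continuous_intros)
  have vdc: "norm (integral {u..v} ?f) \<le> 4 / \<mu>" if "0 \<le> u" "u \<le> v" "v \<le> pi" "\<And>\<theta>. \<theta> \<in> {u..v} \<Longrightarrow> \<eta> \<le> \<bar>\<theta> - \<alpha>\<bar>" for u v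
    by (rule van_der_Corput_first[where \<phi>' = "\<lambda>\<theta>. t * cos \<theta> - c" and \<phi>'' = "\<lambda>\<theta>. - (t * sin \<theta>)"])
      (use that \<mu> t lower in \<open>auto intro!: derivative_eq_intros continuous_intros sin_ge_zero mult_nonneg_nonneg\<close>)
  have split: "integral {0..pi} ?f = integral {0..a} ?f + (integral {a..b} ?f + integral {b..pi} ?f)"
    using Henstock_Kurzweil_Integration.integral_combine[of 0 a pi ?f]
      Henstock_Kurzweil_Integration.integral_combine[of a b pi ?f] ab i by simp
  have "norm (integral {0..pi} ?f) \<le> norm (integral {0..a} ?f) + (norm (integral {a..b} ?f) + norm (integral {b..pi} ?f))"
    unfolding split by (rule order.trans[OF norm_triangle_ineq add_left_mono[OF norm_triangle_ineq]])
  also have "norm (integral {0..a} ?f) \<le> 4 / \<mu>"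
  proof (cases "\<alpha> - \<eta> \<le> 0")
    case True
    then show ?thesis using \<mu> by (simp add: a_def max_def)
  next
    case False
    then show ?thesis using ab by (intro vdc) (auto simp: a_def)
  qed
  also have "norm (integral {b..pi} ?f) \<le> 4 / \<mu>"
  proof (cases "\<alpha> + \<eta> \<ge> pi")
    case True
    then show ?thesis using \<mu> by (simp add: b_def min_def)
  next
    case False
    then show ?thesis using ab by (intro vdc) (auto simp: b_def)
  qed
  also have "norm (integral {a..b} ?f) \<le> integral {a..b} (\<lambda>_. 1)"
    by (intro integral_norm_bound_integral i) auto
  also have "\<dots> \<le> 2 * \<eta>" using ab \<eta> by (auto simp: a_def b_def)
  finally show ?thesis by simp
qed

text \<open>Jordan's inequality: a concave function lies above its chord.\<close>

lemma sin_half_ge: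
  fixes x :: real
  assumes "0 \<le> x" "x \<le> pi"
  shows "x / pi \<le> sin (x / 2)"
proof -
  have "convex_on {0..pi/2} (\<lambda>x. - sin x)"
    by (rule convex_on_realI[where f' = "\<lambda>x. - cos x"])
      (auto intro!: derivative_eq_intros cos_monotone_0_pi_le)
  from convex_onD[OF this, of "x / pi" 0 "pi / 2"] assms
  show ?thesis by (simp add: field_simps)
qed

text \<open>The difference of cosines is 2 (p + q) (q - p) up to sign. The factor q - p is at least
  eta / pi in modulus. The factor p + q is at least |q - p|, which gives the quadratic bound used
  near the turning point, and at least sin (alpha / 2), which gives the linear bound used in the
  oscillatory range.\<close>

lemma cos_diff_bounds:
  fixes \<theta> \<alpha> :: real
  assumes \<theta>: "\<theta> \<in> {0..pi}" and \<alpha>: "\<alpha> \<in> {0..pi/2}" and \<eta>: "0 \<le> \<eta>" "\<eta> \<le> \<bar>\<theta> - \<alpha>\<bar>"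
  shows "2 * (\<eta> / pi)\<^sup>2 \<le> \<bar>cos \<theta> - cos \<alpha>\<bar>" "2 * (\<eta> / pi) * sin (\<alpha> / 2) \<le> \<bar>cos \<theta> - cos \<alpha>\<bar>"
proof -
  define p where "p = sin (\<theta> / 2) * cos (\<alpha> / 2)"
  define q where "q = cos (\<theta> / 2) * sin (\<alpha> / 2)"
  have nn: "sin (\<theta> / 2) \<ge> 0" "cos (\<theta> / 2) \<ge> 0" "sin (\<alpha> / 2) \<ge> 0" "cos (\<alpha> / 2) \<ge> 0"
    using \<theta> \<alpha> pi_gt_zero by (auto intro!: sin_ge_zero cos_ge_zero simp: field_simps)
  have pq: "p \<ge> 0" "q \<ge> 0" using nn by (auto simp: p_def q_def)
  have "cos \<theta> - cos \<alpha> = 2 * sin ((\<theta> + \<alpha>) / 2) * sin ((\<alpha> - \<theta>) / 2)"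
    by (rule cos_diff_cos)
  also have "sin ((\<theta> + \<alpha>) / 2) = p + q"
    by (simp add: p_def q_def add_divide_distrib sin_add)
  also have "sin ((\<alpha> - \<theta>) / 2) = q - p"
    by (simp add: p_def q_def diff_divide_distrib sin_diff mult.commute)
  finally have eq: "\<bar>cos \<theta> - cos \<alpha>\<bar> = 2 * (p + q) * \<bar>q - p\<bar>" using pq by (simp add: abs_mult)
  have "\<eta> / pi \<le> \<bar>\<theta> - \<alpha>\<bar> / pi" using \<eta> by (simp add: divide_right_mono)
  also have "\<dots> \<le> sin (\<bar>\<theta> - \<alpha>\<bar> / 2)" using \<theta> \<alpha> by (intro sin_half_ge) auto
  also have "\<dots> = \<bar>q - p\<bar>"
  proof (cases "\<theta> \<ge> \<alpha>")
    case True
    have "sin (\<bar>\<theta> - \<alpha>\<bar> / 2) = p - q" using True by (simp add: p_def q_def diff_divide_distrib sin_diff mult.commute)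
    moreover have "sin (\<bar>\<theta> - \<alpha>\<bar> / 2) \<ge> 0" using True \<theta> \<alpha> by (intro sin_ge_zero) auto
    ultimately show ?thesis by simp
  next
    case False
    have "sin (\<bar>\<theta> - \<alpha>\<bar> / 2) = q - p" using False by (simp add: p_def q_def diff_divide_distrib sin_diff mult.commute)
    moreover have "sin (\<bar>\<theta> - \<alpha>\<bar> / 2) \<ge> 0" using False \<theta> \<alpha> by (intro sin_ge_zero) auto
    ultimately show ?thesis by simp
  qed
  finally have d: "\<eta> / pi \<le> \<bar>q - p\<bar>" .
  have "\<eta> / pi \<le> p + q" using d pq by linarith
  then show "2 * (\<eta> / pi)\<^sup>2 \<le> \<bar>cos \<theta> - cos \<alpha>\<bar>"
    unfolding eq power2_eq_square mult.assoc using d \<eta> pq by (intro mult_left_mono mult_mono) auto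
  have "sin (\<alpha> / 2) \<le> cos (\<alpha> / 2)"
  proof -
    have "sin (\<alpha> / 2) = cos (pi / 2 - \<alpha> / 2)" by (simp add: cos_diff)
    also have "\<dots> \<le> cos (\<alpha> / 2)" using \<alpha> by (intro cos_monotone_0_pi_le) auto
    finally show ?thesis .
  qed
  have "1 \<le> sin (\<theta> / 2) + cos (\<theta> / 2)"
  proof -
    have "1 \<le> (sin (\<theta> / 2) + cos (\<theta> / 2))\<^sup>2"
      using nn by (simp add: power2_sum)
    then show ?thesis using nn power2_le_imp_le[of 1 "sin (\<theta> / 2) + cos (\<theta> / 2)"] by simp
  qed
  then have "sin (\<alpha> / 2) \<le> (sin (\<theta> / 2) + cos (\<theta> / 2)) * sin (\<alpha> / 2)"
    using nn by (metis mult_le_cancel_right1 not_le)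
  also have "\<dots> \<le> p + q"
    using nn \<open>sin (\<alpha> / 2) \<le> cos (\<alpha> / 2)\<close> by (simp add: p_def q_def ring_distribs mult.commute[of _ "sin (\<alpha> / 2)"] mult_right_mono mult.commute[of "sin (\<theta> / 2)"])
  finally show "2 * (\<eta> / pi) * sin (\<alpha> / 2) \<le> \<bar>cos \<theta> - cos \<alpha>\<bar>"
    unfolding eq mult.assoc mult.commute[of "\<eta> / pi"] using d \<eta> pq nn by (intro mult_left_mono mult_mono) auto
qed

text \<open>The phase \<open>t sin \<theta> - c \<theta>\<close> is stationary at \<open>\<alpha> = arccos (c / t)\<close>. Outside of an
  \<open>\<eta>\<close>-neighbourhood of \<open>\<alpha>\<close> its derivative is bounded below, and \<open>\<eta>\<close> is optimised
  in each regime.\<close>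

theorem bessel_decay:
  "\<exists>C>0. \<forall>m. \<forall>t\<ge>1. norm (bessel m (of_real t)) ^ 4 * (t * max 1 \<bar>t - real_of_int \<bar>m\<bar>\<bar>) \<le> C"
proof -
  \<comment> \<open>In the transition zone, with \<open>eta ^ 3 * t = 1\<close>, the bound
    \<open>2 * eta + 8 / mu\<close> becomes \<open>K * eta\<close>. The same K is large enough for
    the other two regimes.\<close>
  define K where "K = 2 + 4 * pi\<^sup>2"
  have K: "K > 6"
  proof -
    have "pi\<^sup>2 > 1" using pi_gt3 by (simp add: one_less_power)
    then show ?thesis by (simp add: K_def)
  qed
  have main: "norm (bessel m (of_real t)) ^ 4 * (t * max 1 \<bar>t - real_of_int \<bar>m\<bar>\<bar>) \<le> K ^ 4"
    if t: "t \<ge> 1" for m t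
  proof -
    define c where "c = real_of_int \<bar>m\<bar>"
    have c: "c \<ge> 0" by (simp add: c_def)
    define I where "I = norm (integral {0..pi} (\<lambda>\<theta>. cis (t * sin \<theta> - c * \<theta>)))"
    have I0: "I \<ge> 0" by (simp add: I_def)
    \<comment> \<open>For c > t there is no stationary point; the derivative of the phase is then
      smallest in modulus at 0, so 0 replaces it.\<close>
    define \<alpha> where "\<alpha> = (if c \<le> t then arccos (c / t) else 0)"
    have \<alpha>: "\<alpha> \<in> {0..pi/2}" using c t
      using arccos_lbound[of "c / t"] order.trans[of "-1" 0 "c / t"] arccos_le_pi2[of "c / t"] by (auto simp: \<alpha>_def divide_le_eq_1)
    have cos\<alpha>: "c \<le> t \<Longrightarrow> t * cos \<alpha> = c" "c > t \<Longrightarrow> cos \<alpha> = 1"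
      using c t cos_arccos[of "c / t"] order.trans[of "-1" 0 "c / t"] by (auto simp: \<alpha>_def)
    have ge: "t * \<bar>cos \<theta> - cos \<alpha>\<bar> \<le> \<bar>t * cos \<theta> - c\<bar>" for \<theta>
    proof (cases "c \<le> t")
      case True
      have "t * \<bar>cos \<theta> - cos \<alpha>\<bar> = \<bar>t * (cos \<theta> - cos \<alpha>)\<bar>" using t by (simp add: abs_mult)
      then show ?thesis using cos\<alpha>(1)[OF True] by (simp add: algebra_simps)
    next
      case False
      then have "t * \<bar>cos \<theta> - cos \<alpha>\<bar> = t - t * cos \<theta>" using cos\<alpha> t abs_of_nonpos[of "cos \<theta> - 1"] by (simp add: algebra_simps)
      also have "\<dots> \<le> c - t * cos \<theta>" using False by simp
      finally show ?thesis by linarith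
    qed
    have I_le_t: "I ^ 4 * t \<le> K ^ 4 / t powr (1/3)"
    proof -
      \<comment> \<open>The Airy scale: it balances the window \<open>2 * eta\<close> against
        \<open>8 / mu\<close>, where mu is of order \<open>t * eta^2\<close>.\<close>
      define \<eta> where "\<eta> = t powr (- (1/3))"
      have \<eta>: "\<eta> > 0" using t by (simp add: \<eta>_def)
      have \<eta>3: "\<eta> ^ 3 * t = 1" using t by (simp add: \<eta>_def powr_power powr_minus field_simps)
      have "I \<le> 2 * \<eta> + 8 / (2 * t * (\<eta> / pi)\<^sup>2)"
        unfolding I_def
      proof (rule oscillatory_integral_le)
        show "2 * t * (\<eta> / pi)\<^sup>2 \<le> \<bar>t * cos \<theta> - c\<bar>" if "\<theta> \<in> {0..pi}" "\<eta> \<le> \<bar>\<theta> - \<alpha>\<bar>" for \<theta>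
        proof -
          have "t * (2 * (\<eta> / pi)\<^sup>2) \<le> t * \<bar>cos \<theta> - cos \<alpha>\<bar>"
            using that \<alpha> \<eta> t by (intro mult_left_mono cos_diff_bounds) auto
          then show ?thesis using ge[of \<theta>] by (simp add: mult_ac)
        qed
      qed (use t \<eta> \<alpha> in auto)
      also have "8 / (2 * t * (\<eta> / pi)\<^sup>2) = 4 * pi\<^sup>2 * \<eta> / (\<eta> ^ 3 * t)"
        using \<eta> t by (simp add: divide_simps power2_eq_square power3_eq_cube)
      also have "2 * \<eta> + 4 * pi\<^sup>2 * \<eta> / (\<eta> ^ 3 * t) = K * \<eta>" unfolding \<eta>3 by (simp add: K_def algebra_simps)
      finally have "I ^ 4 \<le> (K * \<eta>) ^ 4" using I0 by (intro power_mono)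
      then have "I ^ 4 * t \<le> (K * \<eta>) ^ 4 * t" using t by (intro mult_right_mono) auto
      also have "\<dots> = K ^ 4 * \<eta> * (\<eta> ^ 3 * t)" by (simp add: power_mult_distrib power_numeral_reduce)
      also have "\<dots> = K ^ 4 / t powr (1/3)" unfolding \<eta>3 by (simp add: \<eta>_def powr_minus_divide)
      finally show ?thesis .
    qed
    have t3: "t powr (1/3) \<ge> 1" using t by (simp add: ge_one_powr_ge_zero)
    have K4: "K ^ 4 > 0" using K by simp
    have goal: "I ^ 4 * (t * max 1 \<bar>t - c\<bar>) \<le> K ^ 4"
    proof -
      \<comment> \<open>The transition zone around t = c, the region c > t without stationary
        points, and the oscillatory region c < t.\<close>
      consider "\<bar>t - c\<bar> \<le> t powr (1/3)" "c > t \<or> \<bar>t - c\<bar> \<le> 1" | "c > t" "c - t > t powr (1/3)" | "t - c > 1"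
        using t3 by fastforce
      then show ?thesis
      proof cases
        case 1
        have "max 1 \<bar>t - c\<bar> \<le> t powr (1/3)" using 1 t3 by simp
        then have "I ^ 4 * t * max 1 \<bar>t - c\<bar> \<le> (K ^ 4 / t powr (1/3)) * t powr (1/3)"
          using I_le_t I0 K4 by (intro mult_mono) auto
        then show ?thesis using t by (simp add: mult.assoc)
      next
        case 2
        \<comment> \<open>Without a stationary point no window has to be cut out, so the radius is
          0.\<close>
        have "I \<le> 2 * 0 + 8 / (c - t)" unfolding I_def
        proof (rule oscillatory_integral_le[where \<alpha> = 0])
          show "c - t \<le> \<bar>t * cos \<theta> - c\<bar>" for \<theta>
          proof -
            have "t * cos \<theta> \<le> t * 1" using t by (intro mult_left_mono) auto
            then show ?thesis by linarith
          qed
        qed (use 2 t in auto)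
        then have "I ^ 4 \<le> (8 / (c - t)) ^ 4" using I0 by (intro power_mono) auto
        then have "I ^ 4 * (t * (c - t)) \<le> (8 / (c - t)) ^ 4 * (t * (c - t))"
          using t 2 by (intro mult_right_mono) auto
        also have "\<dots> = 8 ^ 4 * (t / (c - t) ^ 3)"
        proof -
          define x where "x = c - t"
          have "x > 0" using 2 by (simp add: x_def)
          then show ?thesis unfolding x_def[symmetric] by (simp add: divide_simps power_numeral_reduce)
        qed
        \<comment> \<open>This is where the distance of more than t^(1/3) from the transition zone
          enters.\<close>
        also have "t / (c - t) ^ 3 \<le> 1"
        proof -
          have "t = (t powr (1/3)) ^ 3" using t by (simp add: powr_power)
          also have "\<dots> \<le> (c - t) ^ 3" using 2 t3 by (intro power_mono) auto
          finally show ?thesis using 2 by simp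
        qed
        also have "(8::real) ^ 4 * 1 \<le> K ^ 4"
        proof -
          have "pi\<^sup>2 \<ge> 3\<^sup>2" using pi_gt3 by (intro power_mono) auto
          then have "8 \<le> K" by (simp add: K_def)
          then have "8 ^ 4 \<le> K ^ 4" by (rule power_mono) simp
          then show ?thesis by simp
        qed
        finally show ?thesis using 2 t3 by (simp add: max_def abs_if del: power_mult_distrib)
      next
        case 3
        \<comment> \<open>Up to a factor of at most sqrt 2, s is the modulus sqrt (t^2 - c^2) of the
          second derivative of the phase at \<open>alpha\<close>, and 1 / sqrt s is the
          corresponding stationary phase width.\<close>
        define s where "s = sqrt (t * (t - c))"
        have s: "s > 0" using 3 t by (simp add: s_def)
        define \<eta> where "\<eta> = 1 / sqrt s"
        have \<eta>: "\<eta> > 0" using s by (simp add: \<eta>_def)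
        have ct: "c \<le> t" using 3 by simp
        have "(t * sin (\<alpha> / 2))\<^sup>2 = t * (t * (1 - cos \<alpha>)) / 2"
          using cos_double_sin[of "\<alpha> / 2"] by (simp add: power_mult_distrib power2_eq_square[of t])
        also have "t * (1 - cos \<alpha>) = t - c" using cos\<alpha>(1)[OF ct] by (simp add: algebra_simps)
        finally have "(t * sin (\<alpha> / 2))\<^sup>2 = s\<^sup>2 / 2" using 3 t by (simp add: s_def)
        also have "\<dots> \<ge> (s / 2)\<^sup>2" by (simp add: power2_eq_square)
        finally have "(s / 2)\<^sup>2 \<le> (t * sin (\<alpha> / 2))\<^sup>2" .
        moreover have "0 \<le> t * sin (\<alpha> / 2)"
          using \<alpha> t by (intro mult_nonneg_nonneg sin_ge_zero) auto
        ultimately have ts: "s / 2 \<le> t * sin (\<alpha> / 2)" by (rule power2_le_imp_le)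
        have "I \<le> 2 * \<eta> + 8 / (\<eta> / pi * s)" unfolding I_def
        proof (rule oscillatory_integral_le)
          show "\<eta> / pi * s \<le> \<bar>t * cos \<theta> - c\<bar>" if "\<theta> \<in> {0..pi}" "\<eta> \<le> \<bar>\<theta> - \<alpha>\<bar>" for \<theta>
          proof -
            have "\<eta> / pi * s \<le> 2 * (\<eta> / pi) * (t * sin (\<alpha> / 2))"
              using mult_left_mono[OF ts, of "2 * (\<eta> / pi)"] \<eta> by simp
            also have "\<dots> = t * (2 * (\<eta> / pi) * sin (\<alpha> / 2))" by simp
            also have "\<dots> \<le> t * \<bar>cos \<theta> - cos \<alpha>\<bar>"
              using that \<alpha> \<eta> t by (intro mult_left_mono cos_diff_bounds) auto
            finally show ?thesis using ge[of \<theta>] by simp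
          qed
        qed (use t \<eta> s \<alpha> in auto)
        also have "8 / (\<eta> / pi * s) = 8 * pi * \<eta>"
          using s by (simp add: \<eta>_def field_simps power2_eq_square[symmetric])
        also have "2 * \<eta> + 8 * pi * \<eta> \<le> K * \<eta>"
        proof -
          have "2 * 3 * pi \<le> 2 * (pi * pi)" using pi_gt3 by simp
          then have "8 * pi \<le> 4 * pi\<^sup>2" by (simp add: power2_eq_square)
          then have "(2 + 8 * pi) * \<eta> \<le> K * \<eta>" using \<eta> by (intro mult_right_mono) (auto simp: K_def)
          then show ?thesis by (simp add: algebra_simps)
        qed
        finally have "I ^ 4 \<le> (K * \<eta>) ^ 4" using I0 by (intro power_mono)
        then have "I ^ 4 * s\<^sup>2 \<le> (K * \<eta>) ^ 4 * s\<^sup>2" by (intro mult_right_mono) auto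
        also have "\<dots> = K ^ 4"
        proof -
          have "\<eta> ^ 4 = 1 / (sqrt s ^ 2) ^ 2" by (simp add: \<eta>_def power_divide flip: power_mult)
          then show ?thesis using s by (simp add: power_mult_distrib)
        qed
        finally show ?thesis using 3 t by (simp add: s_def max_def abs_if)
      qed
    qed
    have "norm (bessel m (of_real t)) ^ 4 * (t * max 1 \<bar>t - c\<bar>) \<le> I ^ 4 * (t * max 1 \<bar>t - c\<bar>)"
      using norm_bessel_le_half_integral[of m t] t unfolding I_def c_def
      by (intro mult_right_mono power_mono) auto
    then show ?thesis using goal by (simp add: c_def)
  qed
  have "K ^ 4 > 0" using K by simp
  then show ?thesis using main by blast
qed

section \<open>The free propagator\<close>

unbundle no vec_syntax

section \<open>The lattice Laplacian and the kernel of its unitary group\<close>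

definition unit_steps :: "(int ^ 'd::finite) set" where
  "unit_steps = (\<lambda>(i, s). axis i s) ` (UNIV \<times> {1, -1})"

lemma lattice_norm_eq_1_iff: "lattice_norm n = 1 \<longleftrightarrow> n \<in> unit_steps"
proof
  assume "n \<in> unit_steps"
  then obtain i s where n: "n = axis i s" and s: "s = 1 \<or> s = -1" by (auto simp: unit_steps_def)
  have "vec_lambda (\<lambda>j. real_of_int (vec_nth n j)) = real_of_int s *\<^sub>R axis i 1"
    by (simp add: n axis_def Finite_Cartesian_Product.vec_eq_iff)
  then show "lattice_norm n = 1" using s by (auto simp: lattice_norm_def)
next
  assume "lattice_norm n = 1"
  then have "(\<Sum>i\<in>UNIV. (real_of_int (vec_nth n i))\<^sup>2) = 1"
    by (simp add: lattice_norm_def norm_vec_def L2_set_def)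
  then have "of_int (\<Sum>i\<in>UNIV. (vec_nth n i)\<^sup>2) = (of_int 1 :: real)" by simp
  then have sum: "(\<Sum>i\<in>UNIV. (vec_nth n i)\<^sup>2) = 1" by (simp only: of_int_eq_iff)
  then obtain i where i: "vec_nth n i \<noteq> 0" by (metis (mono_tags, lifting) power_zero_numeral sum.neutral zero_neq_one)
  have "(\<Sum>j\<in>UNIV. (vec_nth n j)\<^sup>2) = (vec_nth n i)\<^sup>2 + (\<Sum>j\<in>UNIV - {i}. (vec_nth n j)\<^sup>2)"
    by (simp add: sum.remove)
  moreover have "(vec_nth n i)\<^sup>2 \<ge> 1" using i by (simp add: int_one_le_iff_zero_less)
  moreover have "(\<Sum>j\<in>UNIV - {i}. (vec_nth n j)\<^sup>2) \<ge> 0" by (simp add: sum_nonneg)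
  ultimately have *: "(vec_nth n i)\<^sup>2 = 1" "(\<Sum>j\<in>UNIV - {i}. (vec_nth n j)\<^sup>2) = 0" using sum by auto
  from *(2) have "vec_nth n j = 0" if "j \<noteq> i" for j
    using that by (subst (asm) sum_nonneg_eq_0_iff) auto
  then have "n = axis i (vec_nth n i)" by (auto simp: Finite_Cartesian_Product.vec_eq_iff axis_def)
  moreover have "vec_nth n i = 1 \<or> vec_nth n i = -1" using *(1) by (simp add: power2_eq_1_iff)
  ultimately show "n \<in> unit_steps" unfolding unit_steps_def by (intro image_eqI[where x = "(i, vec_nth n i)"]) auto
qed

lemma laplacian_eq:
  "laplacian f n = (\<Sum>i\<in>UNIV. f (n - axis i 1) + f (n + axis i 1)) / 2"
proof -
  have inj: "inj_on (\<lambda>(i, s). n - axis i s) (UNIV \<times> {1, -1 :: int})"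
    by (auto simp: inj_on_def axis_eq_axis)
  have "{m. lattice_norm (n - m) = 1} = (\<lambda>(i, s). n - axis i s) ` (UNIV \<times> {1, -1})"
  proof (intro Set.set_eqI iffI)
    fix m assume "m \<in> {m. lattice_norm (n - m) = 1}"
    then obtain i and s :: int where "s \<in> {1, -1}" "n - m = axis i s" by (auto simp: lattice_norm_eq_1_iff unit_steps_def)
    then have "m = n - axis i s" by (simp add: algebra_simps)
    then show "m \<in> (\<lambda>(i, s). n - axis i s) ` (UNIV \<times> {1, -1})" using \<open>s \<in> _\<close> by force
  next
    fix m assume "m \<in> (\<lambda>(i, s). n - axis i s) ` (UNIV \<times> {1, -1})"
    then show "m \<in> {m. lattice_norm (n - m) = 1}" by (force simp: lattice_norm_eq_1_iff unit_steps_def)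
  qed
  then have "(\<Sum>m | lattice_norm (n - m) = 1. f m) = (\<Sum>(i, s)\<in>UNIV \<times> {1, -1}. f (n - axis i s))"
    using sum.reindex[OF inj, of f] by (simp add: o_def split_beta)
  also have "\<dots> = (\<Sum>i\<in>UNIV. f (n - axis i 1) + f (n + axis i 1))"
  proof -
    have minus: "n - axis i (-1) = n + axis i 1" for i by (simp add: Finite_Cartesian_Product.vec_eq_iff axis_def)
    have "(\<Sum>(i, s)\<in>UNIV \<times> {1, -1}. f (n - axis i s)) = (\<Sum>i\<in>UNIV. f (n - axis i 1) + f (n - axis i (-1)))"
      by (simp add: sum.cartesian_product[symmetric])
    then show ?thesis unfolding minus .
  qed
  finally show ?thesis by (simp add: laplacian_def)
qed

text \<open>In dimension one the Laplacian is multiplication by cos theta in Fourier space, and by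
  the Jacobi-Anger expansion exp (i t cos theta) has the Fourier coefficients i^m J_m(t).\<close>

definition propagator1 :: "int \<Rightarrow> complex \<Rightarrow> complex" where
  "propagator1 m t = \<i> powi m * bessel m t"

text \<open>The kernel of \<open>exp (i t \<Delta>)\<close>.\<close>

definition propagator :: "int ^ 'd::finite \<Rightarrow> complex \<Rightarrow> complex" where
  "propagator n t = (\<Prod>i\<in>UNIV. propagator1 (vec_nth n i) t)"

lemma norm_propagator1: "norm (propagator1 m t) = norm (bessel m t)"
  by (simp add: propagator1_def norm_mult norm_power_int)

lemma has_field_derivative_propagator1:
  "(propagator1 m has_field_derivative \<i> * (propagator1 (m - 1) t + propagator1 (m + 1) t) / 2) (at t)"
proof -
  have "(propagator1 m has_field_derivative \<i> powi m * ((bessel (m - 1) t - bessel (m + 1) t) / 2)) (at t)"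
    unfolding propagator1_def[abs_def] by (intro DERIV_cmult has_field_derivative_bessel)
  also have "\<i> powi m * ((bessel (m - 1) t - bessel (m + 1) t) / 2) = \<i> * (propagator1 (m - 1) t + propagator1 (m + 1) t) / 2"
  proof -
    have "\<i> powi (m - 1) = - (\<i> * \<i> powi m)" "\<i> powi (m + 1) = \<i> * \<i> powi m"
      by (simp_all add: power_int_diff power_int_add)
    then show ?thesis by (simp add: propagator1_def algebra_simps)
  qed
  finally show ?thesis .
qed

text \<open>By the product rule, differentiating the factor of one coordinate produces the two
  neighbours in that coordinate direction.\<close>

lemma has_field_derivative_propagator:
  "(propagator n has_field_derivative \<i> * laplacian (\<lambda>m. propagator m t) n) (at t)"
proof -
  have step: "propagator (n + axis i s) t = propagator1 (vec_nth n i + s) t * (\<Prod>j\<in>UNIV - {i}. propagator1 (vec_nth n j) t)" for i s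
  proof -
    have "propagator (n + axis i s) t = propagator1 (vec_nth n i + s) t * (\<Prod>j\<in>UNIV - {i}. propagator1 (vec_nth (n + axis i s) j) t)"
      unfolding propagator_def by (subst prod.remove[of _ i]) (auto simp: axis_def)
    also have "(\<Prod>j\<in>UNIV - {i}. propagator1 (vec_nth (n + axis i s) j) t) = (\<Prod>j\<in>UNIV - {i}. propagator1 (vec_nth n j) t)"
      by (intro prod.cong) (auto simp: axis_def)
    finally show ?thesis .
  qed
  have minus: "n - axis i 1 = n + axis i (-1)" for i by (simp add: Finite_Cartesian_Product.vec_eq_iff axis_def)
  have "(propagator n has_field_derivative
     (\<Sum>i\<in>UNIV. \<i> * (propagator1 (vec_nth n i - 1) t + propagator1 (vec_nth n i + 1) t) / 2 * (\<Prod>j\<in>UNIV - {i}. propagator1 (vec_nth n j) t))) (at t)"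
    unfolding propagator_def[abs_def] by (intro has_field_derivative_prod has_field_derivative_propagator1)
  also have "(\<Sum>i\<in>UNIV. \<i> * (propagator1 (vec_nth n i - 1) t + propagator1 (vec_nth n i + 1) t) / 2 * (\<Prod>j\<in>UNIV - {i}. propagator1 (vec_nth n j) t))
      = \<i> * laplacian (\<lambda>m. propagator m t) n"
    unfolding laplacian_eq minus step
    by (simp only: sum_distrib_left sum_divide_distrib) (intro sum.cong refl, simp add: field_simps)
  finally show ?thesis .
qed

lemma propagator_at_0: "propagator n 0 = (if n = 0 then 1 else 0)"
proof (cases "n = 0")
  case True
  then show ?thesis by (simp add: propagator_def propagator1_def bessel_at_0)
next
  case False
  then obtain i where "vec_nth n i \<noteq> 0" by (auto simp: Finite_Cartesian_Product.vec_eq_iff)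
  then have "propagator1 (vec_nth n i) 0 = 0" by (simp add: propagator1_def bessel_at_0)
  then show ?thesis using False unfolding propagator_def by (simp add: prod_zero_iff) blast
qed

lemma norm_propagator: "norm (propagator n t) = (\<Prod>i\<in>UNIV. norm (bessel (vec_nth n i) t))"
  by (simp add: propagator_def prod_norm[symmetric] norm_propagator1)

lemma norm_propagator_le_1: "norm (propagator n (of_real t)) \<le> 1"
  unfolding norm_propagator by (intro prod_le_1) (auto simp: norm_bessel_le_1)

text \<open>The l2 form of unitarity. F lies in the cube of points with coordinates in
  \<open>B\<close>, and over a cube the sum of products is a product of one-dimensional sums, each
  at most 1.\<close>

lemma sum_norm_propagator_le:
  fixes F :: "(int ^ 'd::finite) set"
  assumes "finite F"
  shows "(\<Sum>n\<in>F. (norm (propagator n (of_real t)))\<^sup>2) \<le> 1"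
proof -
  define B where "B = (\<Union>n\<in>F. range (vec_nth n))"
  have B: "finite B" using assms by (auto simp: B_def)
  have inj: "inj_on vec_nth F" by (auto simp: inj_on_def Finite_Cartesian_Product.vec_eq_iff)
  have "(\<Sum>n\<in>F. (norm (propagator n (of_real t)))\<^sup>2) = (\<Sum>f\<in>vec_nth ` F. \<Prod>i\<in>UNIV. (norm (bessel (f i) (of_real t)))\<^sup>2)"
    by (simp add: sum.reindex[OF inj] norm_propagator prod_power_distrib)
  also have "\<dots> \<le> (\<Sum>f\<in>(PiE (UNIV :: 'd set) (\<lambda>_. B)). \<Prod>i\<in>UNIV. (norm (bessel (f i) (of_real t)))\<^sup>2)"
    by (intro sum_mono2 finite_PiE B) (auto simp: B_def intro!: prod_nonneg)
  also have "\<dots> = (\<Prod>i\<in>(UNIV::'d set). \<Sum>m\<in>B. (norm (bessel m (of_real t)))\<^sup>2)"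
    using B by (intro prod_sum_PiE[symmetric]) auto
  also have "\<dots> \<le> 1" using sum_norm_bessel_le[OF B, of t]
    by (intro prod_le_1) (auto intro!: sum_nonneg)
  finally show ?thesis .
qed

lemma continuous_on_propagator [continuous_intros]:
  "continuous_on S f \<Longrightarrow> continuous_on S (\<lambda>x. propagator n (f x))"
proof -
  have "continuous_on UNIV (propagator n)"
    using has_field_derivative_propagator by (meson DERIV_isCont continuous_at_imp_continuous_on)
  then show "continuous_on S f \<Longrightarrow> continuous_on S (\<lambda>x. propagator n (f x))"
    by (rule continuous_on_compose2) auto
qed

section \<open>Dyadic time intervals: l2 bounds and uniform decay\<close>

lemma integral_power2_le:
  fixes f :: "real \<Rightarrow> real"
  assumes "a \<le> b" and cont: "continuous_on {a..b} f"
  shows "(integral {a..b} f)\<^sup>2 \<le> (b - a) * integral {a..b} (\<lambda>x. (f x)\<^sup>2)"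
proof (cases "a = b")
  case False
  with assms have ab: "b - a > 0" by simp
  define c where "c = integral {a..b} f / (b - a)"
  have i: "f integrable_on {a..b}" "(\<lambda>x. (f x)\<^sup>2) integrable_on {a..b}"
    by (intro integrable_continuous_interval continuous_intros cont)+
  have "((\<lambda>x. (f x)\<^sup>2 - 2 * c * f x + c\<^sup>2) has_integral
     (integral {a..b} (\<lambda>x. (f x)\<^sup>2) - 2 * c * integral {a..b} f + (b - a) * c\<^sup>2)) {a..b}"
    using has_integral_const_real[of "c\<^sup>2" a b] ab
    by (intro has_integral_add has_integral_diff has_integral_mult_right integrable_integral i) auto
  moreover have "(f x)\<^sup>2 - 2 * c * f x + c\<^sup>2 = (f x - c)\<^sup>2" for x by (simp add: power2_eq_square algebra_simps)
  ultimately have "0 \<le> integral {a..b} (\<lambda>x. (f x)\<^sup>2) - 2 * c * integral {a..b} f + (b - a) * c\<^sup>2"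
    by (simp add: has_integral_nonneg)
  then have "0 \<le> (b - a) * (integral {a..b} (\<lambda>x. (f x)\<^sup>2) - 2 * c * integral {a..b} f + (b - a) * c\<^sup>2)"
    using ab by (intro mult_nonneg_nonneg) auto
  moreover have I: "integral {a..b} f = (b - a) * c" using ab by (simp add: c_def)
  ultimately show ?thesis unfolding I by (simp add: power2_eq_square algebra_simps)
qed simp

definition dyadic :: "nat \<Rightarrow> real" where
  "dyadic j = (if j = 0 then 0 else 2 ^ (j - 1))"

lemma dyadic_Suc [simp]: "dyadic (Suc j) = 2 ^ j" "dyadic 0 = 0" by (auto simp: dyadic_def)

lemma dyadic_mono: "dyadic j \<le> dyadic (Suc j)" and dyadic_nonneg: "0 \<le> dyadic j"
  by (cases j; simp)+

text \<open>Majorant for the share of the j-th time interval in the resolvent kernel, valid for all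
  l with Im l <= 0 at once. Interval 0 is [0, 1], where only the trivial bound 1 is used; interval j
  > 0 is [2^(j-1), 2^j].\<close>

definition prop_mass :: "nat \<Rightarrow> int ^ 'd::finite \<Rightarrow> real" where
  "prop_mass j n = integral {dyadic j..dyadic (Suc j)} (\<lambda>t. norm (propagator n (of_real t)))"

lemma prop_mass_nonneg: "0 \<le> prop_mass j n"
  unfolding prop_mass_def by (intro integral_nonneg integrable_continuous_interval continuous_intros) auto

lemma prop_mass_0_le: "prop_mass 0 n \<le> 1"
proof -
  have "prop_mass 0 n \<le> integral {dyadic 0..dyadic (Suc 0)} (\<lambda>t. 1)"
    unfolding prop_mass_def by (intro integral_le integrable_continuous_interval continuous_intros)
      (auto simp: norm_propagator_le_1)
  then show ?thesis by simp
qed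

text \<open>Cauchy-Schwarz in time on an interval of length at most \<open>2 ^ j\<close>, then
  unitarity at each fixed time. The weight is 1 for the bound up to the spectrum and
  \<open>exp (Im l * t)\<close> inside the half plane.\<close>

lemma weighted_prop_mass_sum_le:
  fixes F :: "(int ^ 'd::finite) set" and \<phi> :: "real \<Rightarrow> real"
  assumes F: "finite F" and \<phi>: "continuous_on {dyadic j..dyadic (Suc j)} \<phi>"
    and le: "\<And>t. t \<in> {dyadic j..dyadic (Suc j)} \<Longrightarrow> 0 \<le> \<phi> t \<and> \<phi> t \<le> c"
  shows "(\<Sum>n\<in>F. (integral {dyadic j..dyadic (Suc j)} (\<lambda>t. \<phi> t * norm (propagator n (of_real t))))\<^sup>2) \<le> (c * 2 ^ j)\<^sup>2"
proof -
  let ?I = "{dyadic j..dyadic (Suc j)}"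
  define L where "L = dyadic (Suc j) - dyadic j"
  have L: "0 \<le> L" "L \<le> 2 ^ j" using dyadic_mono[of j] dyadic_nonneg[of j] by (auto simp: L_def)
  have "c \<ge> 0" using le[of "dyadic j"] dyadic_mono[of j] by auto
  have i: "(\<lambda>t. (\<phi> t * norm (propagator n (of_real t)))\<^sup>2) integrable_on ?I" for n :: "int ^ 'd"
    by (intro integrable_continuous_interval continuous_intros \<phi>)
  have pw: "(\<Sum>n\<in>F. (\<phi> t * norm (propagator n (of_real t)))\<^sup>2) \<le> c\<^sup>2" if t: "t \<in> ?I" for t
  proof -
    have "(\<Sum>n\<in>F. (\<phi> t * norm (propagator n (of_real t)))\<^sup>2) = (\<phi> t)\<^sup>2 * (\<Sum>n\<in>F. (norm (propagator n (of_real t)))\<^sup>2)"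
      by (simp add: power_mult_distrib sum_distrib_left)
    also have "\<dots> \<le> c\<^sup>2 * 1"
      using le[OF t] by (intro mult_mono power_mono sum_nonneg sum_norm_propagator_le[OF F]) auto
    finally show ?thesis by simp
  qed
  have "(\<Sum>n\<in>F. (integral ?I (\<lambda>t. \<phi> t * norm (propagator n (of_real t))))\<^sup>2) \<le>
      (\<Sum>n\<in>F. L * integral ?I (\<lambda>t. (\<phi> t * norm (propagator n (of_real t)))\<^sup>2))"
    unfolding L_def by (intro sum_mono integral_power2_le dyadic_mono continuous_intros \<phi>)
  also have "\<dots> = L * integral ?I (\<lambda>t. \<Sum>n\<in>F. (\<phi> t * norm (propagator n (of_real t)))\<^sup>2)"
    using F i by (simp add: integral_sum sum_distrib_left)
  also have "\<dots> \<le> L * integral ?I (\<lambda>t. c\<^sup>2)"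
    using F i pw L(1) by (intro mult_left_mono[OF integral_le] integrable_sum integrable_const_ivl) auto
  also have "L * integral ?I (\<lambda>t. c\<^sup>2) = (c * L)\<^sup>2"
    using dyadic_mono[of j] by (simp add: L_def power2_eq_square)
  also have "\<dots> \<le> (c * 2 ^ j)\<^sup>2" using L \<open>c \<ge> 0\<close> by (intro power_mono mult_left_mono) auto
  finally show ?thesis .
qed

lemma prop_mass_sum_le:
  fixes F :: "(int ^ 'd::finite) set"
  assumes F: "finite F"
  shows "(\<Sum>n\<in>F. (prop_mass j n)\<^sup>2) \<le> 4 ^ j"
proof -
  have "((2::real) ^ j)\<^sup>2 = 4 ^ j" by (simp add: power2_eq_square flip: power_mult_distrib)
  then show ?thesis
    using weighted_prop_mass_sum_le[OF F, of j "\<lambda>_. 1" 1] by (simp add: prop_mass_def)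
qed

text \<open>The integrand is a smoothed |t - m|^(-kappa), and the bound must not depend on m. The
  function \<open>G s = s * w s\<close> has derivative at least \<open>(1 - kappa) * w\<close>, so
  increments of G bound the integral. G is odd, at most T^(1-kappa) on [0, T] and subadditive on the
  positive axis, which handles every position of m relative to the window.\<close>

lemma integral_one_plus_square_powr_le:
  fixes m T \<kappa> :: real
  assumes \<kappa>: "0 < \<kappa>" "\<kappa> < 1" and T: "T > 0"
  shows "integral {T..2 * T} (\<lambda>t. (1 + (t - m)\<^sup>2) powr (- \<kappa> / 2)) \<le> 2 / (1 - \<kappa>) * T powr (1 - \<kappa>)"
proof -
  define w where "w = (\<lambda>s::real. (1 + s\<^sup>2) powr (- \<kappa> / 2))"
  define G where "G = (\<lambda>s. s * w s)"
  have pos: "1 + s\<^sup>2 > 0" for s :: real by (simp add: add_pos_nonneg)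
  have w0: "w s > 0" for s using pos[of s] by (simp add: w_def)
  have w_even: "w (- s) = w s" for s by (simp add: w_def)
  have w_antimono: "w t \<le> w s" if "0 \<le> s" "s \<le> t" for s t
    unfolding w_def using that \<kappa> pos by (intro powr_mono2') (auto intro!: power_mono)
  have deriv: "((\<lambda>t. G (t - m)) has_real_derivative w (t - m) * (1 - \<kappa> * (t - m)\<^sup>2 / (1 + (t - m)\<^sup>2))) (at t)" for t
  proof -
    have d: "(G has_real_derivative w s * (1 - \<kappa> * s\<^sup>2 / (1 + s\<^sup>2))) (at s)" for s
    proof -
      have "((\<lambda>s. 1 + s\<^sup>2) has_real_derivative 2 * s) (at s)"
        by (auto intro!: derivative_eq_intros)
      then have "(w has_real_derivative (- \<kappa> / 2 * (1 + s\<^sup>2) powr (- \<kappa> / 2 - 1)) * (2 * s)) (at s)"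
        unfolding w_def using DERIV_fun_powr[where g = "\<lambda>s. 1 + s\<^sup>2" and x = s and m = "2 * s" and r = "- \<kappa> / 2"] pos[of s] by simp
      also have "(- \<kappa> / 2 * (1 + s\<^sup>2) powr (- \<kappa> / 2 - 1)) * (2 * s) = - \<kappa> * s * w s / (1 + s\<^sup>2)"
      proof -
        have "(1 + s\<^sup>2) powr (- \<kappa> / 2 - 1) = w s / (1 + s\<^sup>2)"
          using pos[of s] by (simp only: w_def powr_diff) simp
        moreover have "2 + 2 * s\<^sup>2 = 2 * (1 + s\<^sup>2)" by simp
        ultimately show ?thesis using pos[of s] by (simp add: divide_simps)
      qed
      finally have "(w has_real_derivative - \<kappa> * s * w s / (1 + s\<^sup>2)) (at s)" .
      from DERIV_mult[OF DERIV_ident this]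
      have "(G has_real_derivative (1 * w s + - \<kappa> * s * w s / (1 + s\<^sup>2) * s)) (at s)"
        by (simp add: G_def)
      also have "1 * w s + - \<kappa> * s * w s / (1 + s\<^sup>2) * s = w s * (1 - \<kappa> * s\<^sup>2 / (1 + s\<^sup>2))"
        by (simp add: algebra_simps power2_eq_square)
      finally show ?thesis .
    qed
    have "((\<lambda>t. t - m) has_real_derivative 1) (at t)" by (auto intro!: derivative_eq_intros)
    from DERIV_chain2[OF d this] show ?thesis by simp
  qed
  have cont: "continuous_on S (\<lambda>t. w (t - m))" for S
    unfolding w_def using pos by (intro continuous_intros) (auto simp: less_imp_neq[symmetric])
  have i: "(\<lambda>t. w (t - m)) integrable_on {T..2*T}" by (intro integrable_continuous_interval cont)
  have FTC: "((\<lambda>t. w (t - m) * (1 - \<kappa> * (t - m)\<^sup>2 / (1 + (t - m)\<^sup>2))) has_integral (G (2 * T - m) - G (T - m))) {T..2*T}"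
    using T deriv by (intro fundamental_theorem_of_calculus)
      (auto simp: has_real_derivative_iff_has_vector_derivative[symmetric] intro: DERIV_subset)
  have "(1 - \<kappa>) * integral {T..2*T} (\<lambda>t. w (t - m)) = integral {T..2*T} (\<lambda>t. (1 - \<kappa>) * w (t - m))"
    by simp
  also have "\<dots> \<le> integral {T..2*T} (\<lambda>t. w (t - m) * (1 - \<kappa> * (t - m)\<^sup>2 / (1 + (t - m)\<^sup>2)))"
  proof (rule integral_le)
    show "(1 - \<kappa>) * w (t - m) \<le> w (t - m) * (1 - \<kappa> * (t - m)\<^sup>2 / (1 + (t - m)\<^sup>2))" for t
    proof -
      have "(t - m)\<^sup>2 / (1 + (t - m)\<^sup>2) \<le> 1" using pos[of "t - m"] by (simp add: divide_le_eq_1)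
      then have "\<kappa> * ((t - m)\<^sup>2 / (1 + (t - m)\<^sup>2)) \<le> \<kappa> * 1" using \<kappa> by (intro mult_left_mono) auto
      then have "w (t - m) * (1 - \<kappa>) \<le> w (t - m) * (1 - \<kappa> * ((t - m)\<^sup>2 / (1 + (t - m)\<^sup>2)))"
        using w0[of "t - m"] by (intro mult_left_mono) auto
      then show ?thesis by (simp add: mult.commute)
    qed
  qed (use i FTC in \<open>auto simp: has_integral_integrable intro!: integrable_on_mult_right\<close>)
  also have "integral {T..2*T} (\<lambda>t. w (t - m) * (1 - \<kappa> * (t - m)\<^sup>2 / (1 + (t - m)\<^sup>2))) = G (2 * T - m) - G (T - m)" using FTC by (rule integral_unique)
  also have "\<dots> \<le> 2 * T powr (1 - \<kappa>)"
  proof -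
    have G_le: "G s \<le> T powr (1 - \<kappa>)" if "0 \<le> s" "s \<le> T" for s
    proof (cases "s = 0")
      case False
      with that have s: "s > 0" by simp
      have "w s \<le> (s\<^sup>2) powr (- \<kappa> / 2)" unfolding w_def using s \<kappa> by (intro powr_mono2') auto
      also have "\<dots> = s powr (- \<kappa>)" using s powr_powr[of s 2 "- \<kappa> / 2"] by simp
      finally have "G s \<le> s * s powr (- \<kappa>)" unfolding G_def using s by (intro mult_left_mono) auto
      also have "\<dots> = s powr (1 - \<kappa>)" using s by (simp add: powr_diff powr_minus divide_inverse)
      also have "\<dots> \<le> T powr (1 - \<kappa>)" using s that \<kappa> by (intro powr_mono2) auto
      finally show ?thesis .
    qed (auto simp: G_def)
    have odd: "G (- s) = - G s" for s by (simp add: G_def w_even)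
    have subadd: "G (s + t) \<le> G s + G t" if "0 \<le> s" "0 \<le> t" for s t
    proof -
      have "(s + t) * w (s + t) = s * w (s + t) + t * w (s + t)" by (simp add: algebra_simps)
      also have "\<dots> \<le> s * w s + t * w t" using that by (intro add_mono mult_left_mono w_antimono) auto
      finally show ?thesis by (simp add: G_def)
    qed
    have Tp: "T powr (1 - \<kappa>) \<ge> 0" by simp
    have GT: "G T \<le> T powr (1 - \<kappa>)" using T by (intro G_le) auto
    consider "m \<le> T" | "T < m" "m < 2 * T" | "2 * T \<le> m" by linarith
    then show ?thesis
    proof cases
      case 1
      then have "G (2 * T - m) \<le> G (T - m) + G T" using subadd[of "T - m" T] T by (simp add: algebra_simps)
      then show ?thesis using GT Tp by linarith
    next
      case 2
      then have "G (2 * T - m) \<le> T powr (1 - \<kappa>)" "G (m - T) \<le> T powr (1 - \<kappa>)" by (auto intro!: G_le)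
      then show ?thesis using odd[of "m - T"] by simp
    next
      case 3
      then have "G (m - T) \<le> G (m - 2 * T) + G T" using subadd[of "m - 2 * T" T] T by (simp add: algebra_simps)
      moreover have "G (T - m) = - G (m - T)" "G (2 * T - m) = - G (m - 2 * T)"
        using odd[of "m - T"] odd[of "m - 2 * T"] by simp_all
      ultimately show ?thesis using GT Tp by linarith
    qed
  qed
  finally have "integral {T..2*T} (\<lambda>t. w (t - m)) \<le> 2 * T powr (1 - \<kappa>) / (1 - \<kappa>)"
    using \<kappa> by (simp add: pos_le_divide_eq mult.commute)
  then show ?thesis by (simp add: w_def)
qed

text \<open>The product is at most the k-th power of its largest factor. The time integral can then
  be taken for one coordinate at a time.\<close>

lemma prod_norm_bessel_le:
  assumes "finite F" "card F = k" "k > 0"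
  shows "(\<Prod>i\<in>F. norm (bessel (m i) z)) \<le> (\<Sum>i\<in>F. norm (bessel (m i) z) ^ k)"
proof -
  define M where "M = Max ((\<lambda>i. norm (bessel (m i) z)) ` F)"
  have "F \<noteq> {}" using assms by auto
  then have "M \<in> (\<lambda>i. norm (bessel (m i) z)) ` F" unfolding M_def using assms by (intro Max_in) auto
  then obtain i where i: "i \<in> F" "M = norm (bessel (m i) z)" by blast
  have "(\<Prod>i\<in>F. norm (bessel (m i) z)) \<le> (\<Prod>i\<in>F. M)"
    using assms by (intro prod_mono) (auto simp: M_def)
  also have "\<dots> = norm (bessel (m i) z) ^ k" using assms i by simp
  also have "\<dots> \<le> (\<Sum>i\<in>F. norm (bessel (m i) z) ^ k)"
    using assms i by (intro member_le_sum) auto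
  finally show ?thesis .
qed

text \<open>A Bessel factor is of order (t |t - |m||)^(-1/4). Three of them give T^(-3/4) times the
  integral of |t - |m||^(-3/4), that is T^(-1/2). With four the exponent -1 would produce a
  logarithm, so it is weakened to -a and the result is T^(-a). Further factors are bounded by
  1.\<close>

lemma prop_mass_decay:
  fixes a :: real
  assumes "CARD('d::finite) = 3 \<and> a = 1/2 \<or> CARD('d) \<ge> 4 \<and> 0 < a \<and> a < 1"
  shows "\<exists>C\<ge>1. \<forall>j (n :: int ^ 'd). prop_mass j n \<le> C * 2 powr (- a * real j)"
proof -
  define k :: nat where "k = (if CARD('d) = 3 then 3 else 4)"
  define q where "q = real k / 4"
  \<comment> \<open>Chosen so that \<open>T powr (- q) * T powr (1 - kappa) = T powr (- a)\<close>.
    Since kappa <= q and the base 1 + s^2 is at least 1, weakening the exponent from q to kappa is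
    legitimate.\<close>
  define \<kappa> where "\<kappa> = a + 1 - q"
  have k: "k > 0" "k \<le> CARD('d)" using assms by (auto simp: k_def)
  have \<kappa>: "0 < \<kappa>" "\<kappa> < 1" "\<kappa> \<le> q" using assms by (auto simp: \<kappa>_def q_def k_def)
  obtain F :: "'d set" where F: "finite F" "card F = k"
    using obtain_subset_with_card_n[OF k(2)] finite by metis
  obtain C where C: "C > 0" "\<And>m t. t \<ge> 1 \<Longrightarrow> norm (bessel m (of_real t)) ^ 4 * (t * max 1 \<bar>t - real_of_int \<bar>m\<bar>\<bar>) \<le> C"
    using bessel_decay by blast
  define E where "E = (2 * C) powr q"
  define D where "D = real k * (E * (2 / (1 - \<kappa>)))"
  have "E > 0" using C by (simp add: E_def)
  then have "D \<ge> 0" using \<kappa> by (simp add: D_def)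
  have pw: "norm (bessel m (of_real t)) ^ k \<le> E * T powr (- q) * (1 + (t - real_of_int \<bar>m\<bar>)\<^sup>2) powr (- \<kappa> / 2)"
    if "1 \<le> T" "T \<le> t" for m T t
  proof -
    define s where "s = t - real_of_int \<bar>m\<bar>"
    define x where "x = norm (bessel m (of_real t))"
    have pos: "1 + s\<^sup>2 > 0" by (simp add: add_pos_nonneg)
    have t: "t \<ge> 1" "t > 0" using that by auto
    have "sqrt (1 + s\<^sup>2) \<le> 2 * max 1 \<bar>s\<bar>"
    proof (rule real_le_lsqrt)
      have "1 + s\<^sup>2 \<le> (max 1 \<bar>s\<bar>)\<^sup>2 + (max 1 \<bar>s\<bar>)\<^sup>2"
        using power_mono[of "\<bar>s\<bar>" "max 1 \<bar>s\<bar>" 2] by (intro add_mono one_le_power) auto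
      also have "\<dots> \<le> (2 * max 1 \<bar>s\<bar>)\<^sup>2" by (simp add: power_mult_distrib)
      finally show "1 + s\<^sup>2 \<le> (2 * max 1 \<bar>s\<bar>)\<^sup>2" .
    qed auto
    then have "x ^ 4 * (t * sqrt (1 + s\<^sup>2)) \<le> x ^ 4 * (t * (2 * max 1 \<bar>s\<bar>))"
      using t by (intro mult_left_mono) auto
    also have "\<dots> \<le> 2 * C" using C(2)[OF t(1), of m] by (simp add: s_def x_def mult_ac)
    finally have "x ^ 4 \<le> 2 * C * t powr (-1) * (1 + s\<^sup>2) powr (-1/2)"
      using t pos by (simp add: powr_minus powr_half_sqrt field_simps)
    then have "(x ^ 4) powr q \<le> (2 * C * t powr (-1) * (1 + s\<^sup>2) powr (-1/2)) powr q"
      by (intro powr_mono2) (auto simp: q_def)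
    also have "\<dots> = E * t powr (- q) * (1 + s\<^sup>2) powr (- q / 2)"
      by (simp only: powr_mult powr_powr E_def) simp
    also have "\<dots> \<le> E * T powr (- q) * (1 + s\<^sup>2) powr (- \<kappa> / 2)"
      using that \<kappa> t pos \<open>E > 0\<close> k
      by (intro mult_mono powr_mono powr_mono2') (auto simp: q_def)
    also have "(x ^ 4) powr q = x ^ k"
    proof (cases "x = 0")
      case False
      then have "x > 0" by (simp add: x_def)
      then have "x ^ 4 = x powr 4" "x ^ k = x powr real k" by (simp_all add: powr_realpow)
      then show ?thesis by (simp add: q_def powr_powr)
    qed (use k in auto)
    finally show ?thesis by (simp add: x_def s_def)
  qed
  have Suc_le: "prop_mass (Suc j) n \<le> D * 2 powr (- a * real j)" for j and n :: "int ^ 'd"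
  proof -
    define T where "T = (2::real) ^ j"
    have T: "T \<ge> 1" by (simp add: T_def)
    define W where "W = (\<lambda>i t. (1 + (t - real_of_int \<bar>vec_nth n i\<bar>)\<^sup>2) powr (- \<kappa> / 2))"
    have Wc: "continuous_on {T..2*T} (W i)" for i
      unfolding W_def by (intro continuous_intros) (auto simp: add_nonneg_eq_0_iff)
    have Wi: "(\<lambda>t. E * T powr (- q) * W i t) integrable_on {T..2*T}" for i
      by (intro integrable_continuous_interval continuous_intros Wc)
    have "prop_mass (Suc j) n = integral {T..2*T} (\<lambda>t. norm (propagator n (of_real t)))"
      by (simp add: prop_mass_def T_def)
    also have "\<dots> \<le> integral {T..2*T} (\<lambda>t. \<Sum>i\<in>F. E * T powr (- q) * W i t)"
    proof (rule integral_le)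
      fix t assume t: "t \<in> {T..2*T}"
      have "norm (propagator n (of_real t)) = (\<Prod>i\<in>F. norm (bessel (vec_nth n i) (of_real t))) * (\<Prod>i\<in>UNIV - F. norm (bessel (vec_nth n i) (of_real t)))"
        unfolding norm_propagator using prod.subset_diff[of F UNIV "\<lambda>i. norm (bessel (vec_nth n i) (of_real t))"]
        by (simp add: mult.commute)
      also have "\<dots> \<le> (\<Prod>i\<in>F. norm (bessel (vec_nth n i) (of_real t))) * 1"
        by (intro mult_left_mono[OF prod_le_1] prod_nonneg) (auto simp: norm_bessel_le_1)
      also have "\<dots> \<le> (\<Sum>i\<in>F. norm (bessel (vec_nth n i) (of_real t)) ^ k)"
        using prod_norm_bessel_le[OF F k(1)] by simp
      also have "\<dots> \<le> (\<Sum>i\<in>F. E * T powr (- q) * W i t)"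
        unfolding W_def using t T by (intro sum_mono pw) auto
      finally show "norm (propagator n (of_real t)) \<le> (\<Sum>i\<in>F. E * T powr (- q) * W i t)" .
    qed (rule integrable_continuous_interval, intro continuous_intros, rule integrable_sum[OF F(1) Wi])
    also have "\<dots> = (\<Sum>i\<in>F. E * T powr (- q) * integral {T..2*T} (W i))"
      by (subst integral_sum[OF F(1) Wi]) simp
    also have "\<dots> \<le> (\<Sum>i\<in>F. E * T powr (- q) * (2 / (1 - \<kappa>) * T powr (1 - \<kappa>)))"
      unfolding W_def using \<open>E > 0\<close> \<kappa> T
      by (intro sum_mono mult_left_mono integral_one_plus_square_powr_le) auto
    also have "\<dots> = D * (T powr (- q) * T powr (1 - \<kappa>))" using F by (simp add: D_def)
    also have "T powr (- q) * T powr (1 - \<kappa>) = T powr (- a)" by (simp add: powr_add[symmetric] \<kappa>_def)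
    also have "T powr (- a) = 2 powr (- a * real j)"
    proof -
      have "T = 2 powr real j" by (simp add: T_def powr_realpow)
      then show ?thesis by (simp add: powr_powr mult.commute)
    qed
    finally show ?thesis .
  qed
  show ?thesis
  \<comment> \<open>Interval \<open>Suc i\<close> starts at 2^i, so rewriting the decay in terms of
    its own index costs the factor \<open>2 powr a\<close>; the summand 1 covers j = 0.\<close>
  proof (intro exI[of _ "1 + D * 2 powr a"] conjI allI)
    show "1 \<le> 1 + D * 2 powr a" using \<open>D \<ge> 0\<close> by simp
    fix j and n :: "int ^ 'd"
    show "prop_mass j n \<le> (1 + D * 2 powr a) * 2 powr (- a * real j)"
    proof (cases j)
      case 0
      then show ?thesis using prop_mass_0_le[of n] \<open>D \<ge> 0\<close> by (simp add: add_increasing2)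
    next
      case (Suc i)
      have "prop_mass j n \<le> D * 2 powr (- a * real i)" using Suc_le Suc by simp
      also have "\<dots> = D * 2 powr a * 2 powr (- a * real j)"
        by (simp add: Suc powr_add[symmetric] algebra_simps)
      also have "\<dots> \<le> (1 + D * 2 powr a) * 2 powr (- a * real j)"
        by (intro mult_right_mono) auto
      finally show ?thesis .
    qed
  qed
qed

section \<open>Interpolation and the Hilbert-Schmidt bound\<close>

lemma powr_prod3_le_sum:
  fixes X Y Z x :: real
  assumes "X \<ge> 0" "Y \<ge> 0" "Z \<ge> 0" "0 \<le> x" "2 * x \<le> 1"
  shows "X powr (1 - 2 * x) * (Y powr x * Z powr x) \<le> X + Y + Z"
proof -
  have "X powr (1 - 2 * x) * (Y powr x * Z powr x) \<le>
      (X + Y + Z) powr (1 - 2 * x) * ((X + Y + Z) powr x * (X + Y + Z) powr x)"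
    using assms by (intro mult_mono powr_mono2) auto
  also have "\<dots> = (X + Y + Z) powr 1" by (simp add: powr_add[symmetric])
  also have "\<dots> = X + Y + Z" using assms by simp
  finally show ?thesis .
qed

text \<open>Interpolation between the \<open>\<ell>\<^sup>1\<close> and the \<open>\<ell>\<^sup>2\<close> bound of the quadratic form.\<close>

lemma convolution_form_le:
  fixes a c :: "'g::ab_group_add \<Rightarrow> real"
  assumes a: "\<And>n. a n \<ge> 0" and c: "\<And>n. c n \<ge> 0" and c_le: "\<And>n. c n \<le> \<beta>"
    and c_sum: "\<And>F. finite F \<Longrightarrow> sum c F \<le> \<tau>" and "\<tau> > 0"
    and a_sum: "\<And>F. finite F \<Longrightarrow> (\<Sum>n\<in>F. a n powr p) \<le> A"
    and p: "1 \<le> p" "p \<le> 2" and F: "finite F"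
  shows "(\<Sum>(n, m)\<in>F. a n * a m * c (n - m)) \<le>
    \<beta> powr (1 - 2 * (1 - 1 / p)) * \<tau> powr (2 * (1 - 1 / p)) * (A * A + 2 * A)"
proof -
  \<comment> \<open>The interpolation parameter, running from 0 at p = 1 to 1/2 at p = 2. With
    \<open>u n = a n powr p\<close> it makes \<open>a n = u n powr (1 - x)\<close>.\<close>
  define x where "x = 1 - 1 / p"
  have x: "0 \<le> x" "2 * x \<le> 1" "p * (1 - x) = 1" using p by (auto simp: x_def field_simps)
  have \<beta>: "\<beta> \<ge> 0" using c[of 0] c_le[of 0] by linarith
  have A: "A \<ge> 0" using a_sum[of "{}"] by simp
  define K where "K = \<beta> powr (1 - 2 * x) * \<tau> powr (2 * x)"
  have K: "K \<ge> 0" by (simp add: K_def)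
  define u where "u = (\<lambda>n. a n powr p)"
  have u0: "u n \<ge> 0" for n by (simp add: u_def)
  have au: "a n = u n powr (1 - x)" for n using a[of n] x(3) by (simp add: u_def powr_powr)
  \<comment> \<open>Once \<open>c powr (1 - 2 * x)\<close> is replaced by its supremum, the rest is
    a geometric mean with weights 1 - 2x, x, x of three terms, each of which can be summed over n
    and m.\<close>
  have pw: "a n * a m * c (n - m) \<le> K * (u n * u m + u n * c (n - m) / \<tau> + u m * c (n - m) / \<tau>)" for n m
  proof (cases "u n = 0 \<or> u m = 0 \<or> c (n - m) = 0")
    case True
    then have "a n * a m * c (n - m) = 0" using a by (auto simp: u_def)
    moreover have "K * (u n * u m + u n * c (n - m) / \<tau> + u m * c (n - m) / \<tau>) \<ge> 0"
      using K u0 c \<open>\<tau> > 0\<close> by (intro mult_nonneg_nonneg add_nonneg_nonneg divide_nonneg_nonneg) auto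
    ultimately show ?thesis by linarith
  next
    case False
    then have pos: "u n > 0" "u m > 0" "c (n - m) > 0" using u0[of n] u0[of m] c[of "n - m"] by auto
    define C where "C = c (n - m)"
    have C: "C > 0" "C \<le> \<beta>" using pos c_le by (auto simp: C_def)
    have "a n * a m * C = (u n powr (1 - x) * u m powr (1 - x)) * (C powr (1 - 2 * x) * C powr (2 * x))"
      using C by (simp add: au powr_add[symmetric])
    also have "\<dots> \<le> (u n powr (1 - x) * u m powr (1 - x)) * (\<beta> powr (1 - 2 * x) * C powr (2 * x))"
      using C x by (intro mult_left_mono mult_right_mono powr_mono2) auto
    also have "\<dots> = K * ((u n * u m) powr (1 - 2 * x) * ((u n * C / \<tau>) powr x * (u m * C / \<tau>) powr x))"
    proof -
      have e: "y powr (1 - x) = y powr (1 - 2 * x) * y powr x" for y :: real by (simp add: powr_add[symmetric])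
      have e2: "y powr (2 * x) = y powr x * y powr x" for y :: real by (simp add: powr_add[symmetric])
      have t: "\<tau> powr x > 0" using \<open>\<tau> > 0\<close> by simp
      show ?thesis unfolding e[of "u n"] e[of "u m"] K_def e2 powr_mult powr_divide using t by (simp add: field_simps)
    qed
    also have "\<dots> \<le> K * (u n * u m + u n * C / \<tau> + u m * C / \<tau>)"
      using pos C \<open>\<tau> > 0\<close> x K by (intro mult_left_mono powr_prod3_le_sum) auto
    finally show ?thesis by (simp add: C_def)
  qed
  define P where "P = fst ` F"
  define Q where "Q = snd ` F"
  have PQ: "finite P" "finite Q" "F \<subseteq> P \<times> Q" using F by (force simp: P_def Q_def)+
  have uA: "sum u P \<le> A" "sum u Q \<le> A" using a_sum PQ by (auto simp: u_def)
  have cn: "(\<Sum>m\<in>Q. c (n - m)) \<le> \<tau>" for n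
    using c_sum[of "(\<lambda>m. n - m) ` Q"] PQ by (simp add: sum.reindex inj_on_def)
  have cm: "(\<Sum>n\<in>P. c (n - m)) \<le> \<tau>" for m
    using c_sum[of "(\<lambda>n. n - m) ` P"] PQ by (simp add: sum.reindex inj_on_def)
  have "(\<Sum>(n, m)\<in>F. a n * a m * c (n - m)) \<le> (\<Sum>(n, m)\<in>P \<times> Q. a n * a m * c (n - m))"
    using PQ a c by (intro sum_mono2) auto
  also have "\<dots> \<le> (\<Sum>(n, m)\<in>P \<times> Q. K * (u n * u m + u n * c (n - m) / \<tau> + u m * c (n - m) / \<tau>))"
    using pw by (intro sum_mono) auto
  also have "\<dots> = K * (\<Sum>n\<in>P. \<Sum>m\<in>Q. u n * u m + u n * c (n - m) / \<tau> + u m * c (n - m) / \<tau>)"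
    by (subst sum.cartesian_product) (simp only: sum_distrib_left case_prod_unfold)
  also have "(\<Sum>n\<in>P. \<Sum>m\<in>Q. u n * u m + u n * c (n - m) / \<tau> + u m * c (n - m) / \<tau>)
      = sum u P * sum u Q + (\<Sum>n\<in>P. u n * ((\<Sum>m\<in>Q. c (n - m)) / \<tau>)) + (\<Sum>m\<in>Q. u m * ((\<Sum>n\<in>P. c (n - m)) / \<tau>))"
  proof -
    have "(\<Sum>n\<in>P. \<Sum>m\<in>Q. u m * c (n - m) / \<tau>) = (\<Sum>m\<in>Q. \<Sum>n\<in>P. u m * c (n - m) / \<tau>)"
      by (rule sum.swap)
    moreover have "(\<Sum>n\<in>P. \<Sum>m\<in>Q. u n * u m) = sum u P * sum u Q" by (simp add: sum_product)
    moreover have "(\<Sum>n\<in>P. \<Sum>m\<in>Q. u n * c (n - m) / \<tau>) = (\<Sum>n\<in>P. u n * ((\<Sum>m\<in>Q. c (n - m)) / \<tau>))"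
      by (simp add: sum_distrib_left sum_divide_distrib)
    moreover have "(\<Sum>m\<in>Q. \<Sum>n\<in>P. u m * c (n - m) / \<tau>) = (\<Sum>m\<in>Q. u m * ((\<Sum>n\<in>P. c (n - m)) / \<tau>))"
      by (simp add: sum_distrib_left sum_divide_distrib)
    ultimately show ?thesis by (simp only: sum.distrib)
  qed
  also have "K * \<dots> \<le> K * (A * A + (\<Sum>n\<in>P. u n * 1) + (\<Sum>m\<in>Q. u m * 1))"
    using uA u0 A cn cm \<open>\<tau> > 0\<close>
    by (intro mult_left_mono[OF _ K] add_mono mult_mono sum_mono mult_left_mono) (auto simp: sum_nonneg divide_le_eq_1)
  also have "\<dots> \<le> K * (A * A + A + A)" using uA K by (intro mult_left_mono) auto
  finally show ?thesis by (simp add: K_def x_def algebra_simps)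
qed

text \<open>The majorant of the free resolvent kernel, uniform in l and valid on the spectrum
  itself.\<close>

definition prop_total :: "int ^ 'd::finite \<Rightarrow> real" where
  "prop_total n = (\<Sum>j. prop_mass j n)"

lemma summable_prop_mass:
  fixes n :: "int ^ 'd::finite"
  assumes "CARD('d) \<ge> 3"
  shows "summable (\<lambda>j. prop_mass j n)"
proof -
  obtain C where C: "\<And>j (n :: int ^ 'd). prop_mass j n \<le> C * 2 powr (- (1/2) * real j)"
    using prop_mass_decay[where a = "1/2" and 'd = 'd] assms by (cases "CARD('d) = 3") auto
  have "summable (\<lambda>j. C * (2 powr (- (1/2))) ^ j)"
    by (intro summable_mult summable_geometric) (simp add: powr_minus powr_half_sqrt divide_simps)
  moreover have "2 powr (- (1/2) * real j) = (2 powr (- (1/2))) ^ j" for j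
    by (simp add: powr_powr flip: powr_realpow)
  moreover have "norm (prop_mass j n) \<le> C * 2 powr (- (1/2) * real j)" for j
    using C[of j n] prop_mass_nonneg[of j n] by simp
  ultimately show ?thesis
    by (intro summable_comparison_test[of "\<lambda>j. prop_mass j n" "\<lambda>j. C * (2 powr (- (1/2))) ^ j"]) auto
qed

lemma prop_total_nonneg: "CARD('d::finite) \<ge> 3 \<Longrightarrow> 0 \<le> prop_total (n :: int ^ 'd)"
  unfolding prop_total_def by (intro suminf_nonneg prop_mass_nonneg summable_prop_mass)

text \<open>The sum is the squared Hilbert-Schmidt norm of |V|^(1/2) \<open>prop_total\<close>
  |V|^(1/2). Interpolation bounds the j-th piece by \<open>B * 2 powr (- delta * j)\<close>, and the
  restriction on p is what makes delta positive.\<close>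

theorem hilbert_schmidt_prop_total:
  fixes V :: "int ^ 'd::finite \<Rightarrow> complex"
  assumes d: "CARD('d) \<ge> 3" and V: "V \<in> lspace p" and p: "1 \<le> p" "p < (if CARD('d) = 3 then 6 / 5 else 4 / 3)"
  shows "(\<lambda>(n, m). norm (V n) * norm (V m) * (prop_total (n - m))\<^sup>2) summable_on UNIV"
proof -
  define x where "x = 1 - 1 / p"
  have x: "0 \<le> x" "x < (if CARD('d) = 3 then 1 / 6 else 1 / 4)" using p by (auto simp: x_def field_simps split: if_splits)
  then have x4: "x < 1/4" by (auto split: if_splits)
  \<comment> \<open>For dimension at least 4, delta > 0 means a > 2x / (1 - 2x), and
    \<open>prop_mass_decay\<close> needs a < 1; a is the midpoint of these two bounds.\<close>
  define a where "a = (if CARD('d) = 3 then 1 / 2 else (1 + 2 * x / (1 - 2 * x)) / 2)"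
  have r: "2 * x / (1 - 2 * x) < 1" "0 \<le> 2 * x / (1 - 2 * x)" using x x4 by (auto simp: field_simps)
  have a: "CARD('d) = 3 \<and> a = 1/2 \<or> CARD('d) \<ge> 4 \<and> 0 < a \<and> a < 1"
    using d r by (auto simp: a_def)
  obtain C where C: "C \<ge> 1" "\<And>j (n :: int ^ 'd). prop_mass j n \<le> C * 2 powr (- a * real j)"
    using prop_mass_decay[OF a] by blast
  define \<delta> where "\<delta> = 2 * a * (1 - 2 * x) - 4 * x"
  have \<delta>: "\<delta> > 0"
  proof (cases "CARD('d) = 3")
    case True
    then show ?thesis using x by (simp add: \<delta>_def a_def)
  next
    case False
    then have "2 * a * (1 - 2 * x) = (1 - 2 * x) + 2 * x" using x4 by (simp add: a_def field_simps)
    then show ?thesis using x4 by (simp add: \<delta>_def)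
  qed
  define v where "v = (\<lambda>n. norm (V n))"
  define A where "A = (\<Sum>\<^sub>\<infinity>n. v n powr p)"
  have A: "(\<Sum>n\<in>F. v n powr p) \<le> A" if "finite F" for F
    unfolding A_def using V that by (intro finite_sum_le_infsum) (auto simp: lspace_def v_def)
  have A0: "A \<ge> 0" using A[of "{}"] by simp
  define B where "B = C powr (2 * (1 - 2 * x)) * (A * A + 2 * A)"
  have B0: "B \<ge> 0" using A0 by (simp add: B_def)
  have piece: "(\<Sum>(n, m)\<in>F. v n * v m * (prop_mass j (n - m))\<^sup>2) \<le> B * 2 powr (- \<delta> * real j)" if F: "finite F" for F j
  proof -
    have "(\<Sum>(n, m)\<in>F. v n * v m * (prop_mass j (n - m))\<^sup>2) \<le>
      ((C * 2 powr (- a * real j))\<^sup>2) powr (1 - 2 * (1 - 1 / p)) * (4 ^ j) powr (2 * (1 - 1 / p)) * (A * A + 2 * A)"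
    proof (rule convolution_form_le[where a = v and c = "\<lambda>n. (prop_mass j n)\<^sup>2"])
      show "(prop_mass j n)\<^sup>2 \<le> (C * 2 powr (- a * real j))\<^sup>2" for n :: "int ^ 'd"
        using C(2)[of j n] prop_mass_nonneg[of j n] by (intro power_mono) auto
    qed (use p F A in \<open>auto simp: v_def prop_mass_sum_le split: if_splits\<close>)
    also have "\<dots> = ((C * 2 powr (- a * real j))\<^sup>2) powr (1 - 2 * x) * (4 ^ j) powr (2 * x) * (A * A + 2 * A)"
      by (simp add: x_def)
    also have "((C * 2 powr (- a * real j))\<^sup>2) powr (1 - 2 * x) = C powr (2 * (1 - 2 * x)) * 2 powr (- 2 * a * (1 - 2 * x) * real j)"
    proof -
      have "(C * 2 powr (- a * real j))\<^sup>2 = (C * 2 powr (- a * real j)) powr 2" using C by simp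
      also have "\<dots> powr (1 - 2 * x) = C powr (2 * (1 - 2 * x)) * 2 powr (- 2 * a * (1 - 2 * x) * real j)"
        by (simp only: powr_mult powr_powr) (simp add: mult_ac)
      finally show ?thesis .
    qed
    also have "(4 ^ j) powr (2 * x) = 2 powr (4 * x * real j)"
    proof -
      have "(4::real) ^ j = (2 powr 2) powr real j" by (simp add: powr_realpow)
      then show ?thesis by (simp only: powr_powr) (simp add: mult_ac)
    qed
    also have "C powr (2 * (1 - 2 * x)) * 2 powr (- 2 * a * (1 - 2 * x) * real j) * 2 powr (4 * x * real j) * (A * A + 2 * A)
       = B * (2 powr (- 2 * a * (1 - 2 * x) * real j) * 2 powr (4 * x * real j))"
      by (simp add: B_def mult_ac)
    also have "2 powr (- 2 * a * (1 - 2 * x) * real j) * 2 powr (4 * x * real j) = 2 powr (- \<delta> * real j)"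
      unfolding powr_add[symmetric] by (simp add: \<delta>_def algebra_simps)
    finally show ?thesis .
  qed
  \<comment> \<open>Half of the decay is spent on Cauchy-Schwarz over j with weights
    \<open>q ^ j\<close>; the other half keeps the sum over j finite.\<close>
  define q where "q = 2 powr (- \<delta> / 2)"
  have q: "0 < q" "q < 1" using \<delta> by (auto simp: q_def powr_less_one)
  define S where "S = 1 / (1 - q)"
  have S0: "S > 0" using q by (simp add: S_def)
  have geo: "(\<Sum>j<J. q ^ j) \<le> S" for J
  proof -
    have "(\<Sum>j<J. q ^ j) \<le> (\<Sum>j. q ^ j)" using q by (intro sum_le_suminf summable_geometric) auto
    then show ?thesis using q by (simp add: S_def suminf_geometric)
  qed
  have q2: "2 powr (- \<delta> * real j) = q ^ j * q ^ j" for j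
    unfolding q_def by (simp add: powr_realpow[symmetric] powr_powr powr_add[symmetric])
  have partial: "(\<Sum>(n, m)\<in>F. v n * v m * (\<Sum>j<J. prop_mass j (n - m))\<^sup>2) \<le> S * (B * S)" if F: "finite F" for F J
  proof -
    have cs: "(\<Sum>j<J. prop_mass j n)\<^sup>2 \<le> S * (\<Sum>j<J. (prop_mass j n)\<^sup>2 / q ^ j)" for n :: "int ^ 'd"
    proof -
      have "(\<Sum>j<J. prop_mass j n)\<^sup>2 = (\<Sum>j<J. sqrt (q ^ j) * (prop_mass j n / sqrt (q ^ j)))\<^sup>2"
        using q by simp
      also have "\<dots> \<le> (\<Sum>j<J. (sqrt (q ^ j))\<^sup>2) * (\<Sum>j<J. (prop_mass j n / sqrt (q ^ j))\<^sup>2)"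
        by (rule Cauchy_Schwarz_ineq_sum)
      also have "\<dots> = (\<Sum>j<J. q ^ j) * (\<Sum>j<J. (prop_mass j n)\<^sup>2 / q ^ j)"
        using q by (simp add: power_divide)
      also have "\<dots> \<le> S * (\<Sum>j<J. (prop_mass j n)\<^sup>2 / q ^ j)"
        using geo q by (intro mult_right_mono sum_nonneg) auto
      finally show ?thesis .
    qed
    have "(\<Sum>(n, m)\<in>F. v n * v m * (\<Sum>j<J. prop_mass j (n - m))\<^sup>2) \<le>
        (\<Sum>(n, m)\<in>F. v n * v m * (S * (\<Sum>j<J. (prop_mass j (n - m))\<^sup>2 / q ^ j)))"
      by (intro sum_mono) (auto intro!: mult_left_mono cs simp: v_def)
    also have "\<dots> = S * (\<Sum>(n, m)\<in>F. \<Sum>j<J. v n * v m * (prop_mass j (n - m))\<^sup>2 / q ^ j)"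
      by (simp add: sum_distrib_left split_beta mult_ac)
    also have "(\<Sum>(n, m)\<in>F. \<Sum>j<J. v n * v m * (prop_mass j (n - m))\<^sup>2 / q ^ j)
        = (\<Sum>j<J. (\<Sum>(n, m)\<in>F. v n * v m * (prop_mass j (n - m))\<^sup>2) / q ^ j)"
      by (simp add: split_beta sum_divide_distrib) (rule sum.swap)
    also have "S * \<dots> \<le> S * (\<Sum>j<J. B * q ^ j)"
    proof (intro mult_left_mono sum_mono)
      fix j
      have "(\<Sum>(n, m)\<in>F. v n * v m * (prop_mass j (n - m))\<^sup>2) / q ^ j \<le> (B * (q ^ j * q ^ j)) / q ^ j"
        using piece[OF F, of j, unfolded q2] q by (intro divide_right_mono) auto
      then show "(\<Sum>(n, m)\<in>F. v n * v m * (prop_mass j (n - m))\<^sup>2) / q ^ j \<le> B * q ^ j"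
        using q by simp
    qed (use S0 in auto)
    also have "\<dots> \<le> S * (B * S)"
      using geo S0 B0 by (intro mult_left_mono) (auto simp flip: sum_distrib_left intro!: mult_left_mono)
    finally show ?thesis .
  qed
  have total: "(\<Sum>(n, m)\<in>F. v n * v m * (prop_total (n - m))\<^sup>2) \<le> S * (B * S)" if F: "finite F" for F
  proof (rule tendsto_upperbound)
    show "(\<lambda>J. \<Sum>(n, m)\<in>F. v n * v m * (\<Sum>j<J. prop_mass j (n - m))\<^sup>2) \<longlonglongrightarrow> (\<Sum>(n, m)\<in>F. v n * v m * (prop_total (n - m))\<^sup>2)"
      unfolding prop_total_def split_beta
      by (intro tendsto_intros summable_LIMSEQ summable_prop_mass d)
    show "\<forall>\<^sub>F J in sequentially. (\<Sum>(n, m)\<in>F. v n * v m * (\<Sum>j<J. prop_mass j (n - m))\<^sup>2) \<le> S * (B * S)"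
      using partial[OF F] by simp
  qed simp
  show ?thesis
    using total by (intro nonneg_bdd_above_summable_on bdd_aboveI[of _ "S * (B * S)"]) (auto simp: v_def)
qed

section \<open>The free resolvent up to the spectrum\<close>

definition prop_piece :: "nat \<Rightarrow> complex \<Rightarrow> int ^ 'd::finite \<Rightarrow> complex" where
  "prop_piece j l n = integral {dyadic j..dyadic (Suc j)} (\<lambda>t. exp (- \<i> * l * of_real t) * propagator n (of_real t))"

text \<open>The kernel of \<open>- i \<integral> exp (- i t l) exp (i t \<Delta>) dt\<close> over \<open>[0, \<infinity>)\<close>, for \<open>Im l \<le> 0\<close>.\<close>

definition lower_resolvent :: "complex \<Rightarrow> int ^ 'd::finite \<Rightarrow> complex" where
  "lower_resolvent l n = - \<i> * (\<Sum>j. prop_piece j l n)"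

text \<open>The Laplacian has real coefficients, so the resolvent kernels at l and at
  \<open>cnj l\<close> are conjugate; this transfers all results from the lower half plane.\<close>

definition upper_resolvent :: "complex \<Rightarrow> int ^ 'd::finite \<Rightarrow> complex" where
  "upper_resolvent l n = cnj (lower_resolvent (cnj l) n)"

lemma norm_prop_piece_le_weighted:
  "norm (prop_piece j l n) \<le> integral {dyadic j..dyadic (Suc j)} (\<lambda>t. exp (Im l * t) * norm (propagator n (of_real t)))"
  unfolding prop_piece_def
  by (intro integral_norm_bound_integral integrable_continuous_interval continuous_intros) (auto simp: norm_mult)

lemma norm_prop_piece_le:
  assumes "Im l \<le> 0"
  shows "norm (prop_piece j l n) \<le> prop_mass j n"
proof -
  have "norm (prop_piece j l n) \<le> integral {dyadic j..dyadic (Suc j)} (\<lambda>t. exp (Im l * t) * norm (propagator n (of_real t)))"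
    by (rule norm_prop_piece_le_weighted)
  also have "\<dots> \<le> prop_mass j n"
    unfolding prop_mass_def
  proof (intro integral_le integrable_continuous_interval continuous_intros)
    fix t assume "t \<in> {dyadic j..dyadic (Suc j)}"
    then have "t \<ge> 0" using dyadic_nonneg[of j] by simp
    then have "exp (Im l * t) \<le> 1" using assms by (simp add: mult_nonpos_nonneg)
    then show "exp (Im l * t) * norm (propagator n (of_real t)) \<le> norm (propagator n (of_real t))"
      by (simp add: mult_left_le_one_le)
  qed
  finally show ?thesis .
qed

lemma holomorphic_prop_piece: "(\<lambda>l. prop_piece j l n) holomorphic_on S"
proof -
  have "(\<lambda>l. integral (cbox (dyadic j) (dyadic (Suc j))) (\<lambda>t. exp (- \<i> * l * of_real t) * propagator n (of_real t))) holomorphic_on UNIV"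
  proof (rule leibniz_rule_holomorphic)
    show "((\<lambda>l. exp (- \<i> * l * of_real t) * propagator n (of_real t)) has_field_derivative
        (- \<i> * of_real t) * exp (- \<i> * l * of_real t) * propagator n (of_real t)) (at l within UNIV)" for l t
      by (auto intro!: derivative_eq_intros)
    show "continuous_on (UNIV \<times> cbox (dyadic j) (dyadic (Suc j)))
       (\<lambda>(l, t). (- \<i> * of_real t) * exp (- \<i> * l * of_real t) * propagator n (of_real t))"
      by (auto simp: split_beta intro!: continuous_intros)
  qed (auto intro!: integrable_continuous_interval continuous_intros)
  then show ?thesis unfolding prop_piece_def by (auto intro: holomorphic_on_subset)
qed

lemma uniform_limit_prop_piece:
  fixes n :: "int ^ 'd::finite"
  assumes "CARD('d) \<ge> 3" "S \<subseteq> {l. Im l \<le> 0}"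
  shows "uniform_limit S (\<lambda>J l. \<Sum>j<J. prop_piece j l n) (\<lambda>l. \<Sum>j. prop_piece j l n) sequentially"
  by (rule Weierstrass_m_test[OF _ summable_prop_mass[OF assms(1), of n]])
    (use assms(2) norm_prop_piece_le in blast)

lemma norm_lower_resolvent_le:
  fixes n :: "int ^ 'd::finite"
  assumes "CARD('d) \<ge> 3" "Im l \<le> 0"
  shows "norm (lower_resolvent l n) \<le> prop_total n"
  unfolding lower_resolvent_def prop_total_def norm_mult
  using norm_prop_piece_le[OF assms(2)] summable_prop_mass[OF assms(1)]
  by (auto intro!: norm_suminf_le)

lemma continuous_on_lower_resolvent:
  fixes n :: "int ^ 'd::finite"
  assumes "CARD('d) \<ge> 3"
  shows "continuous_on {l. Im l \<le> 0} (\<lambda>l. lower_resolvent l n)"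
  unfolding lower_resolvent_def
  by (intro continuous_intros uniform_limit_theorem[OF _ uniform_limit_prop_piece[OF assms order.refl]])
    (auto intro!: always_eventually holomorphic_on_imp_continuous_on holomorphic_on_sum holomorphic_prop_piece)

lemma holomorphic_on_lower_resolvent:
  fixes n :: "int ^ 'd::finite"
  assumes "CARD('d) \<ge> 3"
  shows "(\<lambda>l. lower_resolvent l n) holomorphic_on {l. Im l < 0}"
  unfolding lower_resolvent_def
proof (intro holomorphic_intros, rule holomorphic_uniform_sequence)
  have op: "open {l. Im l < 0}" by (rule open_halfspace_Im_lt)
  then show "open {l. Im l < 0}" .
  show "(\<lambda>l. \<Sum>j<J. prop_piece j l n) holomorphic_on {l. Im l < 0}" for J
    by (intro holomorphic_intros holomorphic_prop_piece)
  fix l assume "l \<in> {l. Im l < 0}"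
  then obtain e where e: "e > 0" "cball l e \<subseteq> {l. Im l < 0}" using op open_contains_cball by blast
  then show "\<exists>d>0. cball l d \<subseteq> {l. Im l < 0} \<and>
      uniform_limit (cball l d) (\<lambda>J l. \<Sum>j<J. prop_piece j l n) (\<lambda>l. \<Sum>j. prop_piece j l n) sequentially"
    by (intro exI[of _ e] conjI uniform_limit_prop_piece assms) auto
qed

section \<open>Resolvent kernels as fundamental solutions\<close>

lemma laplacian_sums:
  fixes a :: "nat \<Rightarrow> int ^ 'd::finite \<Rightarrow> complex"
  assumes "\<And>m. (\<lambda>j. a j m) sums s m"
  shows "(\<lambda>j. laplacian (a j) n) sums laplacian s n"
  unfolding laplacian_eq by (intro sums_divide sums_sum sums_add assms)

lemma laplacian_cmult: "laplacian (\<lambda>m. c * f m) n = c * laplacian f n"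
  by (simp add: laplacian_eq sum_distrib_left algebra_simps)

lemma laplacian_cnj: "laplacian (\<lambda>m. cnj (f m)) n = cnj (laplacian f n)"
  by (simp add: laplacian_eq)

lemma laplacian_diff: "laplacian (\<lambda>m. f m - g m) n = laplacian f n - laplacian g n"
  by (simp add: laplacian_eq sum.distrib sum_subtractf diff_divide_distrib add_divide_distrib)

text \<open>A square summable fundamental solution of Delta - l at the origin; convolution with it
  inverts Delta - l.\<close>

definition is_resolvent_kernel :: "complex \<Rightarrow> (int ^ 'd::finite \<Rightarrow> complex) \<Rightarrow> bool" where
  "is_resolvent_kernel l G \<longleftrightarrow> (\<lambda>n. (norm (G n))\<^sup>2) summable_on UNIV \<and>
     (\<forall>n. laplacian G n - l * G n = (if n = 0 then 1 else 0))"

text \<open>On the integrand, Delta - l acts as a time derivative up to the factor -i, so each piece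
  contributes boundary terms that telescope over j.\<close>

lemma laplacian_prop_piece:
  "laplacian (prop_piece j l) n - l * prop_piece j l n =
     - \<i> * (exp (- \<i> * l * of_real (dyadic (Suc j))) * propagator n (of_real (dyadic (Suc j))) -
       exp (- \<i> * l * of_real (dyadic j)) * propagator n (of_real (dyadic j)))"
proof -
  let ?I = "{dyadic j..dyadic (Suc j)}"
  let ?f = "\<lambda>m t. exp (- \<i> * l * of_real t) * propagator m (of_real t)"
  have i: "?f m integrable_on ?I" for m by (intro integrable_continuous_interval continuous_intros)
  have "((\<lambda>t. \<i> * (laplacian (\<lambda>m. ?f m t) n - l * ?f n t)) has_integral (?f n (dyadic (Suc j)) - ?f n (dyadic j))) ?I"
  proof (rule fundamental_theorem_of_calculus[OF dyadic_mono])
    fix t :: real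
    have "((\<lambda>t. exp (- \<i> * l * t) * propagator n t) has_field_derivative
        exp (- \<i> * l * of_real t) * (\<i> * laplacian (\<lambda>m. propagator m (of_real t)) n) +
        (exp (- \<i> * l * of_real t) * (- \<i> * l)) * propagator n (of_real t)) (at (of_real t))"
      by (intro DERIV_mult' has_field_derivative_propagator) (auto intro!: derivative_eq_intros)
    also have "exp (- \<i> * l * of_real t) * (\<i> * laplacian (\<lambda>m. propagator m (of_real t)) n) +
        (exp (- \<i> * l * of_real t) * (- \<i> * l)) * propagator n (of_real t) = \<i> * (laplacian (\<lambda>m. ?f m t) n - l * ?f n t)"
      unfolding laplacian_cmult by (simp add: algebra_simps)
    finally show "(?f n has_vector_derivative \<i> * (laplacian (\<lambda>m. ?f m t) n - l * ?f n t)) (at t within ?I)"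
      using has_vector_derivative_real_field has_vector_derivative_at_within by blast
  qed
  moreover have "((\<lambda>t. \<i> * (laplacian (\<lambda>m. ?f m t) n - l * ?f n t)) has_integral
      (\<i> * (laplacian (prop_piece j l) n - l * prop_piece j l n))) ?I"
    unfolding laplacian_eq prop_piece_def
    by (intro has_integral_mult_right has_integral_diff has_integral_divide has_integral_sum has_integral_add integrable_integral i) auto
  ultimately have "\<i> * (laplacian (prop_piece j l) n - l * prop_piece j l n) = ?f n (dyadic (Suc j)) - ?f n (dyadic j)"
    by (rule has_integral_unique[rotated])
  then have "- \<i> * (\<i> * (laplacian (prop_piece j l) n - l * prop_piece j l n)) = - \<i> * (?f n (dyadic (Suc j)) - ?f n (dyadic j))"
    by simp
  then show ?thesis by (simp add: algebra_simps)
qed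

text \<open>For Im l < 0 the factor \<open>exp (Im l * t)\<close> makes the l2 norms of the pieces
  summable. The boundary terms telescope from the delta function at time 0 to a limit of 0.\<close>

lemma is_resolvent_kernel_lower:
  fixes l :: complex
  assumes d: "CARD('d::finite) \<ge> 3" and l: "Im l < 0"
  shows "is_resolvent_kernel l (lower_resolvent l :: int ^ 'd \<Rightarrow> complex)"
  unfolding is_resolvent_kernel_def
proof (intro conjI allI)
  have sm: "(\<lambda>j. prop_piece j l n) sums (\<Sum>j. prop_piece j l n)" for n :: "int ^ 'd"
    using l norm_prop_piece_le[of l] summable_comparison_test'[OF summable_prop_mass[OF d, of n], of 0 "\<lambda>j. prop_piece j l n"]
    by (auto simp: summable_sums)
  have sl: "(\<lambda>j. - \<i> * prop_piece j l n) sums lower_resolvent l n" for n :: "int ^ 'd"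
    unfolding lower_resolvent_def by (intro sums_mult sm)
  \<comment> \<open>Bound for the l2 norm of the j-th piece: largest weight on the interval times
    \<open>2 ^ j\<close>. The inequality exp x >= x^2 / 2 makes it decay geometrically.\<close>
  define b where "b = (\<lambda>j. exp (Im l * dyadic j) * 2 ^ j)"
  have b0: "b j > 0" and bn: "b j \<noteq> 0" for j by (simp_all add: b_def)
  have "summable b"
  proof -
    define \<eta> where "\<eta> = - Im l"
    have \<eta>: "\<eta> > 0" using l by (simp add: \<eta>_def)
    have "b (Suc i) \<le> 4 / \<eta>\<^sup>2 * (1/2) ^ i" for i
    proof -
      define x where "x = \<eta> * 2 ^ i"
      have x: "x > 0" using \<eta> by (simp add: x_def)
      have "x\<^sup>2 / 2 \<le> exp x" using exp_lower_Taylor_quadratic[of x] x by linarith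
      then have "exp (- x) \<le> 2 / x\<^sup>2" using x by (simp add: exp_minus field_simps)
      then have "exp (- x) * 2 ^ Suc i \<le> 2 / x\<^sup>2 * 2 ^ Suc i" by (intro mult_right_mono) auto
      also have "\<dots> = 4 / \<eta>\<^sup>2 * (1/2) ^ i"
        using \<eta> by (simp add: x_def power_mult_distrib power2_eq_square field_simps)
      finally show ?thesis by (simp add: b_def x_def \<eta>_def)
    qed
    then have "norm (b (Suc i)) \<le> 4 / \<eta>\<^sup>2 * (1/2) ^ i" for i using b0[of "Suc i"] by simp
    moreover have "summable (\<lambda>i. 4 / \<eta>\<^sup>2 * (1/2) ^ i)" by (intro summable_mult summable_geometric) simp
    ultimately have "summable (\<lambda>i. b (Suc i))" by (rule summable_comparison_test'[rotated])
    then show ?thesis by (rule summable_Suc_iff[THEN iffD1])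
  qed
  define M where "M = suminf b"
  have M: "(\<Sum>j<J. b j) \<le> M" for J
    unfolding M_def using \<open>summable b\<close> b0 by (intro sum_le_suminf) (auto simp: less_imp_le)
  have M0: "M \<ge> 0" using M[of 0] by simp
  have partial: "(\<Sum>n\<in>F. (norm (\<Sum>j<J. - \<i> * prop_piece j l n))\<^sup>2) \<le> M * M" if F: "finite F" for F :: "(int ^ 'd) set" and J
  proof -
    define w where "w = (\<lambda>j (n :: int ^ 'd). integral {dyadic j..dyadic (Suc j)} (\<lambda>t. exp (Im l * t) * norm (propagator n (of_real t))))"
    have le_w: "norm (prop_piece j l n) \<le> w j n" for j n
      unfolding w_def by (rule norm_prop_piece_le_weighted)
    have wsum: "(\<Sum>n\<in>F. (w j n)\<^sup>2) \<le> (b j)\<^sup>2" for j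
      unfolding w_def b_def using l
      by (intro weighted_prop_mass_sum_le F continuous_intros) (auto simp: mult_left_mono_neg)
    \<comment> \<open>Cauchy-Schwarz with weights \<open>b j\<close>: summed over n it yields the
      triangle inequality in l2 for finitely many pieces.\<close>
    have "(norm (\<Sum>j<J. - \<i> * prop_piece j l n))\<^sup>2 \<le> M * (\<Sum>j<J. (w j n)\<^sup>2 / b j)" for n
    proof -
      have "norm (\<Sum>j<J. - \<i> * prop_piece j l n) \<le> (\<Sum>j<J. w j n)"
        by (rule order.trans[OF norm_sum]) (auto intro!: sum_mono le_w simp: norm_mult)
      then have "(norm (\<Sum>j<J. - \<i> * prop_piece j l n))\<^sup>2 \<le> (\<Sum>j<J. w j n)\<^sup>2" by (intro power_mono) auto
      also have "\<dots> = (\<Sum>j<J. sqrt (b j) * (w j n / sqrt (b j)))\<^sup>2" by (simp add: bn)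
      also have "\<dots> \<le> (\<Sum>j<J. (sqrt (b j))\<^sup>2) * (\<Sum>j<J. (w j n / sqrt (b j))\<^sup>2)"
        by (rule Cauchy_Schwarz_ineq_sum)
      also have "\<dots> = (\<Sum>j<J. b j) * (\<Sum>j<J. (w j n)\<^sup>2 / b j)"
        using b0 by (simp add: power_divide less_imp_le)
      also have "\<dots> \<le> M * (\<Sum>j<J. (w j n)\<^sup>2 / b j)"
        using b0 by (intro mult_right_mono M sum_nonneg divide_nonneg_nonneg) (auto simp: less_imp_le)
      finally show ?thesis .
    qed
    then have "(\<Sum>n\<in>F. (norm (\<Sum>j<J. - \<i> * prop_piece j l n))\<^sup>2) \<le> (\<Sum>n\<in>F. M * (\<Sum>j<J. (w j n)\<^sup>2 / b j))"
      by (rule sum_mono)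
    also have "\<dots> = M * (\<Sum>j<J. (\<Sum>n\<in>F. (w j n)\<^sup>2) / b j)"
      unfolding sum_distrib_left[symmetric] sum_divide_distrib by (subst sum.swap) (rule refl)
    also have "\<dots> \<le> M * (\<Sum>j<J. (b j)\<^sup>2 / b j)"
      using b0 M0 by (intro mult_left_mono sum_mono divide_right_mono wsum) (auto simp: less_imp_le)
    also have "\<dots> = M * (\<Sum>j<J. b j)" by (simp add: power2_eq_square bn)
    also have "\<dots> \<le> M * M" by (intro mult_left_mono M M0)
    finally show ?thesis .
  qed
  have "(\<Sum>n\<in>F. (norm (lower_resolvent l n))\<^sup>2) \<le> M * M" if "finite F" for F :: "(int ^ 'd) set"
  proof (rule tendsto_upperbound)
    show "(\<lambda>J. \<Sum>n\<in>F. (norm (\<Sum>j<J. - \<i> * prop_piece j l n))\<^sup>2) \<longlonglongrightarrow> (\<Sum>n\<in>F. (norm (lower_resolvent l n))\<^sup>2)"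
      using sl unfolding sums_def by (intro tendsto_intros)
  qed (use partial[OF that] in auto)
  then show "(\<lambda>n :: int ^ 'd. (norm (lower_resolvent l n))\<^sup>2) summable_on UNIV"
    by (intro nonneg_bdd_above_summable_on bdd_aboveI[of _ "M * M"]) auto
next
  fix n :: "int ^ 'd"
  have sm: "(\<lambda>j. prop_piece j l n) sums (\<Sum>j. prop_piece j l n)" for n :: "int ^ 'd"
    using l norm_prop_piece_le[of l] summable_comparison_test'[OF summable_prop_mass[OF d, of n], of 0 "\<lambda>j. prop_piece j l n"]
    by (auto simp: summable_sums)
  define E where "E = (\<lambda>j. exp (- \<i> * l * of_real (dyadic j)) * propagator n (of_real (dyadic j)))"
  have "E \<longlonglongrightarrow> 0"
  proof (rule Lim_null_comparison)
    show "\<forall>\<^sub>F j in sequentially. norm (E j) \<le> exp (Im l * dyadic j)"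
    proof (intro always_eventually allI)
      fix j
      have "norm (E j) = exp (Im l * dyadic j) * norm (propagator n (of_real (dyadic j)))"
        by (simp add: E_def norm_mult)
      also have "\<dots> \<le> exp (Im l * dyadic j) * 1" by (intro mult_left_mono norm_propagator_le_1) auto
      finally show "norm (E j) \<le> exp (Im l * dyadic j)" by simp
    qed
    have "filterlim (\<lambda>j. dyadic (Suc j)) at_top sequentially"
      using filterlim_realpow_sequentially_gt1[of "2::real"]
      by (intro filterlim_at_infinity_imp_filterlim_at_top) simp_all
    then have "filterlim dyadic at_top sequentially" by (simp only: filterlim_sequentially_Suc)
    then have "filterlim (\<lambda>j. Im l * dyadic j) at_bot sequentially"
      using l by (intro filterlim_tendsto_neg_mult_at_bot[OF tendsto_const])
    then show "(\<lambda>j. exp (Im l * dyadic j)) \<longlonglongrightarrow> 0"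
      by (rule filterlim_compose[OF exp_at_bot])
  qed
  then have "(\<lambda>j. E (Suc j) - E j) sums (0 - E 0)" by (rule telescope_sums)
  then have 1: "(\<lambda>j. - \<i> * (E (Suc j) - E j)) sums (- \<i> * (0 - E 0))" by (rule sums_mult)
  have "(\<lambda>j. laplacian (prop_piece j l) n - l * prop_piece j l n) sums
      (laplacian (\<lambda>n. \<Sum>j. prop_piece j l n) n - l * (\<Sum>j. prop_piece j l n))"
    by (intro sums_diff sums_mult laplacian_sums sm)
  then have "(\<lambda>j. - \<i> * (E (Suc j) - E j)) sums (laplacian (\<lambda>n. \<Sum>j. prop_piece j l n) n - l * (\<Sum>j. prop_piece j l n))"
    unfolding laplacian_prop_piece E_def .
  from sums_unique2[OF this 1]
  have "laplacian (\<lambda>n. \<Sum>j. prop_piece j l n) n - l * (\<Sum>j. prop_piece j l n) = - \<i> * (0 - E 0)" .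
  moreover have "E 0 = (if n = 0 then 1 else 0)" by (simp add: E_def propagator_at_0)
  moreover have "laplacian (lower_resolvent l) n - l * lower_resolvent l n =
     - \<i> * (laplacian (\<lambda>n. \<Sum>j. prop_piece j l n) n - l * (\<Sum>j. prop_piece j l n))"
    unfolding lower_resolvent_def[abs_def] laplacian_cmult by (simp add: algebra_simps)
  ultimately show "laplacian (lower_resolvent l) n - l * lower_resolvent l n = (if n = 0 then 1 else 0)" by simp
qed

lemma is_resolvent_kernel_cnj:
  assumes "is_resolvent_kernel l G"
  shows "is_resolvent_kernel (cnj l) (\<lambda>n. cnj (G n))"
proof -
  have "cnj (laplacian G n - l * G n) = (if n = 0 then 1 else 0)" for n
    using assms by (simp add: is_resolvent_kernel_def)
  then show ?thesis using assms by (simp add: is_resolvent_kernel_def laplacian_cnj)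
qed

lemma is_resolvent_kernel_upper:
  assumes "CARD('d::finite) \<ge> 3" "Im l > 0"
  shows "is_resolvent_kernel l (upper_resolvent l :: int ^ 'd \<Rightarrow> complex)"
  using is_resolvent_kernel_cnj[OF is_resolvent_kernel_lower[OF assms(1), of "cnj l"]] assms(2)
  by (simp add: upper_resolvent_def[abs_def])

lemma abs_summable_on_mult_square_summable:
  fixes f g :: "'i \<Rightarrow> complex"
  assumes "(\<lambda>i. (norm (f i))\<^sup>2) summable_on A" "(\<lambda>i. (norm (g i))\<^sup>2) summable_on A"
  shows "(\<lambda>i. norm (f i * g i)) summable_on A"
proof (rule Infinite_Sum.abs_summable_on_comparison_test')
  show "(\<lambda>i. (norm (f i))\<^sup>2 + (norm (g i))\<^sup>2) summable_on A" using assms by (rule summable_on_add)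
  fix i
  have "0 \<le> (norm (f i) - norm (g i))\<^sup>2" by simp
  then have "2 * (norm (f i) * norm (g i)) \<le> (norm (f i))\<^sup>2 + (norm (g i))\<^sup>2"
    by (simp add: power2_eq_square algebra_simps)
  moreover have "0 \<le> norm (f i) * norm (g i)" by simp
  ultimately show "norm (f i * g i) \<le> (norm (f i))\<^sup>2 + (norm (g i))\<^sup>2" unfolding norm_mult by linarith
qed

lemma bij_shift: "bij_betw (\<lambda>m. m + e) UNIV (UNIV :: 'a::ab_group_add set)"
  by (rule bij_betwI[where g = "\<lambda>m. m - e"]) auto

lemma bij_reflect: "bij_betw (\<lambda>m. e - m) UNIV (UNIV :: 'a::ab_group_add set)"
  by (rule bij_betwI[where g = "\<lambda>m. e - m"]) auto

lemma has_sum_finite_sum: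
  fixes f :: "'i \<Rightarrow> 'a \<Rightarrow> 'b::real_normed_vector"
  assumes "finite I" "\<And>i. i \<in> I \<Longrightarrow> (f i has_sum s i) A"
  shows "((\<lambda>x. \<Sum>i\<in>I. f i x) has_sum (\<Sum>i\<in>I. s i)) A"
  using assms by (induction I rule: finite_induct) (auto intro!: has_sum_add)

text \<open>Here \<open>s e\<close> is the convolution of G and f at n + e. Phrasing the identity
  through these values lets it prove both that convolution is a right inverse of Delta - l and, once
  the shifts are moved onto f, that it is a left inverse.\<close>

lemma resolvent_kernel_stencil:
  fixes G f s :: "int ^ 'd::finite \<Rightarrow> complex"
  assumes G: "is_resolvent_kernel l G" and s: "\<And>e. ((\<lambda>m. G (n + e - m) * f m) has_sum s e) UNIV"
  shows "1 / 2 * (\<Sum>i\<in>UNIV. s (- axis i 1) + s (axis i 1)) + (- l) * s 0 = f n" (is "?S = _")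
proof -
  have "((\<lambda>m. (1 / 2 * (\<Sum>i\<in>UNIV. G (n + (- axis i 1) - m) * f m + G (n + axis i 1 - m) * f m)) + (- l) * (G (n + 0 - m) * f m))
     has_sum ?S) UNIV"
    by (intro has_sum_add has_sum_cmult_right has_sum_finite_sum s) auto
  moreover have "(1 / 2 * (\<Sum>i\<in>UNIV. G (n + (- axis i 1) - m) * f m + G (n + axis i 1 - m) * f m)) + (- l) * (G (n + 0 - m) * f m)
     = (if m = n then f n else 0)" for m
  proof -
    have shift: "n + (- axis i 1) - m = (n - m) - axis i 1" "n + axis i 1 - m = (n - m) + axis i 1" for i
      by (simp_all add: algebra_simps)
    have "(1 / 2 * (\<Sum>i\<in>UNIV. G (n + (- axis i 1) - m) * f m + G (n + axis i 1 - m) * f m)) + (- l) * (G (n + 0 - m) * f m)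
      = (laplacian G (n - m) - l * G (n - m)) * f m"
      unfolding laplacian_eq shift by (simp add: distrib_right[symmetric] sum_distrib_right[symmetric] left_diff_distrib mult.assoc)
    also have "\<dots> = (if m = n then f n else 0)" using G by (auto simp: is_resolvent_kernel_def)
    finally show ?thesis .
  qed
  ultimately have "((\<lambda>m. if m = n then f n else 0) has_sum ?S) UNIV" by (simp only:)
  moreover have "((\<lambda>m. if m = n then f n else 0) has_sum f n) UNIV"
    by (rule has_sum_finite_neutralI[of "{n}"]) auto
  ultimately show ?thesis by (rule has_sum_unique)
qed

lemma square_summable_reflect:
  fixes G :: "'a::ab_group_add \<Rightarrow> complex"
  assumes "(\<lambda>n. (norm (G n))\<^sup>2) summable_on UNIV"
  shows "(\<lambda>m. (norm (G (e - m)))\<^sup>2) summable_on UNIV"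
  using summable_on_reindex_bij_betw[OF bij_reflect[of e], of "\<lambda>n. (norm (G n))\<^sup>2"] assms by simp

lemma has_sum_kernel:
  fixes G f :: "int ^ 'd::finite \<Rightarrow> complex"
  assumes G: "is_resolvent_kernel l G" and f: "(\<lambda>n. (norm (f n))\<^sup>2) summable_on UNIV"
  shows "((\<lambda>m. G (n - m) * f m) has_sum (\<Sum>\<^sub>\<infinity>m. G (n - m) * f m)) UNIV"
proof -
  have "(\<lambda>n. (norm (G n))\<^sup>2) summable_on UNIV" using G by (simp add: is_resolvent_kernel_def)
  from abs_summable_on_mult_square_summable[OF square_summable_reflect[OF this] f]
  show ?thesis by (intro has_sum_infsum) (rule Infinite_Sum.abs_summable_summable)
qed

text \<open>Summation by parts: reindexing the sum moves the lattice shifts from G to f.\<close>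

lemma resolvent_kernel_convolution:
  fixes G f :: "int ^ 'd::finite \<Rightarrow> complex"
  assumes G: "is_resolvent_kernel l G" and f: "(\<lambda>n. (norm (f n))\<^sup>2) summable_on UNIV"
  shows "((\<lambda>m. G (n - m) * (laplacian f m - l * f m)) has_sum f n) UNIV"
proof -
  define s where "s = (\<lambda>e. \<Sum>\<^sub>\<infinity>m. G (n + e - m) * f m)"
  have s: "((\<lambda>m. G (n + e - m) * f m) has_sum s e) UNIV" for e
    unfolding s_def by (rule has_sum_kernel[OF G f])
  have s': "((\<lambda>m. G (n - m) * f (m + e)) has_sum s e) UNIV" for e
    using s[of e] has_sum_reindex_bij_betw[OF bij_shift[of e], of "\<lambda>m. G (n + e - m) * f m" "s e"] by (simp add: algebra_simps)
  have minus: "m - axis i 1 = m + (- axis i 1)" for i and m :: "int ^ 'd" by simp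
  have "((\<lambda>m. (1 / 2 * (\<Sum>i\<in>UNIV. G (n - m) * f (m + (- axis i 1)) + G (n - m) * f (m + axis i 1))) + (- l) * (G (n - m) * f (m + 0)))
     has_sum (1 / 2 * (\<Sum>i\<in>UNIV. s (- axis i 1) + s (axis i 1)) + (- l) * s 0)) UNIV"
    by (intro has_sum_add has_sum_cmult_right has_sum_finite_sum s') auto
  moreover have "(1 / 2 * (\<Sum>i\<in>UNIV. G (n - m) * f (m + (- axis i 1)) + G (n - m) * f (m + axis i 1))) + (- l) * (G (n - m) * f (m + 0))
    = G (n - m) * (laplacian f m - l * f m)" for m
    unfolding laplacian_eq minus by (simp add: sum_distrib_left algebra_simps)
  ultimately show ?thesis using resolvent_kernel_stencil[OF G s] by simp
qed

lemma square_summable_diff: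
  fixes f g :: "'i \<Rightarrow> complex"
  assumes "(\<lambda>i. (norm (f i))\<^sup>2) summable_on A" "(\<lambda>i. (norm (g i))\<^sup>2) summable_on A"
  shows "(\<lambda>i. (norm (f i - g i))\<^sup>2) summable_on A"
proof (rule summable_on_comparison_test)
  show "(\<lambda>i. 2 * (norm (f i))\<^sup>2 + 2 * (norm (g i))\<^sup>2) summable_on A"
    using assms by (intro summable_on_add summable_on_cmult_right)
  fix i
  have "(norm (f i - g i))\<^sup>2 \<le> (norm (f i) + norm (g i))\<^sup>2" by (intro power_mono norm_triangle_ineq4) auto
  also have "\<dots> \<le> 2 * (norm (f i))\<^sup>2 + 2 * (norm (g i))\<^sup>2"
    using zero_le_power2[of "norm (f i) - norm (g i)"] by (simp add: power2_eq_square algebra_simps)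
  finally show "(norm (f i - g i))\<^sup>2 \<le> 2 * (norm (f i))\<^sup>2 + 2 * (norm (g i))\<^sup>2" .
qed auto

text \<open>f - g is recovered by convolving G with (Delta - l)(f - g) = 0. Thus the existence of
  one kernel makes Delta - l injective on l2.\<close>

lemma resolvent_equation_unique:
  fixes f g G :: "int ^ 'd::finite \<Rightarrow> complex"
  assumes G: "is_resolvent_kernel l G"
    and f: "(\<lambda>n. (norm (f n))\<^sup>2) summable_on UNIV" and g: "(\<lambda>n. (norm (g n))\<^sup>2) summable_on UNIV"
    and eq: "\<And>n. laplacian f n - l * f n = laplacian g n - l * g n"
  shows "f = g"
proof
  fix n :: "int ^ 'd"
  have "((\<lambda>m. G (n - m) * (laplacian (\<lambda>n. f n - g n) m - l * (f m - g m))) has_sum (f n - g n)) UNIV"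
    by (rule resolvent_kernel_convolution[OF G square_summable_diff[OF f g]])
  moreover have "laplacian (\<lambda>n. f n - g n) m - l * (f m - g m) = 0" for m :: "int ^ 'd"
    using eq[of m] by (simp add: laplacian_diff algebra_simps)
  ultimately have "((\<lambda>m :: int ^ 'd. 0) has_sum (f n - g n)) UNIV" by simp
  moreover have "((\<lambda>m :: int ^ 'd. 0) has_sum (0 :: complex)) UNIV" by simp
  ultimately have "f n - g n = 0" by (rule has_sum_unique)
  then show "f n = g n" by simp
qed

lemma is_resolvent_kernel_unique:
  assumes "is_resolvent_kernel l G" "is_resolvent_kernel l G'"
  shows "G = G'"
  using assms by (intro resolvent_equation_unique[OF assms(1)]) (auto simp: is_resolvent_kernel_def)

section \<open>The Neumann series near infinity\<close>

definition laplacian_power :: "nat \<Rightarrow> int ^ 'd::finite \<Rightarrow> complex" where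
  "laplacian_power k = (laplacian ^^ k) (unit_fun 0)"

text \<open>The expansion of the resolvent at infinity in powers of \<open>s = 1 / l\<close>.\<close>

definition neumann_resolvent :: "complex \<Rightarrow> int ^ 'd::finite \<Rightarrow> complex" where
  "neumann_resolvent s n = - (\<Sum>k. laplacian_power k n * s ^ Suc k)"

lemma sum_norm_laplacian_le:
  fixes f :: "int ^ 'd::finite \<Rightarrow> complex"
  assumes K: "\<And>F. finite F \<Longrightarrow> (\<Sum>n\<in>F. norm (f n)) \<le> K" and F: "finite F"
  shows "(\<Sum>n\<in>F. norm (laplacian f n)) \<le> real CARD('d) * K"
proof -
  have shift: "(\<Sum>n\<in>F. norm (f (n + e))) \<le> K" for e
    using K[of "(\<lambda>n. n + e) ` F"] F by (simp add: sum.reindex inj_on_def)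
  have minus: "n - axis i 1 = n + (- axis i 1)" for i and n :: "int ^ 'd" by simp
  have "norm (laplacian f n) \<le> (\<Sum>i\<in>UNIV. norm (f (n + (- axis i 1))) + norm (f (n + axis i 1))) / 2" for n
  proof -
    have "norm (laplacian f n) = norm (\<Sum>i\<in>UNIV. f (n + (- axis i 1)) + f (n + axis i 1)) / 2"
      unfolding laplacian_eq minus by (simp add: norm_divide)
    also have "\<dots> \<le> (\<Sum>i\<in>UNIV. norm (f (n + (- axis i 1))) + norm (f (n + axis i 1))) / 2"
      by (intro divide_right_mono order.trans[OF norm_sum] sum_mono norm_triangle_ineq) auto
    finally show ?thesis .
  qed
  then have "(\<Sum>n\<in>F. norm (laplacian f n)) \<le> (\<Sum>n\<in>F. (\<Sum>i\<in>UNIV. norm (f (n + (- axis i 1))) + norm (f (n + axis i 1))) / 2)"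
    by (rule sum_mono)
  also have "\<dots> = (\<Sum>i\<in>UNIV. (\<Sum>n\<in>F. norm (f (n + (- axis i 1)))) + (\<Sum>n\<in>F. norm (f (n + axis i 1)))) / 2"
    unfolding sum_divide_distrib[symmetric] by (subst sum.swap) (simp only: sum.distrib)
  also have "\<dots> \<le> (\<Sum>i\<in>(UNIV :: 'd set). K + K) / 2"
    by (intro divide_right_mono sum_mono add_mono shift) auto
  also have "\<dots> = real CARD('d) * K" by simp
  finally show ?thesis .
qed

lemma sum_norm_laplacian_power_le:
  fixes F :: "(int ^ 'd::finite) set"
  assumes "finite F"
  shows "(\<Sum>n\<in>F. norm (laplacian_power k n)) \<le> real CARD('d) ^ k"
  using assms
proof (induction k arbitrary: F)
  case 0
  have "(\<Sum>n\<in>F. norm (laplacian_power 0 n)) = (\<Sum>n\<in>F. if n = 0 then 1 else 0)"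
    by (intro sum.cong) (auto simp: laplacian_power_def unit_fun_def)
  then show ?case using 0 by simp
next
  case (Suc k)
  have "laplacian_power (Suc k) = laplacian (laplacian_power k :: int ^ 'd \<Rightarrow> complex)"
    by (simp add: laplacian_power_def)
  then show ?case using sum_norm_laplacian_le[OF Suc.IH Suc.prems] by simp
qed

lemma norm_laplacian_power_le: "norm (laplacian_power k (n :: int ^ 'd::finite)) \<le> real CARD('d) ^ k"
  using sum_norm_laplacian_power_le[of "{n}" k] by simp

lemma neumann_resolvent_sums:
  fixes n :: "int ^ 'd::finite"
  assumes "real CARD('d) * norm s < 1"
  shows "summable (\<lambda>k. norm (laplacian_power k n * s ^ Suc k))"
    "(\<lambda>k. - (laplacian_power k n * s ^ Suc k)) sums neumann_resolvent s n"
proof -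
  have le: "norm (laplacian_power k n * s ^ Suc k) \<le> norm s * (real CARD('d) * norm s) ^ k" for k
  proof -
    have "norm (laplacian_power k n * s ^ Suc k) \<le> real CARD('d) ^ k * norm (s ^ Suc k)"
      unfolding norm_mult[of "laplacian_power k n"] by (intro mult_right_mono norm_laplacian_power_le) auto
    then show ?thesis by (simp add: norm_mult norm_power power_mult_distrib mult_ac)
  qed
  have "summable (\<lambda>k. norm s * (real CARD('d) * norm s) ^ k)"
    using assms by (intro summable_mult summable_geometric) auto
  then show *: "summable (\<lambda>k. norm (laplacian_power k n * s ^ Suc k))"
    by (rule summable_comparison_test'[where N = 0]) (use le in \<open>simp del: power_Suc\<close>)
  show "(\<lambda>k. - (laplacian_power k n * s ^ Suc k)) sums neumann_resolvent s n"
    unfolding neumann_resolvent_def by (intro sums_minus summable_sums summable_norm_cancel[OF *])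
qed

lemma holomorphic_neumann_resolvent:
  fixes n :: "int ^ 'd::finite"
  shows "(\<lambda>s. neumann_resolvent s n) holomorphic_on ball 0 (1 / real CARD('d))"
proof (rule power_series_holomorphic[where a = "\<lambda>k. if k = 0 then 0 else - laplacian_power (k - 1) n"])
  fix s :: complex assume "s \<in> ball 0 (1 / real CARD('d))"
  then have "real CARD('d) * norm s < 1" by (simp add: field_simps)
  from neumann_resolvent_sums(2)[OF this, of n]
  have "(\<lambda>k. (if Suc k = 0 then 0 else - laplacian_power (Suc k - 1) n) * (s - 0) ^ Suc k) sums neumann_resolvent s n"
    by simp
  then show "(\<lambda>k. (if k = 0 then 0 else - laplacian_power (k - 1) n) * (s - 0) ^ k) sums neumann_resolvent s n"
    by (subst (asm) sums_Suc_iff) simp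
qed

text \<open>The Laplacian has norm at most d on l1, so the series is dominated by a geometric one
  with sum \<open>M\<close> in l1. An l1 bound M also bounds each entry, which gives M^2 for the
  squared l2 norm. Delta - 1/s makes the series telescope.\<close>

lemma is_resolvent_kernel_neumann:
  assumes s: "real CARD('d::finite) * norm s < 1" "s \<noteq> 0"
  shows "is_resolvent_kernel (1 / s) (neumann_resolvent s :: int ^ 'd \<Rightarrow> complex)"
  unfolding is_resolvent_kernel_def
proof (intro conjI allI)
  define M where "M = norm s / (1 - real CARD('d) * norm s)"
  have partial: "(\<Sum>n\<in>F. norm (\<Sum>k<J. - (laplacian_power k n * s ^ Suc k))) \<le> M" if F: "finite F" for F :: "(int ^ 'd) set" and J
  proof -
    have "(\<Sum>n\<in>F. norm (\<Sum>k<J. - (laplacian_power k n * s ^ Suc k))) \<le> (\<Sum>n\<in>F. \<Sum>k<J. norm (laplacian_power k n) * norm (s ^ Suc k))"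
      by (intro sum_mono order.trans[OF norm_sum]) (simp add: norm_mult)
    also have "\<dots> = (\<Sum>k<J. (\<Sum>n\<in>F. norm (laplacian_power k n)) * norm (s ^ Suc k))"
      unfolding sum_distrib_right by (rule sum.swap)
    also have "\<dots> \<le> (\<Sum>k<J. real CARD('d) ^ k * norm (s ^ Suc k))"
      by (intro sum_mono mult_right_mono sum_norm_laplacian_power_le F) auto
    also have "\<dots> = (\<Sum>k<J. norm s * (real CARD('d) * norm s) ^ k)"
      by (simp add: norm_mult norm_power power_mult_distrib mult_ac)
    also have "\<dots> \<le> (\<Sum>k. norm s * (real CARD('d) * norm s) ^ k)"
      using s by (intro sum_le_suminf summable_mult summable_geometric) auto
    also have "\<dots> = M" using s by (simp add: M_def suminf_mult suminf_geometric)
    finally show ?thesis .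
  qed
  have total: "(\<Sum>n\<in>F. norm (neumann_resolvent s n)) \<le> M" if "finite F" for F :: "(int ^ 'd) set"
  proof (rule tendsto_upperbound)
    show "(\<lambda>J. \<Sum>n\<in>F. norm (\<Sum>k<J. - (laplacian_power k n * s ^ Suc k))) \<longlonglongrightarrow> (\<Sum>n\<in>F. norm (neumann_resolvent s n))"
      using neumann_resolvent_sums(2)[OF s(1)] unfolding sums_def by (intro tendsto_intros)
  qed (use partial[OF that] in auto)
  have sq: "(\<Sum>n\<in>F. (norm (neumann_resolvent s n))\<^sup>2) \<le> M * M" if F: "finite F" for F :: "(int ^ 'd) set"
  proof -
    have M0: "M \<ge> 0" using total[of "{}"] by simp
    have "(\<Sum>n\<in>F. (norm (neumann_resolvent s n))\<^sup>2) \<le> (\<Sum>n\<in>F. M * norm (neumann_resolvent s n))"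
    proof (rule sum_mono)
      fix n :: "int ^ 'd"
      have "norm (neumann_resolvent s n) \<le> M" using total[of "{n}"] by simp
      then show "(norm (neumann_resolvent s n))\<^sup>2 \<le> M * norm (neumann_resolvent s n)"
        by (simp add: power2_eq_square mult_right_mono)
    qed
    also have "\<dots> = M * (\<Sum>n\<in>F. norm (neumann_resolvent s n))" by (simp add: sum_distrib_left)
    also have "\<dots> \<le> M * M" by (intro mult_left_mono total F M0)
    finally show ?thesis .
  qed
  then show "(\<lambda>n :: int ^ 'd. (norm (neumann_resolvent s n))\<^sup>2) summable_on UNIV"
    by (intro nonneg_bdd_above_summable_on bdd_aboveI[of _ "M * M"]) auto
next
  fix n :: "int ^ 'd"
  note sm = neumann_resolvent_sums(2)[OF s(1)]
  have Suc: "laplacian_power (Suc k) = laplacian (laplacian_power k :: int ^ 'd \<Rightarrow> complex)" for k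
    by (simp add: laplacian_power_def)
  define a where "a = (\<lambda>k. laplacian_power k n * s ^ k)"
  have "(\<lambda>k. laplacian (\<lambda>n. - (laplacian_power k n * s ^ Suc k)) n - 1 / s * - (laplacian_power k n * s ^ Suc k)) sums
    (laplacian (neumann_resolvent s) n - 1 / s * neumann_resolvent s n)"
    by (intro sums_diff sums_mult laplacian_sums sm)
  moreover have "laplacian (\<lambda>n. - (laplacian_power k n * s ^ Suc k)) n - 1 / s * - (laplacian_power k n * s ^ Suc k)
    = - (a (Suc k) - a k)" for k
  proof -
    have "(\<lambda>n :: int ^ 'd. - (laplacian_power k n * s ^ Suc k)) = (\<lambda>n. - (s ^ Suc k) * laplacian_power k n)" by (simp add: mult.commute)
    then have "laplacian (\<lambda>n. - (laplacian_power k n * s ^ Suc k)) n = - (s ^ Suc k) * laplacian (laplacian_power k) n"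
      by (simp only: laplacian_cmult)
    then show ?thesis using s(2) by (simp add: a_def Suc)
  qed
  ultimately have 1: "(\<lambda>k. - (a (Suc k) - a k)) sums (laplacian (neumann_resolvent s) n - 1 / s * neumann_resolvent s n)"
    by simp
  have "a \<longlonglongrightarrow> 0"
  proof -
    have "(\<lambda>k. laplacian_power k n * s ^ Suc k) \<longlonglongrightarrow> 0"
      using summable_LIMSEQ_zero[OF summable_norm_cancel[OF neumann_resolvent_sums(1)[OF s(1)]]] .
    then have "(\<lambda>k. 1 / s * (laplacian_power k n * s ^ Suc k)) \<longlonglongrightarrow> 1 / s * 0" by (intro tendsto_intros)
    then show ?thesis using s(2) by (simp add: a_def)
  qed
  then have "(\<lambda>k. - (a (Suc k) - a k)) sums - (0 - a 0)" by (intro sums_minus telescope_sums)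
  from sums_unique2[OF 1 this] show "laplacian (neumann_resolvent s) n - 1 / s * neumann_resolvent s n = (if n = 0 then 1 else 0)"
    by (simp add: a_def laplacian_power_def unit_fun_def)
qed

section \<open>Matching the half planes across the real axis and transfer to the disc\<close>

lemma continuous_on_upper_resolvent:
  fixes n :: "int ^ 'd::finite"
  assumes "CARD('d) \<ge> 3"
  shows "continuous_on {l. Im l \<ge> 0} (\<lambda>l. upper_resolvent l n)"
  unfolding upper_resolvent_def
  by (intro continuous_on_cnj continuous_on_compose2[OF continuous_on_lower_resolvent[OF assms]] continuous_intros) auto

lemma holomorphic_on_upper_resolvent:
  fixes n :: "int ^ 'd::finite"
  assumes "CARD('d) \<ge> 3"
  shows "(\<lambda>l. upper_resolvent l n) holomorphic_on {l. Im l > 0}"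
proof -
  have "cnj ` {l. Im l > 0} = {l. Im l < 0}" by (auto simp: image_iff intro!: exI[of _ "cnj _"])
  then have "cnj \<circ> (\<lambda>l. lower_resolvent l n) \<circ> cnj holomorphic_on {l. Im l > 0}"
    using holomorphic_on_lower_resolvent[OF assms, of n]
    by (intro holomorphic_on_compose_cnj_cnj) (auto simp: open_halfspace_Im_gt)
  then show ?thesis by (simp add: upper_resolvent_def o_def)
qed

lemma norm_upper_resolvent_le:
  fixes n :: "int ^ 'd::finite"
  assumes "CARD('d) \<ge> 3" "Im l \<ge> 0"
  shows "norm (upper_resolvent l n) \<le> prop_total n"
  using norm_lower_resolvent_le[of "cnj l" n] assms by (simp add: upper_resolvent_def)

text \<open>On the real axis square summability of the time integral has not been established, so
  uniqueness is applied at points \<open>u j\<close> below and \<open>v j\<close> above the axis,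
  and the identity passes to the limit by continuity.\<close>

lemma half_plane_resolvents_eq_neumann:
  fixes n :: "int ^ 'd::finite"
  assumes d: "CARD('d) \<ge> 3" and l: "Im l = 0" "norm l > real CARD('d)"
  shows "lower_resolvent l n = neumann_resolvent (1 / l) n" "upper_resolvent l n = neumann_resolvent (1 / l) n"
proof -
  have d0: "real CARD('d) > 0" by simp
  have small: "real CARD('d) * norm (1 / w) < 1" "1 / w \<noteq> 0" if "norm w > real CARD('d)" for w :: complex
    using that d0 by (auto simp: norm_divide divide_less_eq intro: order.strict_trans)
  have cN: "(\<lambda>j. neumann_resolvent (1 / u j) n) \<longlonglongrightarrow> neumann_resolvent (1 / l) n" if "u \<longlonglongrightarrow> l" for u
  proof (rule isCont_tendsto_compose[where g = "\<lambda>s. neumann_resolvent s n"])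
    have "1 / l \<in> ball 0 (1 / real CARD('d))" using small(1)[OF l(2)] by (simp add: field_simps)
    then show "isCont (\<lambda>s. neumann_resolvent s n) (1 / l)"
      using holomorphic_on_imp_continuous_on[OF holomorphic_neumann_resolvent] continuous_on_interior by fastforce
    show "(\<lambda>j. 1 / u j) \<longlonglongrightarrow> 1 / l" using that l d0 by (intro tendsto_intros) auto
  qed
  have big: "\<forall>\<^sub>F j in sequentially. norm (u j) > real CARD('d)" if "u \<longlonglongrightarrow> l" for u
    by (rule order_tendstoD(1)[OF tendsto_norm[OF that] l(2)])
  define u where "u = (\<lambda>j. l - \<i> * of_real (1 / Suc j))"
  have u: "u \<longlonglongrightarrow> l"
  proof -
    have "u \<longlonglongrightarrow> l - \<i> * of_real 0" unfolding u_def
      using LIMSEQ_inverse_real_of_nat by (intro tendsto_intros) (simp add: inverse_eq_divide)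
    then show ?thesis by simp
  qed
  have Imu: "Im (u j) < 0" for j using l by (simp add: u_def)
  have "(\<lambda>j. lower_resolvent (u j) n) \<longlonglongrightarrow> lower_resolvent l n"
    using l Imu by (intro continuous_on_tendsto_compose[OF continuous_on_lower_resolvent[OF d] u]) (auto simp: less_imp_le)
  moreover have "\<forall>\<^sub>F j in sequentially. lower_resolvent (u j) n = neumann_resolvent (1 / u j) n"
    using big[OF u]
  proof eventually_elim
    case (elim j)
    then show ?case
      using is_resolvent_kernel_unique[OF is_resolvent_kernel_lower[OF d Imu[of j]] is_resolvent_kernel_neumann[OF small[OF elim], simplified]]
      by simp
  qed
  ultimately have "(\<lambda>j. neumann_resolvent (1 / u j) n) \<longlonglongrightarrow> lower_resolvent l n"
    using tendsto_cong by fast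
  from LIMSEQ_unique[OF this cN[OF u]] show "lower_resolvent l n = neumann_resolvent (1 / l) n" .
  define v where "v = (\<lambda>j. l + \<i> * of_real (1 / Suc j))"
  have v: "v \<longlonglongrightarrow> l"
  proof -
    have "v \<longlonglongrightarrow> l + \<i> * of_real 0" unfolding v_def
      using LIMSEQ_inverse_real_of_nat by (intro tendsto_intros) (simp add: inverse_eq_divide)
    then show ?thesis by simp
  qed
  have Imv: "Im (v j) > 0" for j using l by (simp add: v_def)
  have "(\<lambda>j. upper_resolvent (v j) n) \<longlonglongrightarrow> upper_resolvent l n"
    using l Imv by (intro continuous_on_tendsto_compose[OF continuous_on_upper_resolvent[OF d] v]) (auto simp: less_imp_le)
  moreover have "\<forall>\<^sub>F j in sequentially. upper_resolvent (v j) n = neumann_resolvent (1 / v j) n"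
    using big[OF v]
  proof eventually_elim
    case (elim j)
    then show ?case
      using is_resolvent_kernel_unique[OF is_resolvent_kernel_upper[OF d Imv[of j]] is_resolvent_kernel_neumann[OF small[OF elim], simplified]]
      by simp
  qed
  ultimately have "(\<lambda>j. neumann_resolvent (1 / v j) n) \<longlonglongrightarrow> upper_resolvent l n"
    using tendsto_cong by fast
  from LIMSEQ_unique[OF this cN[OF v]] show "upper_resolvent l n = neumann_resolvent (1 / l) n" .
qed

text \<open>Outside the band both sides equal the Neumann series; dilating l extends the identity to
  the band edges |l| = d.\<close>

lemma lower_eq_upper_resolvent:
  fixes n :: "int ^ 'd::finite"
  assumes d: "CARD('d) \<ge> 3" and l: "Im l = 0" "norm l \<ge> real CARD('d)"
  shows "lower_resolvent l n = upper_resolvent l n"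
proof -
  define u where "u = (\<lambda>j. of_real (1 + 1 / Suc j) * l)"
  have u: "u \<longlonglongrightarrow> l"
  proof -
    have "u \<longlonglongrightarrow> of_real (1 + 0) * l" unfolding u_def
      using LIMSEQ_inverse_real_of_nat by (intro tendsto_intros) (simp add: inverse_eq_divide)
    then show ?thesis by simp
  qed
  have Imu: "Im (u j) = 0" for j using l by (simp add: u_def)
  have nu: "norm (u j) > real CARD('d)" for j
  proof -
    have "norm l > 0" using l d by (auto simp: card_gt_0_iff intro: order.strict_trans2)
    then have "norm l < (1 + 1 / Suc j) * norm l" by simp
    also have "\<dots> = norm (u j)" unfolding u_def norm_mult norm_of_real by simp
    finally show ?thesis using l by simp
  qed
  have "(\<lambda>j. lower_resolvent (u j) n) \<longlonglongrightarrow> lower_resolvent l n"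
    using l Imu by (intro continuous_on_tendsto_compose[OF continuous_on_lower_resolvent[OF d] u]) auto
  moreover have "(\<lambda>j. upper_resolvent (u j) n) \<longlonglongrightarrow> upper_resolvent l n"
    using l Imu by (intro continuous_on_tendsto_compose[OF continuous_on_upper_resolvent[OF d] u]) auto
  moreover have "lower_resolvent (u j) n = upper_resolvent (u j) n" for j
    using half_plane_resolvents_eq_neumann[OF d Imu nu] by simp
  ultimately show ?thesis using LIMSEQ_unique by simp
qed

text \<open>The closed upper half of the disc is mapped into Im l <= 0, which is why the lower
  resolvent appears there. The point 0 corresponds to l = infinity, where the resolvent
  vanishes.\<close>

definition disc_kernel :: "complex \<Rightarrow> int ^ 'd::finite \<Rightarrow> complex" where
  "disc_kernel z n = (if z = 0 then 0
     else if Im z \<ge> 0 then lower_resolvent (spectral_param CARD('d) z) n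
     else upper_resolvent (spectral_param CARD('d) z) n)"

lemma Im_spectral_param:
  "Im (spectral_param d z) = real d / 2 * (Im z * (1 - 1 / (norm z)\<^sup>2))"
proof -
  have "spectral_param d z = of_real (real d / 2) * (z + 1 / z)" by (simp add: spectral_param_def)
  then have "Im (spectral_param d z) = real d / 2 * Im (z + 1 / z)" by (simp only: times_complex.sel Im_complex_of_real Re_complex_of_real)
  also have "Im (z + 1 / z) = Im z * (1 - 1 / (norm z)\<^sup>2)"
    by (simp add: Im_divide cmod_power2 right_diff_distrib)
  finally show ?thesis .
qed

lemma spectral_param_halves:
  assumes "z \<noteq> 0" "d > 0"
  shows "norm z \<le> 1 \<Longrightarrow> Im z \<ge> 0 \<Longrightarrow> Im (spectral_param d z) \<le> 0"
    "norm z \<le> 1 \<Longrightarrow> Im z \<le> 0 \<Longrightarrow> Im (spectral_param d z) \<ge> 0"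
    "norm z < 1 \<Longrightarrow> Im z > 0 \<Longrightarrow> Im (spectral_param d z) < 0"
    "norm z < 1 \<Longrightarrow> Im z < 0 \<Longrightarrow> Im (spectral_param d z) > 0"
proof -
  have le: "1 - 1 / (norm z)\<^sup>2 \<le> 0" if "norm z \<le> 1"
    using that assms by (simp add: divide_simps power_le_one)
  have less: "1 - 1 / (norm z)\<^sup>2 < 0" if "norm z < 1"
    using that assms by (simp add: divide_simps power_less_one_iff)
  show "norm z \<le> 1 \<Longrightarrow> Im z \<ge> 0 \<Longrightarrow> Im (spectral_param d z) \<le> 0"
    "norm z \<le> 1 \<Longrightarrow> Im z \<le> 0 \<Longrightarrow> Im (spectral_param d z) \<ge> 0"
    "norm z < 1 \<Longrightarrow> Im z > 0 \<Longrightarrow> Im (spectral_param d z) < 0"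
    "norm z < 1 \<Longrightarrow> Im z < 0 \<Longrightarrow> Im (spectral_param d z) > 0"
    unfolding Im_spectral_param using le less assms
    by (auto simp: mult_nonneg_nonpos mult_nonpos_nonpos mult_pos_neg mult_neg_neg)
qed

lemma norm_spectral_param_real:
  assumes "z \<noteq> 0" "Im z = 0" "d > 0"
  shows "real d \<le> norm (spectral_param d z)" "norm z < 1 \<Longrightarrow> real d < norm (spectral_param d z)"
    and "Im (spectral_param d z) = 0"
proof -
  obtain x where z: "z = of_real x" and x: "x \<noteq> 0" using assms by (metis complex_eq_iff Im_complex_of_real Re_complex_of_real of_real_eq_0_iff)
  have "norm (spectral_param d z) = real d / 2 * \<bar>x + 1 / x\<bar>"
  proof -
    have "spectral_param d z = of_real (real d / 2 * (x + 1 / x))" by (simp add: spectral_param_def z)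
    then show ?thesis by (simp only: norm_of_real) (simp add: abs_mult)
  qed
  also have "\<bar>x + 1 / x\<bar> = 2 + (1 - \<bar>x\<bar>)\<^sup>2 / \<bar>x\<bar>"
  proof -
    have "x + 1 / x = (1 + x\<^sup>2) / x" using x by (simp add: field_simps power2_eq_square)
    then have "\<bar>x + 1 / x\<bar> = (1 + \<bar>x\<bar>\<^sup>2) / \<bar>x\<bar>" by (simp add: abs_divide)
    also have "\<dots> = 2 + (1 - \<bar>x\<bar>)\<^sup>2 / \<bar>x\<bar>" using x by (simp add: field_simps power2_eq_square)
    finally show ?thesis .
  qed
  finally have n: "norm (spectral_param d z) = real d + real d / 2 * ((1 - \<bar>x\<bar>)\<^sup>2 / \<bar>x\<bar>)" by (simp add: algebra_simps)
  then show "real d \<le> norm (spectral_param d z)" by simp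
  show "real d < norm (spectral_param d z)" if "norm z < 1"
  proof -
    have "(1 - \<bar>x\<bar>)\<^sup>2 / \<bar>x\<bar> > 0" using that x z by auto
    then have "real d / 2 * ((1 - \<bar>x\<bar>)\<^sup>2 / \<bar>x\<bar>) > 0" using assms by (intro mult_pos_pos) auto
    then show ?thesis using n by linarith
  qed
  show "Im (spectral_param d z) = 0" by (simp add: spectral_param_def z)
qed

lemma norm_disc_kernel_le:
  fixes n :: "int ^ 'd::finite"
  assumes "CARD('d) \<ge> 3" "norm z \<le> 1"
  shows "norm (disc_kernel z n) \<le> prop_total n"
  using assms spectral_param_halves(1,2)[of z "CARD('d)"]
  by (auto simp: disc_kernel_def prop_total_nonneg intro!: norm_lower_resolvent_le norm_upper_resolvent_le)

lemma is_resolvent_kernel_disc_kernel: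
  assumes d: "CARD('d::finite) \<ge> 3" and z: "z \<noteq> 0" "norm z < 1"
  shows "is_resolvent_kernel (spectral_param CARD('d) z) (disc_kernel z :: int ^ 'd \<Rightarrow> complex)"
proof -
  let ?l = "spectral_param CARD('d) z"
  consider "Im z > 0" | "Im z < 0" | "Im z = 0" by linarith
  then show ?thesis
  proof cases
    case 1
    then have "disc_kernel z = (lower_resolvent ?l :: int ^ 'd \<Rightarrow> complex)" using z by (auto simp: disc_kernel_def)
    then show ?thesis using is_resolvent_kernel_lower[OF d] spectral_param_halves(3)[OF z(1)] z 1 by simp
  next
    case 2
    then have "disc_kernel z = (upper_resolvent ?l :: int ^ 'd \<Rightarrow> complex)" using z by (auto simp: disc_kernel_def)
    then show ?thesis using is_resolvent_kernel_upper[OF d] spectral_param_halves(4)[OF z(1)] z 2 by simp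
  next
    case 3
    have l: "Im ?l = 0" "norm ?l > real CARD('d)"
      using norm_spectral_param_real[OF z(1) 3, of "CARD('d)"] z by auto
    have "?l \<noteq> 0" using l by auto
    have "disc_kernel z = (neumann_resolvent (1 / ?l) :: int ^ 'd \<Rightarrow> complex)"
      using z 3 half_plane_resolvents_eq_neumann[OF d l] by (auto simp: disc_kernel_def)
    moreover have "is_resolvent_kernel (1 / (1 / ?l)) (neumann_resolvent (1 / ?l) :: int ^ 'd \<Rightarrow> complex)"
      using l \<open>?l \<noteq> 0\<close> by (intro is_resolvent_kernel_neumann) (auto simp: norm_divide divide_less_eq)
    ultimately show ?thesis by simp
  qed
qed

lemma continuous_on_spectral_param: "0 \<notin> S \<Longrightarrow> continuous_on S (spectral_param d)"
  unfolding spectral_param_def[abs_def] by (intro continuous_intros) auto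

text \<open>The open disc is covered by its two open halves and by the open set \<open>U3\<close>
  around the real diameter on which the Neumann series converges. By uniqueness of the kernel, the
  Neumann series represents \<open>disc_kernel\<close> on all of U3.\<close>

lemma holomorphic_on_disc_kernel:
  fixes n :: "int ^ 'd::finite"
  assumes d: "CARD('d) \<ge> 3"
  shows "(\<lambda>z. disc_kernel z n) holomorphic_on ball 0 1"
proof -
  let ?l = "spectral_param CARD('d)"
  \<comment> \<open>The reciprocal of the spectral parameter, in a form that is holomorphic at z = 0
    too.\<close>
  define s where "s = (\<lambda>z::complex. 2 * z / (of_nat CARD('d) * (z\<^sup>2 + 1)))"
  define U1 where "U1 = ball 0 1 \<inter> {z. Im z > 0}"
  define U2 where "U2 = ball 0 1 \<inter> {z. Im z < 0}"
  define U3 where "U3 = {z \<in> ball 0 1. s z \<in> ball 0 (1 / real CARD('d))}"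
  have l_hol: "?l holomorphic_on S" if "0 \<notin> S" for S
    unfolding spectral_param_def[abs_def] using that by (intro holomorphic_intros) auto
  have sq: "z\<^sup>2 + 1 \<noteq> 0" if "z \<in> ball 0 1" for z :: complex
  proof
    assume "z\<^sup>2 + 1 = 0"
    then have "norm (z\<^sup>2) = 1" by (simp add: add_eq_0_iff2)
    then show False using that norm_ge_zero[of z] by (auto simp: norm_power power2_eq_1_iff simp del: norm_ge_zero)
  qed
  have s_hol: "s holomorphic_on ball 0 1" unfolding s_def using sq by (intro holomorphic_intros) auto
  have s_inv: "s z = 1 / ?l z" if "z \<in> ball 0 1" "z \<noteq> 0" for z
    using sq[OF that(1)] that(2) by (simp add: s_def spectral_param_def field_simps power2_eq_square)
  have U3: "U3 = ball 0 1 \<inter> s -` ball 0 (1 / real CARD('d))" by (auto simp: U3_def)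
  have op: "open U1" "open U2" "open U3"
    unfolding U1_def U2_def U3
    by (intro open_Int open_halfspace_Im_gt open_halfspace_Im_lt open_ball
        continuous_open_preimage[OF holomorphic_on_imp_continuous_on[OF s_hol]])+
  have eq1: "disc_kernel z n = lower_resolvent (?l z) n" if "z \<in> U1" for z
    using that by (auto simp: U1_def disc_kernel_def)
  have eq2: "disc_kernel z n = upper_resolvent (?l z) n" if "z \<in> U2" for z
    using that by (auto simp: U2_def disc_kernel_def)
  have eq3: "disc_kernel z n = neumann_resolvent (s z) n" if "z \<in> U3" for z
  proof (cases "z = 0")
    case True
    then show ?thesis by (simp add: disc_kernel_def s_def neumann_resolvent_def)
  next
    case False
    have z: "norm z < 1" "z \<in> ball 0 1" using that by (auto simp: U3_def)
    have sz: "real CARD('d) * norm (s z) < 1" using that by (simp add: U3_def field_simps)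
    have "s z \<noteq> 0" using False sq[OF z(2)] by (simp add: s_def)
    from is_resolvent_kernel_neumann[OF sz this]
    have "is_resolvent_kernel (?l z) (neumann_resolvent (s z) :: int ^ 'd \<Rightarrow> complex)"
      using s_inv[OF z(2) False] by simp
    from is_resolvent_kernel_unique[OF is_resolvent_kernel_disc_kernel[OF d False z(1)] this] show ?thesis by simp
  qed
  have "(\<lambda>z. lower_resolvent (?l z) n) holomorphic_on U1"
  proof -
    have "0 \<notin> U1" by (simp add: U1_def)
    moreover have "?l ` U1 \<subseteq> {l. Im l < 0}"
    proof
      fix l assume "l \<in> ?l ` U1"
      then obtain z where "z \<in> U1" "l = ?l z" by blast
      moreover from this have "z \<noteq> 0" using \<open>0 \<notin> U1\<close> by blast
      ultimately show "l \<in> {l. Im l < 0}" using spectral_param_halves(3)[of z "CARD('d)"] by (simp add: U1_def)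
    qed
    moreover note \<open>0 \<notin> U1\<close>
    ultimately show ?thesis using holomorphic_on_compose_gen[OF l_hol holomorphic_on_lower_resolvent[OF d, of n]] by (simp add: o_def)
  qed
  then have h1: "(\<lambda>z. disc_kernel z n) holomorphic_on U1" by (rule holomorphic_transform) (simp add: eq1)
  have "(\<lambda>z. upper_resolvent (?l z) n) holomorphic_on U2"
  proof -
    have "0 \<notin> U2" by (simp add: U2_def)
    moreover have "?l ` U2 \<subseteq> {l. Im l > 0}"
    proof
      fix l assume "l \<in> ?l ` U2"
      then obtain z where "z \<in> U2" "l = ?l z" by blast
      moreover from this have "z \<noteq> 0" using \<open>0 \<notin> U2\<close> by blast
      ultimately show "l \<in> {l. Im l > 0}" using spectral_param_halves(4)[of z "CARD('d)"] by (simp add: U2_def)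
    qed
    moreover note \<open>0 \<notin> U2\<close>
    ultimately show ?thesis using holomorphic_on_compose_gen[OF l_hol holomorphic_on_upper_resolvent[OF d, of n]] by (simp add: o_def)
  qed
  then have h2: "(\<lambda>z. disc_kernel z n) holomorphic_on U2" by (rule holomorphic_transform) (simp add: eq2)
  have "(\<lambda>z. neumann_resolvent (s z) n) holomorphic_on U3"
  proof -
    have "U3 \<subseteq> ball 0 1" "s ` U3 \<subseteq> ball 0 (1 / real CARD('d))" by (auto simp: U3_def)
    then show ?thesis
      using holomorphic_on_compose_gen[OF holomorphic_on_subset[OF s_hol] holomorphic_neumann_resolvent[of n]] by (simp add: o_def)
  qed
  then have h3: "(\<lambda>z. disc_kernel z n) holomorphic_on U3" by (rule holomorphic_transform) (simp add: eq3)
  have "ball 0 1 \<subseteq> U1 \<union> U2 \<union> U3"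
  proof
    fix z :: complex assume z: "z \<in> ball 0 1"
    show "z \<in> U1 \<union> U2 \<union> U3"
    proof (cases "Im z = 0 \<and> z \<noteq> 0")
      case True
      then have "norm (?l z) > real CARD('d)" using norm_spectral_param_real(2)[of z "CARD('d)"] z by simp
      then have "norm (s z) < 1 / real CARD('d)"
        using s_inv[OF z] True by (simp add: norm_divide frac_less2)
      then show ?thesis using z by (simp add: U3_def)
    next
      case False
      show ?thesis
      proof (cases "z = 0")
        case True
        then show ?thesis by (simp add: U3_def s_def)
      next
        case F: False
        then show ?thesis using False z by (auto simp: U1_def U2_def)
      qed
    qed
  qed
  then show ?thesis
    using holomorphic_on_Un[OF holomorphic_on_Un[OF h1 h2 op(1,2)] h3 _ op(3)] op holomorphic_on_subset by blast
qed

text \<open>The two closed half discs without 0 are pasted along the real diameter, where lower and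
  upper resolvent agree; the endpoints 1 and -1 are the band edges. Holomorphy in the open disc
  covers the point 0.\<close>

lemma continuous_on_disc_kernel:
  fixes n :: "int ^ 'd::finite"
  assumes d: "CARD('d) \<ge> 3"
  shows "continuous_on (cball 0 1) (\<lambda>z. disc_kernel z n)"
proof -
  let ?l = "spectral_param CARD('d)"
  define A where "A = (cball 0 1 - {0}) \<inter> {z. Im z \<ge> 0}"
  define B where "B = (cball 0 1 - {0}) \<inter> {z. Im z \<le> 0}"
  have AB: "A \<union> B = cball 0 1 - {0}" by (auto simp: A_def B_def)
  have "continuous_on A (\<lambda>z. lower_resolvent (?l z) n)"
    using spectral_param_halves(1)[of _ "CARD('d)"]
    by (intro continuous_on_compose2[OF continuous_on_lower_resolvent[OF d] continuous_on_spectral_param]) (auto simp: A_def)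
  moreover have "lower_resolvent (?l z) n = disc_kernel z n" if "z \<in> A" for z
    using that by (auto simp: A_def disc_kernel_def)
  ultimately have cA: "continuous_on A (\<lambda>z. disc_kernel z n)" by (rule continuous_on_eq)
  have "continuous_on B (\<lambda>z. upper_resolvent (?l z) n)"
    using spectral_param_halves(2)[of _ "CARD('d)"]
    by (intro continuous_on_compose2[OF continuous_on_upper_resolvent[OF d] continuous_on_spectral_param]) (auto simp: B_def)
  moreover have "upper_resolvent (?l z) n = disc_kernel z n" if "z \<in> B" for z
  proof (cases "Im z = 0")
    case True
    have "z \<noteq> 0" using that by (auto simp: B_def)
    then show ?thesis
      using True norm_spectral_param_real(1,3)[of z "CARD('d)"] lower_eq_upper_resolvent[OF d, of "?l z" n]
      by (auto simp: disc_kernel_def)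
  qed (use that in \<open>auto simp: B_def disc_kernel_def\<close>)
  ultimately have cB: "continuous_on B (\<lambda>z. disc_kernel z n)" by (rule continuous_on_eq)
  have "closedin (top_of_set (cball 0 1 - {0})) A" "closedin (top_of_set (cball 0 1 - {0})) B"
    unfolding A_def B_def by (intro closedin_closed_Int closed_halfspace_Im_ge closed_halfspace_Im_le)+
  then have c1: "continuous_on (cball 0 1 - {0}) (\<lambda>z. disc_kernel z n)"
    using continuous_on_Un_local[of A B] cA cB AB by simp
  have c2: "continuous_on (ball 0 1) (\<lambda>z. disc_kernel z n)"
    by (intro holomorphic_on_imp_continuous_on holomorphic_on_disc_kernel d)
  have "(0 :: complex) \<in> ball 0 1" by simp
  then have Un: "ball 0 1 \<union> (cball 0 1 - {0}) = (cball 0 1 :: complex set)"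
    using ball_subset_cball[of "0 :: complex" 1] by blast
  have "openin (top_of_set (cball 0 1)) (ball 0 1 :: complex set)"
    by (intro open_subset) auto
  moreover have "openin (top_of_set (cball 0 1)) (cball 0 1 - {0} :: complex set)"
    by (simp add: openin_delete)
  ultimately show ?thesis
    by (rule continuous_on_Un_local_open[OF _ _ c2 c1, unfolded Un])
qed

section \<open>The regularized determinant\<close>

definition disc_algebra :: "(complex \<Rightarrow> complex) \<Rightarrow> bool" where
  "disc_algebra F \<longleftrightarrow> continuous_on (cball 0 1) F \<and> F holomorphic_on ball 0 1"

named_theorems disc_algebra_intros

lemma disc_algebra_const [disc_algebra_intros]: "disc_algebra (\<lambda>z. c)"
  by (simp add: disc_algebra_def)

lemma disc_algebra_mult [disc_algebra_intros]: "disc_algebra F \<Longrightarrow> disc_algebra G \<Longrightarrow> disc_algebra (\<lambda>z. F z * G z)"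
  by (simp add: disc_algebra_def continuous_on_mult holomorphic_on_mult)

lemma disc_algebra_sum [disc_algebra_intros]: "(\<And>i. i \<in> I \<Longrightarrow> disc_algebra (F i)) \<Longrightarrow> disc_algebra (\<lambda>z. \<Sum>i\<in>I. F i z)"
  unfolding disc_algebra_def by (auto intro!: continuous_on_sum holomorphic_on_sum)

lemma disc_algebra_prod [disc_algebra_intros]: "(\<And>i. i \<in> I \<Longrightarrow> disc_algebra (F i)) \<Longrightarrow> disc_algebra (\<lambda>z. \<Prod>i\<in>I. F i z)"
  unfolding disc_algebra_def by (auto intro!: continuous_on_prod holomorphic_on_prod)

lemma disc_algebra_infsum:
  assumes F: "\<And>i. i \<in> A \<Longrightarrow> disc_algebra (F i)"
    and le: "\<And>i z. i \<in> A \<Longrightarrow> norm z \<le> 1 \<Longrightarrow> norm (F i z) \<le> b i" and b: "b summable_on A"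
  shows "disc_algebra (\<lambda>z. \<Sum>\<^sub>\<infinity>i\<in>A. F i z)"
proof -
  have lim: "uniform_limit (cball 0 1) (\<lambda>X z. \<Sum>i\<in>X. F i z) (\<lambda>z. \<Sum>\<^sub>\<infinity>i\<in>A. F i z) (finite_subsets_at_top A)"
    by (rule Weierstrass_m_test_general[OF _ b]) (simp add: le)
  have ev: "\<forall>\<^sub>F X in finite_subsets_at_top A.
      continuous_on (cball 0 1) (\<lambda>z. \<Sum>i\<in>X. F i z) \<and> (\<lambda>z. \<Sum>i\<in>X. F i z) holomorphic_on ball 0 1"
  proof (rule eventually_finite_subsets_at_top_weakI)
    fix X assume "X \<subseteq> A"
    then have "disc_algebra (\<lambda>z. \<Sum>i\<in>X. F i z)" by (intro disc_algebra_sum F) auto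
    then show "continuous_on (cball 0 1) (\<lambda>z. \<Sum>i\<in>X. F i z) \<and> (\<lambda>z. \<Sum>i\<in>X. F i z) holomorphic_on ball 0 1"
      by (simp add: disc_algebra_def)
  qed
  show ?thesis
    using holomorphic_uniform_limit[OF ev lim finite_subsets_at_top_neq_bot] unfolding disc_algebra_def by metis
qed

lemma norm_infsum_le_infsum:
  fixes f :: "'i \<Rightarrow> complex"
  assumes "b summable_on A" "\<And>i. i \<in> A \<Longrightarrow> norm (f i) \<le> b i"
  shows "norm (infsum f A) \<le> infsum b A"
proof -
  have s: "(\<lambda>i. norm (f i)) summable_on A" by (rule Infinite_Sum.abs_summable_on_comparison_test'[OF assms])
  have "norm (infsum f A) \<le> (\<Sum>\<^sub>\<infinity>i\<in>A. norm (f i))" by (rule norm_infsum_bound[OF s])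
  also have "\<dots> \<le> infsum b A" by (rule infsum_mono[OF s assms(1)]) (rule assms(2))
  finally show ?thesis .
qed

lemma suminf_eq_infsum:
  fixes f :: "nat \<Rightarrow> complex"
  assumes "b summable_on UNIV" "\<And>k. norm (f k) \<le> b k"
  shows "suminf f = infsum f UNIV" "summable f" "f summable_on UNIV"
proof -
  have "(\<lambda>k. norm (f k)) summable_on UNIV"
    by (rule Infinite_Sum.abs_summable_on_comparison_test'[OF assms(1)]) (rule assms(2))
  then show s: "f summable_on UNIV" by (rule Infinite_Sum.abs_summable_summable)
  then have "f sums infsum f UNIV" by (intro has_sum_imp_sums has_sum_infsum)
  then show "suminf f = infsum f UNIV" "summable f" by (simp_all add: sums_iff)
qed

lemma
  fixes f g :: "'i \<Rightarrow> real"
  assumes f: "(\<lambda>i. (f i)\<^sup>2) summable_on A" "\<And>i. i \<in> A \<Longrightarrow> f i \<ge> 0"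
    and g: "(\<lambda>i. (g i)\<^sup>2) summable_on A" "\<And>i. i \<in> A \<Longrightarrow> g i \<ge> 0"
  shows cauchy_schwarz_summable_on: "(\<lambda>i. f i * g i) summable_on A"
    and cauchy_schwarz_infsum: "(\<Sum>\<^sub>\<infinity>i\<in>A. f i * g i) \<le> sqrt (\<Sum>\<^sub>\<infinity>i\<in>A. (f i)\<^sup>2) * sqrt (\<Sum>\<^sub>\<infinity>i\<in>A. (g i)\<^sup>2)"
proof -
  have le: "(\<Sum>i\<in>F. f i * g i) \<le> sqrt (\<Sum>\<^sub>\<infinity>i\<in>A. (f i)\<^sup>2) * sqrt (\<Sum>\<^sub>\<infinity>i\<in>A. (g i)\<^sup>2)" if "finite F" "F \<subseteq> A" for F
  proof -
    have "(\<Sum>i\<in>F. f i * g i) \<le> L2_set f F * L2_set g F"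
      using L2_set_mult_ineq[of f g F] f(2) g(2) that
      by (smt (verit, best) abs_of_nonneg subsetD sum.cong)
    also have "\<dots> \<le> sqrt (\<Sum>\<^sub>\<infinity>i\<in>A. (f i)\<^sup>2) * sqrt (\<Sum>\<^sub>\<infinity>i\<in>A. (g i)\<^sup>2)"
      unfolding L2_set_def using that f g
      by (intro mult_mono real_sqrt_le_mono finite_sum_le_infsum) (auto intro!: infsum_nonneg sum_nonneg)
    finally show ?thesis .
  qed
  show s: "(\<lambda>i. f i * g i) summable_on A"
    using le f(2) g(2) by (intro nonneg_bdd_above_summable_on bdd_aboveI2) auto
  show "(\<Sum>\<^sub>\<infinity>i\<in>A. f i * g i) \<le> sqrt (\<Sum>\<^sub>\<infinity>i\<in>A. (f i)\<^sup>2) * sqrt (\<Sum>\<^sub>\<infinity>i\<in>A. (g i)\<^sup>2)"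
    by (rule infsum_le_finite_sums[OF s]) (rule le)
qed

text \<open>Elementary symmetric functions are coefficients of the generating product of 1 + s w_i,
  which is at most exp (s W); the parameter s is free and is later adapted to k.\<close>

lemma sum_prod_subsets_le:
  fixes w :: "'i \<Rightarrow> real"
  assumes w: "\<And>i. w i \<ge> 0" and W: "\<And>F. finite F \<Longrightarrow> sum w F \<le> W" and s: "s > 0"
    and fin: "finite \<S>" "\<And>S. S \<in> \<S> \<Longrightarrow> finite S \<and> card S = k"
  shows "(\<Sum>S\<in>\<S>. prod w S) \<le> exp (s * W) / s ^ k"
proof -
  define F where "F = \<Union>\<S>"
  have F: "finite F" using fin by (auto simp: F_def)
  have "(\<Sum>S\<in>\<S>. prod w S) * s ^ k = (\<Sum>S\<in>\<S>. \<Prod>i\<in>S. s * w i)"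
    unfolding sum_distrib_right using fin by (intro sum.cong refl) (simp add: prod.distrib)
  also have "\<dots> \<le> (\<Sum>S\<in>Pow F. \<Prod>i\<in>S. s * w i)"
    using F w s by (intro sum_mono2 prod_nonneg) (auto simp: F_def less_imp_le)
  also have "\<dots> = (\<Prod>i\<in>F. s * w i + 1)" using prod_add[OF F, of "\<lambda>i. s * w i" "\<lambda>_. 1"] by simp
  also have "\<dots> \<le> (\<Prod>i\<in>F. exp (s * w i))"
    using w s exp_ge_add_one_self[of "s * w _"] by (intro prod_mono conjI) (auto simp: add.commute intro: add_nonneg_nonneg less_imp_le)
  also have "\<dots> = exp (s * sum w F)" using F by (simp add: exp_sum sum_distrib_left)
  also have "\<dots> \<le> exp (s * W)" using W[OF F] s by simp
  finally show ?thesis using s by (simp add: field_simps)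
qed

text \<open>Hadamard's factor times the bound of \<open>sum_prod_subsets_le\<close> with s = 2 sqrt
  k. This s cancels \<open>sqrt (k^k)\<close> and leaves exp (2 W sqrt k) / 2^k; the value at k = 0
  is 1.\<close>

definition hadamard_series :: "real \<Rightarrow> nat \<Rightarrow> real" where
  "hadamard_series W k = sqrt (real k ^ k) * (exp (2 * sqrt k * W) / (2 * sqrt k) ^ k)"

lemma summable_hadamard_series:
  assumes "W \<ge> 0"
  shows "summable (hadamard_series W)"
proof -
  \<comment> \<open>By completing the square, 2 W sqrt k <= e k + W^2 / e. This e turns exp (e k) /
    2^k into (2/3)^k.\<close>
  define e where "e = ln (4/3 :: real)"
  have e: "e > 0" by (simp add: e_def)
  have "hadamard_series W k \<le> exp (W\<^sup>2 / e) * (2/3) ^ k" if "k > 0" for k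
  proof -
    have "sqrt (real k ^ k) = sqrt k ^ k" by (simp add: real_sqrt_power)
    then have "hadamard_series W k = exp (2 * sqrt k * W) / 2 ^ k"
      using that by (simp add: hadamard_series_def power_mult_distrib)
    moreover have "2 * sqrt k * W \<le> e * k + W\<^sup>2 / e"
    proof -
      have "0 \<le> (sqrt e * sqrt k - W / sqrt e)\<^sup>2" by simp
      also have "\<dots> = e * k - 2 * sqrt k * W + W\<^sup>2 / e"
        using e by (simp add: power2_diff power_mult_distrib power_divide)
      finally show ?thesis by simp
    qed
    then have "exp (2 * sqrt k * W) \<le> exp (W\<^sup>2 / e) * (4/3) ^ k"
    proof -
      have "exp (e * k + W\<^sup>2 / e) = exp (W\<^sup>2 / e) * (4/3) ^ k"
        using exp_of_nat_mult[of k e] by (simp add: exp_add e_def mult.commute)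
      then show ?thesis using \<open>2 * sqrt k * W \<le> _\<close> by (metis exp_le_cancel_iff)
    qed
    ultimately have "hadamard_series W k \<le> exp (W\<^sup>2 / e) * (4/3) ^ k / 2 ^ k" by (simp add: divide_right_mono)
    moreover have "(4/3 :: real) ^ k / 2 ^ k = (2/3) ^ k" by (simp flip: power_divide)
    ultimately show ?thesis by (metis times_divide_eq_right)
  qed
  moreover have "hadamard_series W k \<ge> 0" for k by (simp add: hadamard_series_def)
  ultimately have "norm (hadamard_series W k) \<le> exp (W\<^sup>2 / e) * (2/3) ^ k" if "k \<ge> 1" for k
    using that by simp
  moreover have "summable (\<lambda>k. exp (W\<^sup>2 / e) * (2/3) ^ k)" by (intro summable_mult summable_geometric) simp
  ultimately show ?thesis by (rule summable_comparison_test'[rotated])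
qed

section \<open>The determinant series of a dominated family of matrices\<close>

primrec matrix_power :: "('i \<Rightarrow> 'i \<Rightarrow> complex) \<Rightarrow> nat \<Rightarrow> 'i \<Rightarrow> 'i \<Rightarrow> complex" where
  "matrix_power K 0 = (\<lambda>i j. if i = j then 1 else 0)"
| "matrix_power K (Suc k) = (\<lambda>i j. \<Sum>\<^sub>\<infinity>m. K i m * matrix_power K k m j)"

lemma matrix_power_1: "matrix_power K (Suc 0) i j = K i j"
proof -
  have "(\<Sum>\<^sub>\<infinity>m. K i m * (if m = j then 1 else 0)) = (\<Sum>\<^sub>\<infinity>m\<in>{j}. K i m * (if m = j then 1 else 0))"
    by (rule infsum_cong_neutral) auto
  then show ?thesis by simp
qed

text \<open>The coefficient of \<open>x\<^sup>k\<close> in \<open>(1 + x) exp (- x) - 1\<close>, for \<open>k \<ge> 2\<close>.\<close>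

definition reg_coeff :: "nat \<Rightarrow> complex" where
  "reg_coeff k = (- 1) ^ k / fact k + (- 1) ^ (k - 1) / fact (k - 1)"

text \<open>The matrix of (I + K) exp (- K) - I. The linear term cancels, so the series begins with
  K^2, which is trace class when K is Hilbert-Schmidt.\<close>

definition reg_matrix :: "('i \<Rightarrow> 'i \<Rightarrow> complex) \<Rightarrow> 'i \<Rightarrow> 'i \<Rightarrow> complex" where
  "reg_matrix K i j = (\<Sum>\<^sub>\<infinity>k. reg_coeff (k + 2) * matrix_power K (k + 2) i j)"

definition matrix_minor :: "('i \<Rightarrow> 'i \<Rightarrow> complex) \<Rightarrow> 'i set \<Rightarrow> complex" where
  "matrix_minor T S = (\<Sum>\<pi> | \<pi> permutes S. of_int (sign \<pi>) * (\<Prod>i\<in>S. T i (\<pi> i)))"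

definition matrix_det :: "('i \<Rightarrow> 'i \<Rightarrow> complex) \<Rightarrow> complex" where
  "matrix_det T = (\<Sum>k. \<Sum>\<^sub>\<infinity>S | finite S \<and> card S = k. matrix_minor T S)"

lemma norm_reg_coeff_le: "norm (reg_coeff (k + 2)) \<le> 2 / fact k"
proof -
  have "norm (reg_coeff (k + 2)) \<le> 1 / fact (k + 2) + 1 / fact (k + 1)"
    unfolding reg_coeff_def by (rule order.trans[OF norm_triangle_ineq]) (simp add: norm_divide norm_power norm_fact del: fact_Suc)
  also have "\<dots> \<le> 1 / fact k + 1 / fact k"
    by (intro add_mono divide_left_mono fact_mono mult_pos_pos) auto
  finally show ?thesis by simp
qed

text \<open>One matrix M dominates the whole family of kernels. All estimates depend on M only and
  are therefore uniform on the closed disc.\<close>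

locale hilbert_schmidt_majorant =
  fixes M :: "'i \<Rightarrow> 'i \<Rightarrow> real"
  assumes nonneg: "M i j \<ge> 0"
    and square_summable: "(\<lambda>(i, j). (M i j)\<^sup>2) summable_on UNIV"
begin

definition "row_norm i = sqrt (\<Sum>\<^sub>\<infinity>j. (M i j)\<^sup>2)"
definition "col_norm j = sqrt (\<Sum>\<^sub>\<infinity>i. (M i j)\<^sup>2)"
definition "hs_norm = sqrt (\<Sum>\<^sub>\<infinity>(i, j). (M i j)\<^sup>2)"

lemma row_summable: "(\<lambda>j. (M i j)\<^sup>2) summable_on UNIV"
  using summable_on_SigmaD1[of "\<lambda>i j. (M i j)\<^sup>2" UNIV "\<lambda>_. UNIV" i] square_summable by simp

lemma square_summable_swap: "(\<lambda>(j, i). (M i j)\<^sup>2) summable_on UNIV"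
  using summable_on_reindex_bij_betw[of prod.swap UNIV UNIV "\<lambda>(i, j). (M i j)\<^sup>2"] square_summable
  by (simp add: bij_swap case_prod_unfold)

lemma col_summable: "(\<lambda>i. (M i j)\<^sup>2) summable_on UNIV"
  using summable_on_SigmaD1[of "\<lambda>j i. (M i j)\<^sup>2" UNIV "\<lambda>_. UNIV" j] square_summable_swap by simp

lemma norms_nonneg: "row_norm i \<ge> 0" "col_norm j \<ge> 0" "hs_norm \<ge> 0"
  unfolding row_norm_def col_norm_def hs_norm_def by (auto intro!: infsum_nonneg)

lemma row_norm_sq: "(row_norm i)\<^sup>2 = (\<Sum>\<^sub>\<infinity>j. (M i j)\<^sup>2)"
  and col_norm_sq: "(col_norm j)\<^sup>2 = (\<Sum>\<^sub>\<infinity>i. (M i j)\<^sup>2)"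
  unfolding row_norm_def col_norm_def by (auto intro!: real_sqrt_pow2 infsum_nonneg)

lemma hs_norm_sq: "(hs_norm)\<^sup>2 = (\<Sum>\<^sub>\<infinity>(i, j). (M i j)\<^sup>2)"
  unfolding hs_norm_def by (auto intro!: real_sqrt_pow2 infsum_nonneg)

lemma row_norm_square_summable: "(\<lambda>i. (row_norm i)\<^sup>2) summable_on UNIV"
  unfolding row_norm_sq using summable_on_Sigma_banach[of "\<lambda>i j. (M i j)\<^sup>2" UNIV "\<lambda>_. UNIV"] square_summable by simp

lemma infsum_row_norm: "(\<Sum>\<^sub>\<infinity>i. (row_norm i)\<^sup>2) = hs_norm\<^sup>2"
  unfolding row_norm_sq hs_norm_sq using infsum_Sigma'_banach[of "\<lambda>i j. (M i j)\<^sup>2" UNIV "\<lambda>_. UNIV"] square_summable by simp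

lemma col_norm_square_summable: "(\<lambda>i. (col_norm i)\<^sup>2) summable_on UNIV"
  unfolding col_norm_sq using summable_on_Sigma_banach[of "\<lambda>j i. (M i j)\<^sup>2" UNIV "\<lambda>_. UNIV"] square_summable_swap by simp

lemma trace_bound_summable: "(\<lambda>i. row_norm i * col_norm i) summable_on UNIV"
  by (intro cauchy_schwarz_summable_on row_norm_square_summable col_norm_square_summable norms_nonneg)

text \<open>Bounds the power with exponent k + 1. From the second power on Cauchy-Schwarz yields a
  rank one bound, row norm times column norm, which is the form that the minor estimate
  requires.\<close>

primrec pow_bound :: "nat \<Rightarrow> 'i \<Rightarrow> 'i \<Rightarrow> real" where
  "pow_bound 0 = M"
| "pow_bound (Suc k) = (\<lambda>i j. row_norm i * (hs_norm ^ k * col_norm j))"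

lemma pow_bound_nonneg: "pow_bound k i j \<ge> 0"
  by (cases k) (auto simp: nonneg norms_nonneg)

lemma pow_bound_col:
  "(\<lambda>i. (pow_bound k i j)\<^sup>2) summable_on UNIV"
  "sqrt (\<Sum>\<^sub>\<infinity>i. (pow_bound k i j)\<^sup>2) = hs_norm ^ k * col_norm j"
proof -
  show "(\<lambda>i. (pow_bound k i j)\<^sup>2) summable_on UNIV"
    by (cases k) (auto simp: col_summable power_mult_distrib intro!: summable_on_cmult_left row_norm_square_summable)
  show "sqrt (\<Sum>\<^sub>\<infinity>i. (pow_bound k i j)\<^sup>2) = hs_norm ^ k * col_norm j"
  proof (cases k)
    case 0
    then show ?thesis by (simp add: col_norm_def)
  next
    case (Suc l)
    have "(\<Sum>\<^sub>\<infinity>i. (pow_bound k i j)\<^sup>2) = (\<Sum>\<^sub>\<infinity>i. (row_norm i)\<^sup>2 * (hs_norm ^ l * col_norm j)\<^sup>2)"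
      by (simp add: Suc power_mult_distrib)
    also have "\<dots> = hs_norm\<^sup>2 * (hs_norm ^ l * col_norm j)\<^sup>2"
      by (subst infsum_cmult_left) (auto simp: infsum_row_norm row_norm_square_summable)
    also have "\<dots> = (hs_norm ^ k * col_norm j)\<^sup>2" by (simp add: Suc power_mult_distrib)
    finally show ?thesis using norms_nonneg by simp
  qed
qed

lemma row_pow_bound_summable: "(\<lambda>m. M i m * pow_bound k m j) summable_on UNIV"
  by (intro cauchy_schwarz_summable_on row_summable pow_bound_col nonneg pow_bound_nonneg)

lemma matrix_power_bound:
  assumes K: "\<And>i j. norm (K i j) \<le> M i j"
  shows "norm (matrix_power K (Suc k) i j) \<le> pow_bound k i j"
proof (induction k arbitrary: i j)
  case 0
  have "norm (matrix_power K (Suc 0) i j) \<le> M i j" unfolding matrix_power_1 by (rule K)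
  then show ?case by simp
next
  case (Suc k)
  have "norm (matrix_power K (Suc (Suc k)) i j) \<le> (\<Sum>\<^sub>\<infinity>m. M i m * pow_bound k m j)"
    unfolding matrix_power.simps(2)[of K "Suc k"]
  proof (rule norm_infsum_le_infsum[OF row_pow_bound_summable])
    show "norm (K i m * matrix_power K (Suc k) m j) \<le> M i m * pow_bound k m j" for m
      unfolding norm_mult by (intro mult_mono K Suc.IH nonneg) auto
  qed
  also have "\<dots> \<le> sqrt (\<Sum>\<^sub>\<infinity>m. (M i m)\<^sup>2) * sqrt (\<Sum>\<^sub>\<infinity>m. (pow_bound k m j)\<^sup>2)"
    by (intro cauchy_schwarz_infsum row_summable pow_bound_col nonneg pow_bound_nonneg)
  also have "\<dots> = pow_bound (Suc k) i j" by (simp add: pow_bound_col row_norm_def)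
  finally show ?case .
qed

lemma disc_algebra_matrix_power:
  assumes K: "\<And>z i j. norm z \<le> 1 \<Longrightarrow> norm (K z i j) \<le> M i j" and alg: "\<And>i j. disc_algebra (\<lambda>z. K z i j)"
  shows "disc_algebra (\<lambda>z. matrix_power (K z) (Suc k) i j)"
proof (induction k arbitrary: i j)
  case 0
  then show ?case unfolding matrix_power_1 by (rule alg)
next
  case (Suc k)
  show ?case unfolding matrix_power.simps(2)[of _ "Suc k"]
  proof (rule disc_algebra_infsum[OF _ _ row_pow_bound_summable])
    show "disc_algebra (\<lambda>z. K z i m * matrix_power (K z) (Suc k) m j)" for m
      by (intro disc_algebra_mult alg Suc.IH)
    show "norm (K z i m * matrix_power (K z) (Suc k) m j) \<le> M i m * pow_bound k m j" if "norm z \<le> 1" for m z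
      unfolding norm_mult using K[OF that] by (intro mult_mono matrix_power_bound nonneg) auto
  qed
qed

definition "reg_bound = 2 * exp hs_norm"

lemma reg_term_bound:
  assumes K: "\<And>i j. norm (K i j) \<le> M i j"
  shows "norm (reg_coeff (k + 2) * matrix_power K (k + 2) i j) \<le> 2 / fact k * hs_norm ^ k * (row_norm i * col_norm j)"
proof -
  have "norm (reg_coeff (k + 2) * matrix_power K (k + 2) i j) \<le> 2 / fact k * pow_bound (Suc k) i j"
    unfolding norm_mult using matrix_power_bound[OF K, of "Suc k" i j]
    by (intro mult_mono norm_reg_coeff_le) auto
  then show ?thesis by (simp add: mult_ac)
qed

lemma reg_bound_series:
  "((\<lambda>k. 2 / fact k * hs_norm ^ k * c) has_sum (reg_bound * c)) UNIV"
proof -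
  have "((\<lambda>k. hs_norm ^ k / fact k) has_sum exp hs_norm) UNIV"
    using exp_converges[of hs_norm] norms_nonneg
    by (intro norm_summable_imp_has_sum) (auto simp: sums_iff divide_inverse mult.commute intro: summable_norm_exp)
  then have "((\<lambda>k. (2 * c) * (hs_norm ^ k / fact k)) has_sum (2 * c) * exp hs_norm) UNIV"
    by (rule has_sum_cmult_right)
  then show ?thesis by (simp add: reg_bound_def mult_ac)
qed

lemma norm_reg_matrix_le:
  assumes K: "\<And>i j. norm (K i j) \<le> M i j"
  shows "norm (reg_matrix K i j) \<le> (reg_bound * row_norm i) * col_norm j"
proof -
  have s: "((\<lambda>k. 2 / fact k * hs_norm ^ k * (row_norm i * col_norm j)) has_sum (reg_bound * (row_norm i * col_norm j))) UNIV"
    by (rule reg_bound_series)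
  have "norm (reg_matrix K i j) \<le> (\<Sum>\<^sub>\<infinity>k. 2 / fact k * hs_norm ^ k * (row_norm i * col_norm j))"
    unfolding reg_matrix_def by (rule norm_infsum_le_infsum[OF has_sum_imp_summable[OF s] reg_term_bound[OF K]])
  also have "\<dots> = reg_bound * (row_norm i * col_norm j)" using s by (rule infsumI)
  finally show ?thesis by (simp add: mult_ac)
qed

lemma disc_algebra_reg_matrix:
  assumes K: "\<And>z i j. norm z \<le> 1 \<Longrightarrow> norm (K z i j) \<le> M i j" and alg: "\<And>i j. disc_algebra (\<lambda>z. K z i j)"
  shows "disc_algebra (\<lambda>z. reg_matrix (K z) i j)"
  unfolding reg_matrix_def
proof (rule disc_algebra_infsum[OF _ _ has_sum_imp_summable[OF reg_bound_series[of "row_norm i * col_norm j"]]])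
  show "disc_algebra (\<lambda>z. reg_coeff (k + 2) * matrix_power (K z) (k + 2) i j)" for k
    using disc_algebra_matrix_power[OF K alg, of "Suc k"] by (intro disc_algebra_mult disc_algebra_const) simp
qed (rule reg_term_bound[OF K])

definition "trace_bound = (\<Sum>\<^sub>\<infinity>i. reg_bound * row_norm i * col_norm i)"

lemma reg_bound_nonneg: "reg_bound \<ge> 0" by (simp add: reg_bound_def)

lemma sum_trace_bound_le: "finite F \<Longrightarrow> (\<Sum>i\<in>F. reg_bound * row_norm i * col_norm i) \<le> trace_bound"
  unfolding trace_bound_def
  using summable_on_cmult_right[OF trace_bound_summable, of reg_bound]
  by (intro finite_sum_le_infsum) (auto simp: mult.assoc reg_bound_nonneg norms_nonneg)

lemma norm_minor_le:
  assumes K: "\<And>i j. norm (K i j) \<le> M i j" and S: "finite S"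
  shows "norm (matrix_minor (reg_matrix K) S) \<le> sqrt (real (card S) ^ card S) * (\<Prod>i\<in>S. reg_bound * row_norm i * col_norm i)"
  unfolding matrix_minor_def
  by (rule norm_principal_minor_le[OF S norm_reg_matrix_le[OF K]]) (auto simp: reg_bound_nonneg norms_nonneg)

lemma minor_bound_summable:
  "(\<lambda>S. sqrt (real k ^ k) * (\<Prod>i\<in>S. reg_bound * row_norm i * col_norm i)) summable_on {S. finite S \<and> card S = k}"
  "(\<Sum>\<^sub>\<infinity>S | finite S \<and> card S = k. sqrt (real k ^ k) * (\<Prod>i\<in>S. reg_bound * row_norm i * col_norm i)) \<le> hadamard_series trace_bound k"
proof -
  define w where "w = (\<lambda>i. reg_bound * row_norm i * col_norm i)"
  have w: "w i \<ge> 0" for i by (auto simp: w_def reg_bound_nonneg norms_nonneg)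
  have le: "(\<Sum>S\<in>\<S>. sqrt (real k ^ k) * prod w S) \<le> hadamard_series trace_bound k" if "finite \<S>" "\<S> \<subseteq> {S. finite S \<and> card S = k}" for \<S>
  \<comment> \<open>The choice s = 2 sqrt k is positive only for k > 0. For k = 0 the empty set is
    the only index and the bound is 1.\<close>
  proof (cases "k = 0")
    case True
    have "\<S> \<subseteq> {{}}" using that True by auto
    then have "(\<Sum>S\<in>\<S>. sqrt (real k ^ k) * prod w S) \<le> (\<Sum>S\<in>{{}}. sqrt (real k ^ k) * prod w S)"
      using w by (intro sum_mono2) (auto simp: prod_nonneg)
    then show ?thesis using True by (simp add: hadamard_series_def)
  next
    case False
    have "(\<Sum>S\<in>\<S>. prod w S) \<le> exp (2 * sqrt k * trace_bound) / (2 * sqrt k) ^ k"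
      using that False w sum_trace_bound_le by (intro sum_prod_subsets_le) (auto simp: w_def)
    then show ?thesis unfolding hadamard_series_def sum_distrib_left[symmetric] by (intro mult_left_mono) auto
  qed
  show s: "(\<lambda>S. sqrt (real k ^ k) * (\<Prod>i\<in>S. reg_bound * row_norm i * col_norm i)) summable_on {S. finite S \<and> card S = k}"
    using le w unfolding w_def[symmetric]
    by (intro nonneg_bdd_above_summable_on bdd_aboveI2[where M = "hadamard_series trace_bound k"] mult_nonneg_nonneg prod_nonneg) auto
  show "(\<Sum>\<^sub>\<infinity>S | finite S \<and> card S = k. sqrt (real k ^ k) * (\<Prod>i\<in>S. reg_bound * row_norm i * col_norm i)) \<le> hadamard_series trace_bound k"
    by (rule infsum_le_finite_sums[OF s]) (use le in \<open>simp add: w_def\<close>)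
qed

text \<open>Membership in the disc algebra passes from entries to powers, to the regularized matrix,
  to minors, to the sums over sets of size k and to the sum over k; each infinite sum has a summable
  majorant independent of z.\<close>

theorem disc_algebra_matrix_det:
  assumes K: "\<And>z i j. norm z \<le> 1 \<Longrightarrow> norm (K z i j) \<le> M i j" and alg: "\<And>i j. disc_algebra (\<lambda>z. K z i j)"
  shows "disc_algebra (\<lambda>z. matrix_det (reg_matrix (K z)))"
proof -
  define e where "e = (\<lambda>k z. \<Sum>\<^sub>\<infinity>S | finite S \<and> card S = k. matrix_minor (reg_matrix (K z)) S)"
  have minor_le: "norm (matrix_minor (reg_matrix (K z)) S) \<le> sqrt (real k ^ k) * (\<Prod>i\<in>S. reg_bound * row_norm i * col_norm i)"
    if "norm z \<le> 1" "S \<in> {S. finite S \<and> card S = k}" for z S k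
    using norm_minor_le[OF K[OF that(1)], of S] that(2) by simp
  have e_alg: "disc_algebra (e k)" for k
    unfolding e_def
  proof (rule disc_algebra_infsum[OF _ _ minor_bound_summable(1)[of k]])
    show "disc_algebra (\<lambda>z. matrix_minor (reg_matrix (K z)) S)" for S
      unfolding matrix_minor_def
      by (intro disc_algebra_intros disc_algebra_reg_matrix[OF K alg])
  qed (rule minor_le)
  have e_le: "norm (e k z) \<le> hadamard_series trace_bound k" if "norm z \<le> 1" for k z
    unfolding e_def
    by (rule order.trans[OF norm_infsum_le_infsum[OF minor_bound_summable(1) minor_le[OF that]] minor_bound_summable(2)])
  have "trace_bound \<ge> 0" using sum_trace_bound_le[of "{}"] by simp
  then have s: "hadamard_series trace_bound summable_on UNIV"
    by (subst summable_on_UNIV_nonneg_real_iff) (auto simp: hadamard_series_def intro!: summable_hadamard_series)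
  have "disc_algebra (\<lambda>z. \<Sum>\<^sub>\<infinity>k. e k z)"
    by (rule disc_algebra_infsum[OF e_alg e_le s])
  moreover have "(\<Sum>\<^sub>\<infinity>k. e k z) = matrix_det (reg_matrix (K z))" if "norm z \<le> 1" for z
  proof -
    have "matrix_det (reg_matrix (K z)) = (\<Sum>k. e k z)" by (simp add: matrix_det_def e_def)
    then show ?thesis using suminf_eq_infsum(1)[OF s e_le[OF that]] by simp
  qed
  ultimately show ?thesis
    unfolding disc_algebra_def
    by (auto intro: holomorphic_transform continuous_on_eq)
qed

end

section \<open>Operators on absolutely summable sequences and their matrices\<close>

definition l1_le :: "('i \<Rightarrow> complex) \<Rightarrow> real \<Rightarrow> bool" where
  "l1_le f c \<longleftrightarrow> (\<forall>F. finite F \<longrightarrow> (\<Sum>n\<in>F. norm (f n)) \<le> c)"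

lemma l1_leD: "l1_le f c \<Longrightarrow> finite F \<Longrightarrow> (\<Sum>n\<in>F. norm (f n)) \<le> c"
  by (simp add: l1_le_def)

lemma l1_le_summable: "l1_le f c \<Longrightarrow> (\<lambda>n. norm (f n)) summable_on UNIV"
  unfolding l1_le_def by (intro nonneg_bdd_above_summable_on bdd_aboveI2[where M = c]) auto

lemma l1_le_infsum: "l1_le f c \<Longrightarrow> (\<Sum>\<^sub>\<infinity>n. norm (f n)) \<le> c"
  by (rule infsum_le_finite_sums[OF l1_le_summable]) (auto simp: l1_le_def)

lemma l1_le_norm: "l1_le f c \<Longrightarrow> norm (f n) \<le> c"
  unfolding l1_le_def by (drule spec[of _ "{n}"]) simp

lemma l1_le_square_summable:
  assumes "l1_le f c"
  shows "(\<lambda>n. (norm (f n))\<^sup>2) summable_on UNIV"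
proof (rule summable_on_comparison_test)
  show "(\<lambda>n. c * norm (f n)) summable_on UNIV"
    by (rule summable_on_cmult_right[OF l1_le_summable[OF assms]])
  show "(norm (f n))\<^sup>2 \<le> c * norm (f n)" for n
    using l1_le_norm[OF assms, of n] by (simp add: power2_eq_square mult_right_mono)
qed auto

lemma lspace_2_iff: "f \<in> lspace 2 \<longleftrightarrow> (\<lambda>n. (norm (f n))\<^sup>2) summable_on UNIV"
  by (simp add: lspace_def powr_numeral)

text \<open>\<open>inv_into\<close> picks the only l2 preimage once injectivity is known. That the
  convolution lies in l2 is Young's inequality for an l2 kernel and an l1 sequence; that it solves
  the equation is the stencil identity.\<close>

lemma free_resolvent_eq:
  fixes G f :: "int ^ 'd::finite \<Rightarrow> complex"
  assumes G: "is_resolvent_kernel l G" and f: "l1_le f c"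
  shows "free_resolvent l f = (\<lambda>n. \<Sum>\<^sub>\<infinity>m. G (n - m) * f m)"
  unfolding free_resolvent_def
proof (rule inv_into_f_eq)
  have f2: "(\<lambda>n. (norm (f n))\<^sup>2) summable_on UNIV" by (rule l1_le_square_summable[OF f])
  have G2: "(\<lambda>n. (norm (G n))\<^sup>2) summable_on UNIV" using G by (simp add: is_resolvent_kernel_def)
  define R where "R = (\<lambda>n. \<Sum>\<^sub>\<infinity>m. G (n - m) * f m)"
  have R: "((\<lambda>m. G (n - m) * f m) has_sum R n) UNIV" for n
    unfolding R_def by (rule has_sum_kernel[OF G f2])
  show "inj_on (\<lambda>f n. laplacian f n - l * f n) (lspace 2 :: (int ^ 'd \<Rightarrow> complex) set)"
  proof (rule inj_onI)
    fix f g :: "int ^ 'd \<Rightarrow> complex"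
    assume "f \<in> lspace 2" "g \<in> lspace 2" and eq: "(\<lambda>n. laplacian f n - l * f n) = (\<lambda>n. laplacian g n - l * g n)"
    then show "f = g"
      using fun_cong[OF eq] by (intro resolvent_equation_unique[OF G]) (simp_all add: lspace_2_iff)
  qed
  define \<Gamma> where "\<Gamma> = (\<Sum>\<^sub>\<infinity>n. (norm (G n))\<^sup>2)"
  have c0: "c \<ge> 0" using l1_leD[OF f, of "{}"] by simp
  have \<Gamma>0: "\<Gamma> \<ge> 0" by (simp add: \<Gamma>_def infsum_nonneg)
  have fs: "(\<lambda>m. norm (f m)) summable_on UNIV" by (rule l1_le_summable[OF f])
  have Gf: "(\<lambda>m. (norm (G (n - m)))\<^sup>2 * norm (f m)) summable_on UNIV" for n
  proof (rule summable_on_comparison_test)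
    show "(\<lambda>m. (norm (G (n - m)))\<^sup>2 * c) summable_on UNIV"
      by (intro summable_on_cmult_left square_summable_reflect G2)
  qed (auto intro!: mult_left_mono l1_le_norm[OF f])
  \<comment> \<open>Cauchy-Schwarz after splitting |f| into sqrt |f| times sqrt |f|.\<close>
  have R_le: "(norm (R n))\<^sup>2 \<le> c * (\<Sum>\<^sub>\<infinity>m. (norm (G (n - m)))\<^sup>2 * norm (f m))" for n
  proof -
    have "norm (R n) \<le> (\<Sum>\<^sub>\<infinity>m. (norm (G (n - m)) * sqrt (norm (f m))) * sqrt (norm (f m)))"
      unfolding R_def
    proof (rule norm_infsum_le_infsum)
      show "(\<lambda>m. (norm (G (n - m)) * sqrt (norm (f m))) * sqrt (norm (f m))) summable_on UNIV"
        using Gf[of n] fs by (intro cauchy_schwarz_summable_on) (auto simp: power_mult_distrib)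
    qed (simp add: norm_mult mult.assoc)
    also have "\<dots> \<le> sqrt (\<Sum>\<^sub>\<infinity>m. (norm (G (n - m)) * sqrt (norm (f m)))\<^sup>2) * sqrt (\<Sum>\<^sub>\<infinity>m. (sqrt (norm (f m)))\<^sup>2)"
      using Gf[of n] fs by (intro cauchy_schwarz_infsum) (auto simp: power_mult_distrib)
    finally have "(norm (R n))\<^sup>2 \<le> (sqrt (\<Sum>\<^sub>\<infinity>m. (norm (G (n - m)))\<^sup>2 * norm (f m)) * sqrt (\<Sum>\<^sub>\<infinity>m. norm (f m)))\<^sup>2"
      by (intro power_mono) (auto simp: power_mult_distrib)
    also have "\<dots> = (\<Sum>\<^sub>\<infinity>m. norm (f m)) * (\<Sum>\<^sub>\<infinity>m. (norm (G (n - m)))\<^sup>2 * norm (f m))"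
      by (simp add: power_mult_distrib infsum_nonneg mult.commute)
    also have "\<dots> \<le> c * (\<Sum>\<^sub>\<infinity>m. (norm (G (n - m)))\<^sup>2 * norm (f m))"
      by (intro mult_right_mono l1_le_infsum[OF f] infsum_nonneg) auto
    finally show ?thesis .
  qed
  have R_sum: "(\<Sum>n\<in>F. (norm (R n))\<^sup>2) \<le> c * (\<Gamma> * c)" if F: "finite F" for F
  proof -
    have Gsum: "(\<Sum>n\<in>F. (norm (G (n - m)))\<^sup>2) \<le> \<Gamma>" for m
    proof -
      have "(\<Sum>n\<in>F. (norm (G (n - m)))\<^sup>2) = (\<Sum>n\<in>(\<lambda>n. n - m) ` F. (norm (G n))\<^sup>2)"
        by (simp add: sum.reindex inj_on_def)
      also have "\<dots> \<le> \<Gamma>" unfolding \<Gamma>_def using F by (intro finite_sum_le_infsum G2) auto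
      finally show ?thesis .
    qed
    have "(\<Sum>n\<in>F. (norm (R n))\<^sup>2) \<le> (\<Sum>n\<in>F. c * (\<Sum>\<^sub>\<infinity>m. (norm (G (n - m)))\<^sup>2 * norm (f m)))"
      by (rule sum_mono[OF R_le])
    also have "\<dots> = c * (\<Sum>n\<in>F. \<Sum>\<^sub>\<infinity>m. (norm (G (n - m)))\<^sup>2 * norm (f m))" by (simp add: sum_distrib_left)
    also have "(\<Sum>n\<in>F. \<Sum>\<^sub>\<infinity>m. (norm (G (n - m)))\<^sup>2 * norm (f m)) \<le> (\<Sum>\<^sub>\<infinity>m. \<Gamma> * norm (f m))"
    proof (rule has_sum_mono)
      show "((\<lambda>m. \<Sum>n\<in>F. (norm (G (n - m)))\<^sup>2 * norm (f m)) has_sum (\<Sum>n\<in>F. \<Sum>\<^sub>\<infinity>m. (norm (G (n - m)))\<^sup>2 * norm (f m))) UNIV"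
        by (intro has_sum_finite_sum F has_sum_infsum Gf)
      show "((\<lambda>m. \<Gamma> * norm (f m)) has_sum (\<Sum>\<^sub>\<infinity>m. \<Gamma> * norm (f m))) UNIV"
        by (intro has_sum_infsum summable_on_cmult_right fs)
    qed (simp add: sum_distrib_right[symmetric] mult_right_mono[OF Gsum])
    also have "(\<Sum>\<^sub>\<infinity>m. \<Gamma> * norm (f m)) \<le> \<Gamma> * c"
      by (subst infsum_cmult_right) (auto simp: fs intro!: mult_left_mono l1_le_infsum[OF f] \<Gamma>0)
    finally show ?thesis using c0 by (simp add: mult_left_mono)
  qed
  show "(\<lambda>n. \<Sum>\<^sub>\<infinity>m. G (n - m) * f m) \<in> lspace 2"
    unfolding lspace_2_iff R_def[symmetric] using R_sum
    by (intro nonneg_bdd_above_summable_on bdd_aboveI2[where M = "c * (\<Gamma> * c)"]) auto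
  show "(\<lambda>n. laplacian (\<lambda>n. \<Sum>\<^sub>\<infinity>m. G (n - m) * f m) n - l * (\<Sum>\<^sub>\<infinity>m. G (n - m) * f m)) = f"
  proof
    fix n :: "int ^ 'd"
    have "1 / 2 * (\<Sum>i\<in>UNIV. R (n + (- axis i 1)) + R (n + axis i 1)) + (- l) * R (n + 0) = f n"
      by (rule resolvent_kernel_stencil[OF G R])
    then have "laplacian R n - l * R n = f n" by (simp add: laplacian_eq)
    then show "laplacian (\<lambda>n. \<Sum>\<^sub>\<infinity>m. G (n - m) * f m) n - l * (\<Sum>\<^sub>\<infinity>m. G (n - m) * f m) = f n"
      by (simp add: R_def)
  qed
qed

text \<open>Uniformly summable columns mean that A acts boundedly on l1, so powers and exponential
  exist entrywise. The columns of \<open>V R_0\<close> are products of two square summable sequences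
  and hence of this kind.\<close>

locale column_bounded =
  fixes A :: "'i \<Rightarrow> 'i \<Rightarrow> complex" and \<alpha> :: real
  assumes col: "l1_le (\<lambda>i. A i m) \<alpha>"
begin

lemma alpha_nonneg: "\<alpha> \<ge> 0"
  using l1_leD[OF col, of "{}"] by simp

lemma entry_le: "norm (A i m) \<le> \<alpha>"
  using l1_le_norm[OF col] .

lemma apply_summable: "l1_le f c \<Longrightarrow> (\<lambda>m. norm (A i m * f m)) summable_on UNIV"
  by (rule Infinite_Sum.abs_summable_on_comparison_test'[OF summable_on_cmult_right[OF l1_le_summable, of f c \<alpha>]])
    (auto simp: norm_mult intro!: mult_right_mono entry_le)

lemma l1_le_apply:
  assumes f: "l1_le f c"
  shows "l1_le (\<lambda>i. \<Sum>\<^sub>\<infinity>m. A i m * f m) (\<alpha> * c)"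
  unfolding l1_le_def
proof (intro allI impI)
  fix F :: "'i set" assume F: "finite F"
  have "(\<Sum>i\<in>F. norm (\<Sum>\<^sub>\<infinity>m. A i m * f m)) \<le> (\<Sum>i\<in>F. \<Sum>\<^sub>\<infinity>m. norm (A i m * f m))"
    by (intro sum_mono norm_infsum_bound apply_summable[OF f])
  also have "\<dots> \<le> (\<Sum>\<^sub>\<infinity>m. \<alpha> * norm (f m))"
  proof (rule has_sum_mono)
    show "((\<lambda>m. \<Sum>i\<in>F. norm (A i m * f m)) has_sum (\<Sum>i\<in>F. \<Sum>\<^sub>\<infinity>m. norm (A i m * f m))) UNIV"
      by (intro has_sum_finite_sum F has_sum_infsum apply_summable[OF f])
    show "((\<lambda>m. \<alpha> * norm (f m)) has_sum (\<Sum>\<^sub>\<infinity>m. \<alpha> * norm (f m))) UNIV"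
      by (intro has_sum_infsum summable_on_cmult_right l1_le_summable[OF f])
    show "(\<Sum>i\<in>F. norm (A i m * f m)) \<le> \<alpha> * norm (f m)" for m
      unfolding norm_mult sum_distrib_right[symmetric] by (intro mult_right_mono l1_leD[OF col F]) auto
  qed
  also have "\<dots> = \<alpha> * (\<Sum>\<^sub>\<infinity>m. norm (f m))" by (rule infsum_cmult_right) (simp add: l1_le_summable[OF f])
  also have "\<dots> \<le> \<alpha> * c" by (intro mult_left_mono l1_le_infsum[OF f] alpha_nonneg)
  finally show "(\<Sum>i\<in>F. norm (\<Sum>\<^sub>\<infinity>m. A i m * f m)) \<le> \<alpha> * c" .
qed

lemma l1_le_matrix_power: "l1_le (\<lambda>i. matrix_power A k i j) (\<alpha> ^ k)"
proof (induction k)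
  case 0
  show ?case unfolding l1_le_def by (auto simp: if_distrib cong: if_cong)
next
  case (Suc k)
  then show ?case using l1_le_apply[OF Suc] by simp
qed

definition "exp_matrix i j = (\<Sum>k. (- 1) ^ k / fact k * matrix_power A k i j)"

lemma exp_term_norm: "norm ((- 1) ^ k / fact k * matrix_power A k i j) = norm (matrix_power A k i j) / fact k"
  by (simp add: norm_mult norm_divide norm_power norm_fact)

lemma exp_alpha_sums: "(\<lambda>k. \<alpha> ^ k / fact k) sums exp \<alpha>"
  using exp_converges[of \<alpha>] by (simp add: divide_inverse mult.commute)

lemma exp_partial_le: "finite F2 \<Longrightarrow> (\<Sum>k\<in>F2. \<alpha> ^ k / fact k) \<le> exp \<alpha>"
  using sum_le_suminf[of "\<lambda>k. \<alpha> ^ k / fact k" F2] exp_alpha_sums alpha_nonneg by (auto simp: sums_iff)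

lemma exp_double_le:
  assumes "finite F1" "finite F2"
  shows "(\<Sum>m\<in>F1. \<Sum>k\<in>F2. norm ((- 1) ^ k / fact k * matrix_power A k m j)) \<le> exp \<alpha>"
proof -
  have "(\<Sum>m\<in>F1. \<Sum>k\<in>F2. norm ((- 1) ^ k / fact k * matrix_power A k m j))
      = (\<Sum>k\<in>F2. (\<Sum>m\<in>F1. norm (matrix_power A k m j)) / fact k)"
    unfolding exp_term_norm sum_divide_distrib by (rule sum.swap)
  also have "\<dots> \<le> (\<Sum>k\<in>F2. \<alpha> ^ k / fact k)"
    by (intro sum_mono divide_right_mono l1_leD[OF l1_le_matrix_power] assms) auto
  also have "\<dots> \<le> exp \<alpha>" by (rule exp_partial_le[OF assms(2)])
  finally show ?thesis .
qed

lemma exp_summable: "summable (\<lambda>k. norm ((- 1) ^ k / fact k * matrix_power A k i j))"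
proof (rule summable_comparison_test')
  show "summable (\<lambda>k. \<alpha> ^ k / fact k)" using exp_alpha_sums by (simp add: sums_iff)
  show "norm (norm ((- 1) ^ k / fact k * matrix_power A k i j)) \<le> \<alpha> ^ k / fact k" if "k \<ge> 0" for k
    unfolding exp_term_norm using l1_le_norm[OF l1_le_matrix_power, of k i j] by (simp add: divide_right_mono)
qed

lemma exp_matrix_infsum: "exp_matrix i j = (\<Sum>\<^sub>\<infinity>k. (- 1) ^ k / fact k * matrix_power A k i j)"
  unfolding exp_matrix_def
proof (rule suminf_eq_infsum(1))
  show "(\<lambda>k. norm ((- 1) ^ k / fact k * matrix_power A k i j)) summable_on UNIV"
    by (rule summable_on_UNIV_nonneg_real_iff[THEN iffD2, OF _ exp_summable]) (rule norm_ge_zero)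
qed (rule order.refl)

lemma l1_le_exp_matrix: "l1_le (\<lambda>i. exp_matrix i j) (exp \<alpha>)"
  unfolding l1_le_def
proof (intro allI impI)
  fix F :: "'i set" assume F: "finite F"
  have "(\<Sum>i\<in>F. norm (exp_matrix i j)) \<le> (\<Sum>i\<in>F. \<Sum>k. norm ((- 1) ^ k / fact k * matrix_power A k i j))"
    unfolding exp_matrix_def by (intro sum_mono summable_norm exp_summable)
  also have "\<dots> = (\<Sum>k. \<Sum>i\<in>F. norm ((- 1) ^ k / fact k * matrix_power A k i j))"
    by (rule suminf_sum[OF exp_summable, symmetric])
  also have "\<dots> \<le> exp \<alpha>"
  proof (rule suminf_le_const)
    show "summable (\<lambda>k. \<Sum>i\<in>F. norm ((- 1) ^ k / fact k * matrix_power A k i j))"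
      by (intro summable_sum exp_summable)
    show "(\<Sum>k<J. \<Sum>i\<in>F. norm ((- 1) ^ k / fact k * matrix_power A k i j)) \<le> exp \<alpha>" for J
      using exp_double_le[OF F, of "{..<J}" j] sum.swap[of "\<lambda>k i. norm ((- 1) ^ k / fact k * matrix_power A k i j)" F "{..<J}"] by simp
  qed
  finally show "(\<Sum>i\<in>F. norm (exp_matrix i j)) \<le> exp \<alpha>" .
qed

text \<open>Fubini for the double family over the summation index m and the exponent k, whose
  absolute sums stay below \<open>alpha * exp alpha\<close>.\<close>

lemma apply_exp_matrix:
  "(\<Sum>\<^sub>\<infinity>m. A i m * exp_matrix m j) = (\<Sum>k. (- 1) ^ k / fact k * matrix_power A (Suc k) i j)"
  "summable (\<lambda>k. (- 1) ^ k / fact k * matrix_power A (Suc k) i j)"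
proof -
  define t where "t = (\<lambda>m k. A i m * ((- 1) ^ k / fact k * matrix_power A k m j))"
  have double: "(\<lambda>(m, k). norm (t m k)) summable_on UNIV \<times> UNIV"
  proof (rule nonneg_bdd_above_summable_on)
    show "bdd_above (sum (\<lambda>(m, k). norm (t m k)) ` {F. F \<subseteq> UNIV \<times> UNIV \<and> finite F})"
    proof (rule bdd_aboveI2)
      fix F :: "('i \<times> nat) set" assume "F \<in> {F. F \<subseteq> UNIV \<times> UNIV \<and> finite F}"
      then have F: "finite F" by simp
      have "sum (\<lambda>(m, k). norm (t m k)) F \<le> sum (\<lambda>(m, k). norm (t m k)) (fst ` F \<times> snd ` F)"
        using F by (intro sum_mono2 subset_fst_snd) auto
      also have "\<dots> = (\<Sum>m\<in>fst ` F. \<Sum>k\<in>snd ` F. norm (t m k))" by (simp add: sum.cartesian_product)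
      also have "\<dots> \<le> (\<Sum>m\<in>fst ` F. \<Sum>k\<in>snd ` F. \<alpha> * norm ((- 1) ^ k / fact k * matrix_power A k m j))"
        unfolding t_def norm_mult[of "A i _"] by (intro sum_mono mult_right_mono entry_le) auto
      also have "\<dots> = \<alpha> * (\<Sum>m\<in>fst ` F. \<Sum>k\<in>snd ` F. norm ((- 1) ^ k / fact k * matrix_power A k m j))"
        by (simp only: sum_distrib_left)
      also have "\<dots> \<le> \<alpha> * exp \<alpha>" using F by (intro mult_left_mono exp_double_le alpha_nonneg) auto
      finally show "sum (\<lambda>(m, k). norm (t m k)) F \<le> \<alpha> * exp \<alpha>" .
    qed
  qed auto
  have n: "(\<lambda>x. norm ((\<lambda>(m, k). t m k) x)) = (\<lambda>(m, k). norm (t m k))" by (auto simp: fun_eq_iff)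
  have s: "(\<lambda>(m, k). t m k) summable_on UNIV \<times> UNIV"
    by (rule Infinite_Sum.abs_summable_summable) (use double in \<open>simp add: n\<close>)
  have "(\<Sum>\<^sub>\<infinity>m. A i m * exp_matrix m j) = (\<Sum>\<^sub>\<infinity>m. \<Sum>\<^sub>\<infinity>k. t m k)"
    unfolding exp_matrix_infsum t_def by (intro infsum_cong infsum_cmult_right'[symmetric])
  also have "\<dots> = (\<Sum>\<^sub>\<infinity>k. \<Sum>\<^sub>\<infinity>m. t m k)" by (rule infsum_swap_banach[OF s])
  also have "\<dots> = (\<Sum>\<^sub>\<infinity>k. (- 1) ^ k / fact k * matrix_power A (Suc k) i j)"
  proof (intro infsum_cong)
    fix k
    have "(\<Sum>\<^sub>\<infinity>m. t m k) = (\<Sum>\<^sub>\<infinity>m. (- 1) ^ k / fact k * (A i m * matrix_power A k m j))"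
      by (intro infsum_cong) (simp add: t_def)
    also have "\<dots> = (- 1) ^ k / fact k * matrix_power A (Suc k) i j"
      unfolding matrix_power.simps(2) by (rule infsum_cmult_right')
    finally show "(\<Sum>\<^sub>\<infinity>m. t m k) = (- 1) ^ k / fact k * matrix_power A (Suc k) i j" .
  qed
  finally have 1: "(\<Sum>\<^sub>\<infinity>m. A i m * exp_matrix m j) = (\<Sum>\<^sub>\<infinity>k. (- 1) ^ k / fact k * matrix_power A (Suc k) i j)" .
  have le: "norm ((- 1) ^ k / fact k * matrix_power A (Suc k) i j) \<le> \<alpha> * (\<alpha> ^ k / fact k)" for k
  proof -
    have "norm ((- 1) ^ k / fact k * matrix_power A (Suc k) i j) = norm (matrix_power A (Suc k) i j) / fact k"
      by (simp add: norm_mult norm_divide norm_power norm_fact del: matrix_power.simps)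
    also have "\<dots> \<le> \<alpha> ^ Suc k / fact k" by (intro divide_right_mono l1_le_norm[OF l1_le_matrix_power]) auto
    finally show ?thesis by simp
  qed
  have b: "(\<lambda>k. \<alpha> * (\<alpha> ^ k / fact k)) summable_on UNIV"
    by (rule summable_on_UNIV_nonneg_real_iff[THEN iffD2, OF _ summable_mult[OF sums_summable[OF exp_alpha_sums]]])
      (simp add: alpha_nonneg)
  show "(\<Sum>\<^sub>\<infinity>m. A i m * exp_matrix m j) = (\<Sum>k. (- 1) ^ k / fact k * matrix_power A (Suc k) i j)"
    "summable (\<lambda>k. (- 1) ^ k / fact k * matrix_power A (Suc k) i j)"
    using suminf_eq_infsum(1,2)[OF b le] 1 by simp_all
qed

text \<open>The zeroth power cancels against the identity, and the first power in exp (- A) against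
  the leading term of A exp (- A). The rest pairs coefficient k + 2 of one series with k + 1 of the
  other, which is \<open>reg_coeff\<close>.\<close>

lemma regularized_entry:
  "exp_matrix i j + (\<Sum>\<^sub>\<infinity>m. A i m * exp_matrix m j) - (if i = j then 1 else 0) = reg_matrix A i j"
proof -
  define a where "a = (\<lambda>k. (- 1) ^ k / fact k :: complex)"
  define P where "P = (\<lambda>k. matrix_power A k i j)"
  have s1: "summable (\<lambda>k. a k * P k)" unfolding a_def P_def by (rule summable_norm_cancel[OF exp_summable])
  have s2: "summable (\<lambda>k. a k * P (Suc k))" unfolding a_def P_def by (rule apply_exp_matrix(2))
  have "exp_matrix i j = (\<Sum>k. a k * P k)" by (simp add: exp_matrix_def a_def P_def)
  also have "\<dots> = (\<Sum>k. a (k + 2) * P (k + 2)) + (\<Sum>k<2. a k * P k)" by (rule suminf_split_initial_segment[OF s1])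
  finally have e1: "exp_matrix i j = (\<Sum>k. a (k + 2) * P (k + 2)) + (P 0 - P 1)"
    by (simp add: numeral_2_eq_2 a_def)
  have "(\<Sum>\<^sub>\<infinity>m. A i m * exp_matrix m j) = (\<Sum>k. a k * P (Suc k))"
    unfolding apply_exp_matrix(1) a_def P_def ..
  also have "\<dots> = (\<Sum>k. a (k + 1) * P (Suc (k + 1))) + (\<Sum>k<1. a k * P (Suc k))" by (rule suminf_split_initial_segment[OF s2])
  finally have e2: "(\<Sum>\<^sub>\<infinity>m. A i m * exp_matrix m j) = (\<Sum>k. a (k + 1) * P (k + 2)) + P 1"
    by (simp add: a_def)
  have sm: "summable (\<lambda>k. a (k + 2) * P (k + 2))" "summable (\<lambda>k. a (k + 1) * P (k + 2))"
    using summable_ignore_initial_segment[OF s1, of 2] summable_ignore_initial_segment[OF s2, of 1] by simp_all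
  have rc: "reg_coeff (k + 2) = a (k + 2) + a (k + 1)" for k by (simp add: reg_coeff_def a_def)
  have "exp_matrix i j + (\<Sum>\<^sub>\<infinity>m. A i m * exp_matrix m j) - P 0 = (\<Sum>k. a (k + 2) * P (k + 2)) + (\<Sum>k. a (k + 1) * P (k + 2))"
    unfolding e1 e2 by simp
  also have "\<dots> = (\<Sum>k. reg_coeff (k + 2) * P (k + 2))"
    unfolding suminf_add[OF sm] rc distrib_right ..
  also have "\<dots> = reg_matrix A i j"
    unfolding reg_matrix_def P_def
  proof (rule suminf_eq_infsum(1)[of "\<lambda>k. 2 * \<alpha>\<^sup>2 * (\<alpha> ^ k / fact k)"])
    show "(\<lambda>k. 2 * \<alpha>\<^sup>2 * (\<alpha> ^ k / fact k)) summable_on UNIV"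
      by (rule summable_on_UNIV_nonneg_real_iff[THEN iffD2, OF _ summable_mult[OF sums_summable[OF exp_alpha_sums]]])
        (simp add: alpha_nonneg)
    show "norm (reg_coeff (k + 2) * matrix_power A (k + 2) i j) \<le> 2 * \<alpha>\<^sup>2 * (\<alpha> ^ k / fact k)" for k
    proof -
      have "norm (reg_coeff (k + 2) * matrix_power A (k + 2) i j) \<le> 2 / fact k * \<alpha> ^ (k + 2)"
        unfolding norm_mult by (intro mult_mono norm_reg_coeff_le l1_le_norm[OF l1_le_matrix_power]) auto
      then show ?thesis by (simp add: power_add power2_eq_square mult_ac del: matrix_power.simps)
    qed
  qed
  finally show ?thesis by (simp add: P_def)
qed

end

text \<open>The definition evaluates the operator only at unit vectors and vectors obtained from
  them. All of these are absolutely summable, so it suffices that \<open>op\<close> is given by A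
  there.\<close>

lemma regularized_det_eq:
  fixes op :: "'i oper"
  assumes A: "column_bounded A \<alpha>" and op: "\<And>f c. l1_le f c \<Longrightarrow> op f = (\<lambda>i. \<Sum>\<^sub>\<infinity>m. A i m * f m)"
  shows "regularized_det op = matrix_det (reg_matrix A)"
proof -
  interpret column_bounded A \<alpha> by (rule A)
  have iter: "((\<lambda>f i. - op f i) ^^ k) (unit_fun j) = (\<lambda>i. (- 1) ^ k * matrix_power A k i j)" for k j
  proof (induction k)
    case 0
    then show ?case by (auto simp: unit_fun_def)
  next
    case (Suc k)
    have l1: "l1_le (\<lambda>i. (- 1) ^ k * matrix_power A k i j) (\<alpha> ^ k)"
      using l1_le_matrix_power[of k j] by (simp add: l1_le_def norm_mult norm_power)
    have "(\<Sum>\<^sub>\<infinity>m. A i m * ((- 1) ^ k * matrix_power A k m j)) = (- 1) ^ k * matrix_power A (Suc k) i j" for i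
    proof -
      have "(\<Sum>\<^sub>\<infinity>m. A i m * ((- 1) ^ k * matrix_power A k m j)) = (\<Sum>\<^sub>\<infinity>m. (- 1) ^ k * (A i m * matrix_power A k m j))"
        by (intro infsum_cong) simp
      then show ?thesis unfolding matrix_power.simps(2) by (simp only: infsum_cmult_right')
    qed
    then show ?case by (simp add: Suc op[OF l1] del: matrix_power.simps)
  qed
  have ex: "oper_exp (\<lambda>f i. - op f i) (unit_fun j) = (\<lambda>i. exp_matrix i j)" for j
    by (simp add: oper_exp_def iter exp_matrix_def)
  have entry: "matrix_entry (\<lambda>f i. ((\<lambda>f i. f i + op f i) \<circ> oper_exp (\<lambda>f i. - op f i)) f i - f i) i j = reg_matrix A i j" for i j
    unfolding regularized_entry[symmetric]
    by (simp add: matrix_entry_def ex op[OF l1_le_exp_matrix]) (simp add: unit_fun_def)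
  show ?thesis
    unfolding regularized_det_def fredholm_det_def trace_ext_power_def principal_minor_def entry matrix_det_def matrix_minor_def ..
qed

text \<open>T is the conjugate of T' by the diagonal matrix u, written without division because u
  may have zeros; a row with \<open>u i = 0\<close> vanishes in both matrices. Along a permutation
  the factors \<open>u i\<close> cancel.\<close>

lemma matrix_minor_similar:
  assumes u: "\<And>i j. T i j * u j = u i * T' i j"
    and zero: "\<And>i j. u i = 0 \<Longrightarrow> T i j = 0 \<and> T' i j = 0" and S: "finite S"
  shows "matrix_minor T S = matrix_minor T' S"
proof (cases "\<exists>i\<in>S. u i = 0")
  case True
  then obtain i where i: "i \<in> S" "u i = 0" by blast
  have "(\<Prod>i\<in>S. T i (\<pi> i)) = 0" "(\<Prod>i\<in>S. T' i (\<pi> i)) = 0" for \<pi>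
    by (rule prod_zero[OF S], rule bexI[OF _ i(1)], simp add: zero[OF i(2)])+
  then show ?thesis by (simp add: matrix_minor_def)
next
  case False
  show ?thesis unfolding matrix_minor_def
  proof (intro sum.cong refl arg_cong2[where f = "(*)"])
    fix \<pi> assume "\<pi> \<in> {\<pi>. \<pi> permutes S}"
    then have \<pi>: "\<pi> permutes S" by simp
    have "(\<Prod>i\<in>S. T i (\<pi> i)) * (\<Prod>i\<in>S. u (\<pi> i)) = (\<Prod>i\<in>S. u i) * (\<Prod>i\<in>S. T' i (\<pi> i))"
      unfolding prod.distrib[symmetric] by (simp only: u)
    moreover have "(\<Prod>i\<in>S. u (\<pi> i)) = (\<Prod>i\<in>S. u i)"
      by (rule prod.permute[OF \<pi>, unfolded o_def, symmetric])
    moreover have "(\<Prod>i\<in>S. u i) \<noteq> 0" using False S by simp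
    ultimately show "(\<Prod>i\<in>S. T i (\<pi> i)) = (\<Prod>i\<in>S. T' i (\<pi> i))" by simp
  qed
qed

text \<open>The intertwining relation is inherited by all powers, hence by the regularized matrices
  and their minors.\<close>

lemma matrix_det_similar:
  assumes A: "\<And>i j. A i j * u j = u i * K i j" and zero: "\<And>i j. u i = 0 \<Longrightarrow> A i j = 0 \<and> K i j = 0"
  shows "matrix_det (reg_matrix A) = matrix_det (reg_matrix K)"
proof -
  have P: "matrix_power A k i j * u j = u i * matrix_power K k i j" for k i j
  proof (induction k arbitrary: i)
    case 0
    then show ?case by simp
  next
    case (Suc k)
    have "matrix_power A (Suc k) i j * u j = (\<Sum>\<^sub>\<infinity>m. A i m * matrix_power A k m j * u j)"
      by (simp add: infsum_cmult_left')
    also have "\<dots> = (\<Sum>\<^sub>\<infinity>m. u i * (K i m * matrix_power K k m j))"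
    proof (intro infsum_cong)
      fix m
      have "A i m * matrix_power A k m j * u j = A i m * u m * matrix_power K k m j" by (simp add: Suc mult.assoc)
      then show "A i m * matrix_power A k m j * u j = u i * (K i m * matrix_power K k m j)" by (simp add: A mult.assoc)
    qed
    also have "\<dots> = u i * matrix_power K (Suc k) i j" by (simp add: infsum_cmult_right')
    finally show ?case .
  qed
  have "reg_matrix A i j * u j = u i * reg_matrix K i j" for i j
  proof -
    have "reg_matrix A i j * u j = (\<Sum>\<^sub>\<infinity>k. reg_coeff (k + 2) * (matrix_power A (k + 2) i j * u j))"
      unfolding reg_matrix_def mult.assoc[symmetric] by (rule infsum_cmult_left'[symmetric])
    also have "\<dots> = (\<Sum>\<^sub>\<infinity>k. u i * (reg_coeff (k + 2) * matrix_power K (k + 2) i j))"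
      unfolding P by (intro infsum_cong) (simp only: mult_ac)
    also have "\<dots> = u i * reg_matrix K i j" unfolding reg_matrix_def by (rule infsum_cmult_right')
    finally show ?thesis .
  qed
  moreover have "reg_matrix B i j = 0" if "\<And>m. B i m = 0" for B :: "'a \<Rightarrow> 'a \<Rightarrow> complex" and i j
    unfolding reg_matrix_def using that by simp
  ultimately have "matrix_minor (reg_matrix A) S = matrix_minor (reg_matrix K) S" if "finite S" for S
    using zero that by (intro matrix_minor_similar[of _ u]) auto
  then show ?thesis unfolding matrix_det_def by (intro suminf_cong infsum_cong) auto
qed

text \<open>The Birman-Schwinger step: with V = u v, the matrix of \<open>V R_0\<close> is the
  conjugate by u of that of \<open>v R_0 u\<close>, which distributes V evenly over both sides of
  the kernel.\<close>

theorem schroedinger_det_eq: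
  fixes V u v G :: "int ^ 'd::finite \<Rightarrow> complex"
  assumes G: "is_resolvent_kernel l G" and V: "(\<lambda>n. (norm (V n))\<^sup>2) summable_on UNIV"
    and uv: "\<And>n. V n = u n * v n" "\<And>n. u n = 0 \<Longrightarrow> v n = 0"
  shows "schroedinger_det V l = matrix_det (reg_matrix (\<lambda>i j. v i * G (i - j) * u j))"
proof -
  define A where "A = (\<lambda>i j. V i * G (i - j))"
  have G2: "(\<lambda>n. (norm (G n))\<^sup>2) summable_on UNIV" using G by (simp add: is_resolvent_kernel_def)
  define \<alpha> where "\<alpha> = sqrt (\<Sum>\<^sub>\<infinity>n. (norm (V n))\<^sup>2) * sqrt (\<Sum>\<^sub>\<infinity>n. (norm (G n))\<^sup>2)"
  have "column_bounded A \<alpha>"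
  proof
    show "l1_le (\<lambda>i. A i m) \<alpha>" for m
      unfolding l1_le_def
    proof (intro allI impI)
      fix F :: "(int ^ 'd) set" assume F: "finite F"
      have Gm: "(\<lambda>n. (norm (G (n - m)))\<^sup>2) summable_on UNIV" "(\<Sum>\<^sub>\<infinity>n. (norm (G (n - m)))\<^sup>2) = (\<Sum>\<^sub>\<infinity>n. (norm (G n))\<^sup>2)"
        using summable_on_reindex_bij_betw[OF bij_shift[of "- m"], of "\<lambda>n. (norm (G n))\<^sup>2"]
          infsum_reindex_bij_betw[OF bij_shift[of "- m"], of "\<lambda>n. (norm (G n))\<^sup>2"] G2 by simp_all
      have "(\<Sum>i\<in>F. norm (A i m)) = (\<Sum>i\<in>F. norm (V i) * norm (G (i - m)))" by (simp add: A_def norm_mult)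
      also have "\<dots> \<le> (\<Sum>\<^sub>\<infinity>i. norm (V i) * norm (G (i - m)))"
        by (intro finite_sum_le_infsum F cauchy_schwarz_summable_on V Gm) auto
      also have "\<dots> \<le> \<alpha>" unfolding \<alpha>_def Gm(2)[symmetric] by (intro cauchy_schwarz_infsum V Gm) auto
      finally show "(\<Sum>i\<in>F. norm (A i m)) \<le> \<alpha>" .
    qed
  qed
  then have "schroedinger_det V l = matrix_det (reg_matrix A)"
    unfolding schroedinger_det_def
  proof (rule regularized_det_eq)
    fix f :: "int ^ 'd \<Rightarrow> complex" and c assume f: "l1_le f c"
    show "(\<lambda>n. V n * free_resolvent l f n) = (\<lambda>i. \<Sum>\<^sub>\<infinity>m. A i m * f m)"
    proof
      fix n :: "int ^ 'd"
      have "(\<Sum>\<^sub>\<infinity>m. A n m * f m) = (\<Sum>\<^sub>\<infinity>m. V n * (G (n - m) * f m))" by (simp add: A_def mult.assoc)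
      also have "\<dots> = V n * (\<Sum>\<^sub>\<infinity>m. G (n - m) * f m)" by (rule infsum_cmult_right')
      finally show "V n * free_resolvent l f n = (\<Sum>\<^sub>\<infinity>m. A n m * f m)" by (simp add: free_resolvent_eq[OF G f])
    qed
  qed
  also have "\<dots> = matrix_det (reg_matrix (\<lambda>i j. v i * G (i - j) * u j))"
  proof (rule matrix_det_similar)
    show "A i j * u j = u i * (v i * G (i - j) * u j)" for i j by (simp add: A_def uv(1))
    show "A i j = 0 \<and> v i * G (i - j) * u j = 0" if "u i = 0" for i j using uv(2)[OF that] by (simp add: A_def uv(1))
  qed
  finally show ?thesis .
qed

lemma lspace_square_summable:
  fixes V :: "'i \<Rightarrow> complex"
  assumes V: "V \<in> lspace p" and p: "0 < p" "p \<le> 2"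
  shows "(\<lambda>n. (norm (V n))\<^sup>2) summable_on UNIV"
proof -
  have s: "(\<lambda>n. norm (V n) powr p) summable_on UNIV" using V by (simp add: lspace_def)
  define C where "C = (\<Sum>\<^sub>\<infinity>n. norm (V n) powr p)"
  have le: "norm (V n) powr p \<le> C" for n
    using finite_sum_le_infsum[OF s, of "{n}"] by (simp add: C_def)
  show ?thesis
  proof (rule summable_on_comparison_test)
    show "(\<lambda>n. C powr ((2 - p) / p) * norm (V n) powr p) summable_on UNIV"
      by (rule summable_on_cmult_right[OF s])
    show "(norm (V n))\<^sup>2 \<le> C powr ((2 - p) / p) * norm (V n) powr p" for n
    proof (cases "V n = 0")
      case False
      have "(norm (V n))\<^sup>2 = norm (V n) powr (2 - p) * norm (V n) powr p"
        using False by (simp add: powr_add[symmetric] powr_numeral)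
      also have "norm (V n) powr (2 - p) = (norm (V n) powr p) powr ((2 - p) / p)"
        using p by (simp add: powr_powr)
      also have "\<dots> \<le> C powr ((2 - p) / p)" using le p by (intro powr_mono2) auto
      finally show ?thesis by (simp add: mult_right_mono)
    qed simp
  qed simp
qed

lemma matrix_det_zero: "matrix_det (reg_matrix (\<lambda>i j. 0)) = 1"
proof -
  have r: "reg_matrix (\<lambda>i j :: 'a. 0) = (\<lambda>i j. 0)" by (simp add: reg_matrix_def fun_eq_iff)
  have m: "matrix_minor (\<lambda>i j :: 'a. 0) S = (if S = {} then 1 else 0)" if "finite S" for S
  proof (cases "S = {}")
    case True
    have "{\<pi>. \<pi> permutes ({} :: 'a set)} = {id}" by auto
    then show ?thesis using True by (simp add: matrix_minor_def)
  next
    case False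
    then have "(\<Prod>i\<in>S. (0 :: complex)) = 0" using that by (simp add: card_gt_0_iff)
    then show ?thesis using False by (simp add: matrix_minor_def)
  qed
  have "(\<Sum>\<^sub>\<infinity>S | finite S \<and> card S = k. matrix_minor (\<lambda>i j :: 'a. 0) S) = (if k = 0 then 1 else 0)" for k
  proof (cases "k = 0")
    case True
    then have "{S :: 'a set. finite S \<and> card S = k} = {{}}" by auto
    then show ?thesis using True by (simp add: m)
  next
    case False
    then have "(\<Sum>\<^sub>\<infinity>S | finite S \<and> card S = k. matrix_minor (\<lambda>i j :: 'a. 0) S) = 0"
      by (intro infsum_0) (auto simp: m)
    then show ?thesis using False by simp
  qed
  then have "matrix_det (reg_matrix (\<lambda>i j :: 'a. 0)) = (\<Sum>k. if k = 0 then 1 else 0)"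
    unfolding matrix_det_def r by simp
  also have "\<dots> = (\<Sum>k\<in>{0 :: nat}. if k = 0 then 1 else 0)" by (rule suminf_finite) auto
  finally show ?thesis by simp
qed

theorem disc_det_extension:
  fixes V :: "int ^ 'd::finite \<Rightarrow> complex"
  assumes d: "CARD('d) \<ge> 3" and V: "V \<in> lspace p" and p: "1 \<le> p" "p < (if CARD('d) = 3 then 6 / 5 else 4 / 3)"
  obtains F where "disc_algebra F" "\<And>z. norm z < 1 \<Longrightarrow> disc_det V z = F z" "F 0 = 1"
proof -
  define u where "u = (\<lambda>n. complex_of_real (sqrt (norm (V n))))"
  \<comment> \<open>Where V vanishes, division by zero gives \<open>v n = 0\<close>. So both u and v
    have modulus \<open>sqrt (norm (V n))\<close> everywhere.\<close>
  define v where "v = (\<lambda>n. V n / u n)"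
  have nu: "norm (u n) = sqrt (norm (V n))" for n by (simp add: u_def)
  have nv: "norm (v n) = sqrt (norm (V n))" for n by (simp add: v_def norm_divide nu real_div_sqrt)
  have u0: "V n = 0" if "u n = 0" for n using that by (simp add: u_def)
  have uv: "V n = u n * v n" for n using u0 by (auto simp: v_def)
  define M where "M = (\<lambda>i j :: int ^ 'd. sqrt (norm (V i)) * prop_total (i - j) * sqrt (norm (V j)))"
  have "(\<lambda>(i, j). (M i j)\<^sup>2) = (\<lambda>(i, j). norm (V i) * norm (V j) * (prop_total (i - j))\<^sup>2)"
    by (simp add: M_def power_mult_distrib mult_ac)
  then interpret hilbert_schmidt_majorant M
    using hilbert_schmidt_prop_total[OF d V p] by unfold_locales (auto simp: M_def prop_total_nonneg[OF d])
  define K where "K = (\<lambda>z i j :: int ^ 'd. v i * disc_kernel z (i - j) * u j)"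
  define F where "F = (\<lambda>z. matrix_det (reg_matrix (K z)))"
  have K_le: "norm (K z i j) \<le> M i j" if "norm z \<le> 1" for z i j
    unfolding K_def M_def norm_mult nu nv
    by (intro mult_mono norm_disc_kernel_le d that) (auto simp: prop_total_nonneg[OF d])
  have K_alg: "disc_algebra (\<lambda>z. K z i j)" for i j
  proof -
    have "disc_algebra (\<lambda>z. disc_kernel z (i - j))"
      using continuous_on_disc_kernel[OF d] holomorphic_on_disc_kernel[OF d] by (simp add: disc_algebra_def)
    then show ?thesis unfolding K_def by (intro disc_algebra_mult disc_algebra_const)
  qed
  have F: "disc_algebra F" unfolding F_def by (rule disc_algebra_matrix_det[OF K_le K_alg])
  have F0: "F 0 = 1" by (simp add: F_def K_def disc_kernel_def matrix_det_zero)
  have V2: "(\<lambda>n. (norm (V n))\<^sup>2) summable_on UNIV"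
    using p by (intro lspace_square_summable[OF V]) (auto split: if_splits)
  have eq: "disc_det V z = F z" if z: "norm z < 1" for z
  proof (cases "z = 0")
    case True
    then show ?thesis using F0 by (simp add: disc_det_def)
  next
    case False
    have "schroedinger_det V (spectral_param CARD('d) z) = matrix_det (reg_matrix (\<lambda>i j. v i * disc_kernel z (i - j) * u j))"
      by (rule schroedinger_det_eq[OF is_resolvent_kernel_disc_kernel[OF d False z] V2 uv]) (simp add: v_def)
    then show ?thesis using False by (simp add: disc_det_def F_def K_def)
  qed
  show thesis by (rule that[OF F eq F0])
qed

section \<open>Canonical factorization\<close>

text \<open>Induction on the index set: dividing by \<open>z - a i\<close> lowers the order by one
  at \<open>a i\<close> and nowhere else. J lists the zeros in U with multiplicity; outside U the
  quotient g may still vanish.\<close>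

lemma holomorphic_factor_zeros:
  fixes f :: "complex \<Rightarrow> complex" and a :: "'j \<Rightarrow> complex"
  assumes "finite J" "f holomorphic_on S" "open S" "connected S" "U \<subseteq> S" "\<exists>w\<in>S. f w \<noteq> 0"
    and "\<And>j. j \<in> J \<Longrightarrow> a j \<in> U"
    and "\<And>w. w \<in> U \<Longrightarrow> zorder f w = int (card {j\<in>J. a j = w})"
  obtains g where "g holomorphic_on S" "\<And>z. z \<in> S \<Longrightarrow> f z = (\<Prod>j\<in>J. z - a j) * g z"
    "\<And>w. w \<in> U \<Longrightarrow> g w \<noteq> 0"
  using assms
proof (induction J arbitrary: f thesis rule: finite_induct)
  case empty
  have "f w \<noteq> 0" if "w \<in> U" for w
  proof -
    have "w \<in> S" using that empty.prems by auto
    from zorder_exist_zero[OF empty.prems(2,3,4) this empty.prems(6)] empty.prems(8)[OF that]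
    show ?thesis by (auto split: if_splits)
  qed
  then show thesis using empty.prems(1,2) by auto
next
  case (insert i J)
  let ?b = "a i"
  have bU: "?b \<in> U" using insert.prems by auto
  then have bS: "?b \<in> S" using insert.prems by auto
  have "{j \<in> insert i J. a j = ?b} = insert i {j\<in>J. a j = ?b}" by auto
  then have "zorder f ?b > 0" using insert.prems(8)[OF bU] insert.hyps by simp
  with zorder_exist_zero[OF insert.prems(2,3,4) bS insert.prems(6)] have fb: "f ?b = 0"
    by (auto split: if_splits)
  define f1 where "f1 = (\<lambda>z. if z = ?b then deriv f ?b else f z / (z - ?b))"
  have hol1: "f1 holomorphic_on S"
    using pole_lemma_open[OF insert.prems(2,3), of ?b] unfolding f1_def fb by (simp only: diff_zero)
  have eq: "f z = (z - ?b) * f1 z" for z using fb by (simp add: f1_def)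
  have nz1: "\<exists>w\<in>S. f1 w \<noteq> 0" using insert.prems(6) eq by auto
  have zo: "zorder f w = (if w = ?b then 1 else 0) + zorder f1 w" if "w \<in> S" for w
  proof -
    have an: "f1 analytic_on {w}" using hol1 insert.prems(3) that by (auto simp: analytic_at)
    have "eventually (\<lambda>z. f z \<noteq> 0) (at w)"
    proof -
      obtain v where "v \<in> S" "f v \<noteq> 0" using insert.prems(6) by auto
      from non_zero_neighbour_alt[OF insert.prems(2,3,4) that this] show ?thesis
        by (rule eventually_mono) simp
    qed
    then have "zorder (\<lambda>z. (z - ?b) * f1 z) w = zorder (\<lambda>z. z - ?b) w + zorder f1 w"
      by (intro zorder_times_analytic an) (auto simp: eq intro!: analytic_intros)
    moreover have "zorder (\<lambda>z. z - ?b) w = (if w = ?b then 1 else 0)"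
    proof (cases "w = ?b")
      case True
      then show ?thesis using zorder_eqI[of UNIV w "\<lambda>_. 1" "\<lambda>z. z - ?b" 1] by simp
    next
      case False
      then show ?thesis using zorder_eq_0I[of "\<lambda>z. z - ?b" w] by (simp add: analytic_intros)
    qed
    moreover have "f = (\<lambda>z. (z - ?b) * f1 z)" using eq by auto
    ultimately show ?thesis by simp
  qed
  have zo1: "zorder f1 w = int (card {j\<in>J. a j = w})" if w: "w \<in> U" for w
  proof -
    have "w \<in> S" using w insert.prems by auto
    have "{j \<in> insert i J. a j = w} = (if w = ?b then insert i {j\<in>J. a j = w} else {j\<in>J. a j = w})" by auto
    then show ?thesis using zo[OF \<open>w \<in> S\<close>] insert.prems(8)[OF w] insert.hyps by (simp split: if_splits)
  qed
  obtain g where g: "g holomorphic_on S" "\<And>z. z \<in> S \<Longrightarrow> f1 z = (\<Prod>j\<in>J. z - a j) * g z" "\<And>w. w \<in> U \<Longrightarrow> g w \<noteq> 0"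
    by (rule insert.IH[OF _ hol1 insert.prems(3,4,5) nz1 _ zo1]) (use insert.prems(7) in auto)
  show thesis
    by (rule insert.prems(1)[OF g(1) _ g(3)]) (use insert.hyps g(2) eq in simp_all)
qed

section \<open>Integral formulas on the unit circle\<close>

lemma cis_neq: "norm z < 1 \<Longrightarrow> cis t \<noteq> z"
  by (metis norm_cis less_irrefl)

lemma cauchy_integral_unit_circle:
  assumes hol: "f holomorphic_on ball 0 R" and R: "R > 1" and w: "norm w < 1"
  shows "((\<lambda>t. f (cis t) * (cis t / (cis t - w))) has_integral 2 * of_real pi * f w) {-pi..pi}"
proof -
  \<comment> \<open>\<open>circlepath\<close> is parametrized over an angle from 0 to 2 pi;
    reflecting f and shifting the angle by pi moves the interval to
    \<open>{-pi..pi}\<close>.\<close>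
  define f' where "f' = (\<lambda>z. f (- z))"
  have h1: "f' holomorphic_on ball 0 R"
    unfolding f'_def using holomorphic_on_compose_gen[OF _ hol, of uminus "ball 0 R"]
    by (simp add: o_def holomorphic_intros image_subset_iff)
  then have h2: "f' holomorphic_on cball 0 1" by (rule holomorphic_on_subset) (use R in auto)
  have "((\<lambda>u. f' u / (u - (- w))) has_contour_integral 2 * of_real pi * \<i> * f' (- w)) (circlepath 0 1)"
    by (rule Cauchy_integral_circlepath_simple[OF h2]) (use w in simp)
  then have "((\<lambda>t. f' (cis t) / (cis t + w) * \<i> * cis t) has_integral 2 * of_real pi * \<i> * f w) {0..2*pi}"
    unfolding circlepath_def by (subst (asm) has_contour_integral_part_circlepath_iff) (auto simp: f'_def)
  then have "((\<lambda>t. f' (cis (t + pi)) / (cis (t + pi) + w) * \<i> * cis (t + pi)) has_integral 2 * of_real pi * \<i> * f w) {0-pi..2*pi-pi}"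
    by (rule has_integral_shift_real_ivl)
  then have "((\<lambda>t. (- \<i>) * (f' (cis (t + pi)) / (cis (t + pi) + w) * \<i> * cis (t + pi))) has_integral (- \<i>) * (2 * of_real pi * \<i> * f w)) {0-pi..2*pi-pi}"
    by (rule has_integral_mult_right)
  moreover have "(- \<i>) * (f' (cis (t + pi)) / (cis (t + pi) + w) * \<i> * cis (t + pi)) = f (cis t) * (cis t / (cis t - w))" for t
  proof -
    have "cis (t + pi) = - cis t" by (simp add: cis_mult[symmetric])
    moreover have "cis t \<noteq> w" by (rule cis_neq[OF w])
    ultimately show ?thesis by (simp add: f'_def field_simps)
  qed
  moreover have "(- \<i>) * (2 * of_real pi * \<i> * f w) = 2 * of_real pi * f w" by simp
  moreover have "{0 - pi..2 * pi - pi} = {- pi..pi}" by simp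
  ultimately show ?thesis by (simp only:)
qed

text \<open>The Cauchy formula at \<open>z\<close> and the conjugate of the mean value property of
  \<open>L \<zeta> / (1 - cnj z * \<zeta>)\<close> are added.\<close>

lemma schwarz_integral_formula:
  assumes hol: "L holomorphic_on ball 0 R" and R: "R > 1" and z: "norm z < 1" and L0: "Im (L 0) = 0"
  shows "((\<lambda>t. (cis t + z) / (cis t - z) * of_real (Re (L (cis t)))) has_integral 2 * of_real pi * L z) {-pi..pi}"
proof -
  have C1: "((\<lambda>t. L (cis t) * (cis t / (cis t - z))) has_integral 2 * of_real pi * L z) {-pi..pi}"
    by (rule cauchy_integral_unit_circle[OF hol R z])
  \<comment> \<open>Keeps |u| below 1 / |z|, so that \<open>1 - cnj z * u\<close> has no zero in the
    enlarged disc.\<close>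
  define R' where "R' = (if z = 0 then R else min R (1 / norm z))"
  have R': "R' > 1" "R' \<le> R" using R z by (auto simp: R'_def field_simps)
  have ne: "1 - cnj z * u \<noteq> 0" if "u \<in> ball 0 R'" for u
  proof
    assume "1 - cnj z * u = 0"
    then have "cnj z * u = 1" by simp
    then have *: "norm z * norm u = 1" by (metis complex_mod_cnj norm_mult norm_one)
    then have "z \<noteq> 0" by auto
    then have "norm u < 1 / norm z" using that by (simp add: R'_def)
    then show False using * \<open>z \<noteq> 0\<close> by (simp add: field_simps)
  qed
  have h: "(\<lambda>u. L u / (1 - cnj z * u)) holomorphic_on ball 0 R'"
    using ne by (intro holomorphic_intros holomorphic_on_subset[OF hol]) (use R' in auto)
  have "((\<lambda>t. L (cis t) / (1 - cnj z * cis t) * (cis t / (cis t - 0))) has_integral 2 * of_real pi * (L 0 / (1 - cnj z * 0))) {-pi..pi}"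
    by (rule cauchy_integral_unit_circle[OF h R'(1)]) simp
  then have "((\<lambda>t. L (cis t) / (1 - cnj z * cis t)) has_integral 2 * of_real pi * L 0) {-pi..pi}" by simp
  then have "((cnj \<circ> (\<lambda>t. L (cis t) / (1 - cnj z * cis t))) has_integral cnj (2 * of_real pi * L 0)) {-pi..pi}"
    by (subst has_integral_cnj)
  moreover have "cnj (1 - cnj z * cis t) = (cis t - z) / cis t" for t
    by (simp add: cis_cnj field_simps flip: cis_inverse)
  ultimately have C2: "((\<lambda>t. cnj (L (cis t)) * (cis t / (cis t - z))) has_integral 2 * of_real pi * cnj (L 0)) {-pi..pi}"
    by (simp add: o_def)
  have "((\<lambda>t. L (cis t) * (cis t / (cis t - 0))) has_integral 2 * of_real pi * L 0) {-pi..pi}"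
    by (rule cauchy_integral_unit_circle[OF hol R]) simp
  then have C3: "((\<lambda>t. L (cis t)) has_integral 2 * of_real pi * L 0) {-pi..pi}" by simp
  then have "((\<lambda>t. Re (L (cis t))) has_integral Re (2 * of_real pi * L 0)) {-pi..pi}"
    by (rule has_integral_Re)
  then have C4: "((\<lambda>t. of_real (Re (L (cis t))) :: complex) has_integral of_real (Re (2 * of_real pi * L 0))) {-pi..pi}"
    by (rule has_integral_of_real)
  \<comment> \<open>The kernel (cis t + z) / (cis t - z) is 2 cis t / (cis t - z) - 1, and L + cnj L
    = 2 Re L.\<close>
  have "((\<lambda>t. L (cis t) * (cis t / (cis t - z)) + cnj (L (cis t)) * (cis t / (cis t - z)) - of_real (Re (L (cis t))))
     has_integral 2 * of_real pi * L z + 2 * of_real pi * cnj (L 0) - of_real (Re (2 * of_real pi * L 0))) {-pi..pi}"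
    by (intro has_integral_add has_integral_diff C1 C2 C4)
  moreover have "2 * of_real pi * L z + 2 * of_real pi * cnj (L 0) - of_real (Re (2 * of_real pi * L 0)) = 2 * of_real pi * L z"
    using L0 by (auto simp: complex_eq_iff)
  moreover have "L (cis t) * (cis t / (cis t - z)) + cnj (L (cis t)) * (cis t / (cis t - z)) - of_real (Re (L (cis t)))
      = (cis t + z) / (cis t - z) * of_real (Re (L (cis t)))" for t
  proof -
    have "L (cis t) * (cis t / (cis t - z)) + cnj (L (cis t)) * (cis t / (cis t - z)) = of_real (2 * Re (L (cis t))) * (cis t / (cis t - z))"
      by (metis complex_add_cnj distrib_right)
    moreover have "cis t - z \<noteq> 0" using cis_neq[OF z, of t] by simp
    ultimately show ?thesis by (simp add: field_simps)
  qed
  ultimately show ?thesis by simp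
qed

text \<open>By compactness G has no zeros in a slightly larger disc either, hence has a holomorphic
  logarithm there. Normalized to be the real number ln c at 0, this logarithm satisfies the Schwarz
  formula.\<close>

lemma nonvanishing_poisson:
  assumes hol: "G holomorphic_on ball 0 R" and R: "R > 1" and nz: "\<And>z. norm z \<le> 1 \<Longrightarrow> G z \<noteq> 0"
    and G0: "G 0 = of_real c" "c > 0" and z: "norm z < 1"
  shows "G z = exp (1 / (2 * of_real pi) *
    (LINT t:{-pi..pi}|lborel. (cis t + z) / (cis t - z) * of_real (ln (norm (G (cis t))))))"
proof -
  have op: "open {z\<in>ball 0 R. G z \<noteq> 0}"
  proof -
    have "open (ball 0 R \<inter> G -` (- {0}))"
      by (rule continuous_open_preimage[OF holomorphic_on_imp_continuous_on[OF hol]]) auto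
    moreover have "ball 0 R \<inter> G -` (- {0}) = {z\<in>ball 0 R. G z \<noteq> 0}" by auto
    ultimately show ?thesis by simp
  qed
  have sub: "cball 0 1 \<subseteq> {z\<in>ball 0 R. G z \<noteq> 0}" using R nz by auto
  obtain e where e: "e > 0" "(\<Union>x\<in>cball 0 1. cball x e) \<subseteq> {z\<in>ball 0 R. G z \<noteq> 0}"
    by (rule compact_subset_open_imp_cball_epsilon_subset[OF compact_cball op sub])
  have sub2: "ball 0 (1 + e) \<subseteq> {z\<in>ball 0 R. G z \<noteq> 0}"
  proof
    fix u :: complex assume u: "u \<in> ball 0 (1 + e)"
    show "u \<in> {z\<in>ball 0 R. G z \<noteq> 0}"
    proof (cases "norm u \<le> 1")
      case True
      then show ?thesis using sub by auto
    next
      case False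
      have "u \<in> cball (sgn u) e"
      proof -
        have "u \<noteq> 0" using False by auto
        have "of_real (norm u) * sgn u = u" using \<open>u \<noteq> 0\<close> by (simp add: sgn_eq)
        then have "u - sgn u = of_real (norm u - 1) * sgn u" by (simp add: algebra_simps)
        then have "norm (u - sgn u) = \<bar>norm u - 1\<bar> * norm (sgn u)" by (metis norm_mult norm_of_real)
        then have "norm (u - sgn u) = norm u - 1" using False \<open>u \<noteq> 0\<close> by (simp add: norm_sgn)
        then show ?thesis using u by (simp add: dist_norm norm_minus_commute)
      qed
      moreover have "sgn u \<in> cball 0 1" by (simp add: norm_sgn)
      ultimately show ?thesis using e(2) by blast
    qed
  qed
  have "convex (ball (0::complex) (1 + e))" by simp
  moreover have "G holomorphic_on ball 0 (1 + e)" using sub2 by (intro holomorphic_on_subset[OF hol]) auto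
  ultimately obtain L0 where L0: "L0 holomorphic_on ball 0 (1+e)" "\<And>z. z \<in> ball 0 (1+e) \<Longrightarrow> exp (L0 z) = G z"
    using sub2 e(1) by (rule_tac holomorphic_logarithm_exists[of "ball 0 (1+e)" G 0]) auto
  define L where "L = (\<lambda>z. L0 z - L0 0 + of_real (ln c))"
  have L: "L holomorphic_on ball 0 (1+e)" unfolding L_def by (intro holomorphic_intros L0)
  have expL: "exp (L z) = G z" if "z \<in> ball 0 (1+e)" for z
    using L0(2)[OF that] L0(2)[of 0] e(1) G0 by (simp add: L_def exp_add exp_diff exp_of_real)
  have ReL: "Re (L (cis t)) = ln (norm (G (cis t)))" for t
  proof -
    have "exp (L (cis t)) = G (cis t)" using e(1) by (intro expL) simp
    then have "norm (G (cis t)) = exp (Re (L (cis t)))" by (simp flip: norm_exp_eq_Re)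
    then show ?thesis by simp
  qed
  have I: "((\<lambda>t. (cis t + z) / (cis t - z) * of_real (Re (L (cis t)))) has_integral 2 * of_real pi * L z) {-pi..pi}"
    using e(1) by (intro schwarz_integral_formula[OF L _ z]) (auto simp: L_def)
  have "continuous_on {-pi..pi} (\<lambda>t. (cis t + z) / (cis t - z) * of_real (Re (L (cis t))))"
  proof -
    have "continuous_on (ball 0 (1+e)) L" by (rule holomorphic_on_imp_continuous_on[OF L])
    then have "continuous_on {-pi..pi} (\<lambda>t. L (cis t))"
      by (rule continuous_on_compose2) (use e(1) in \<open>auto intro!: continuous_intros\<close>)
    then show ?thesis using cis_neq[OF z] by (auto intro!: continuous_intros)
  qed
  then have "set_integrable lborel {-pi..pi} (\<lambda>t. (cis t + z) / (cis t - z) * of_real (Re (L (cis t))))"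
    by (rule borel_integrable_atLeastAtMost')
  from set_borel_integral_eq_integral(2)[OF this] integral_unique[OF I]
  have "(LINT t:{-pi..pi}|lborel. (cis t + z) / (cis t - z) * of_real (Re (L (cis t)))) = 2 * of_real pi * L z"
    by simp
  then have "1 / (2 * of_real pi) * (LINT t:{-pi..pi}|lborel. (cis t + z) / (cis t - z) * of_real (Re (L (cis t)))) = L z"
    by simp
  moreover have "exp (L z) = G z" using z e(1) by (intro expL) simp
  ultimately show ?thesis by (simp add: ReL)
qed

section \<open>Blaschke factors and the Poisson-Jensen formula\<close>

definition blaschke_factor :: "complex \<Rightarrow> complex \<Rightarrow> complex" where
  "blaschke_factor a z = of_real (norm a) / a * ((a - z) / (1 - cnj a * z))"

lemma blaschke_denominator_nonzero:
  assumes "norm a < 1" "norm z \<le> 1"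
  shows "1 - cnj a * z \<noteq> 0"
proof
  assume "1 - cnj a * z = 0"
  then have "cnj a * z = 1" by simp
  then have *: "norm a * norm z = 1" by (metis complex_mod_cnj norm_mult norm_one)
  have "norm a * norm z \<le> norm a * 1" using assms by (intro mult_left_mono) auto
  then show False using * assms by simp
qed

lemma norm_blaschke_factor_circle:
  assumes "norm a < 1" "a \<noteq> 0"
  shows "norm (blaschke_factor a (cis t)) = 1"
proof -
  have "1 - cnj a * cis t = cis t * cnj (cis t - a)"
    by (simp add: algebra_simps cis_mult cis_cnj)
  then have "norm (1 - cnj a * cis t) = norm (a - cis t)"
    by (simp add: norm_mult norm_minus_commute complex_mod_cnj del: complex_cnj_diff)
  moreover have "a - cis t \<noteq> 0" using cis_neq[OF assms(1), of t] by simp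
  ultimately show ?thesis using assms(2) by (simp add: blaschke_factor_def norm_mult norm_divide)
qed

text \<open>After rescaling by r the zeros are removed by Blaschke factors. These have modulus 1 on
  the circle and positive value at 0, so the zero-free quotient G has the boundary modulus of F and
  G 0 > 0.\<close>

lemma poisson_jensen:
  fixes F :: "complex \<Rightarrow> complex" and a :: "'j \<Rightarrow> complex"
  assumes hol: "F holomorphic_on ball 0 1" and F0: "F 0 = 1" and r: "0 < r" "r < 1"
    and nz: "\<And>w. norm w = r \<Longrightarrow> F w \<noteq> 0" and J: "finite J"
    and a: "\<And>j. j \<in> J \<Longrightarrow> norm (a j) < r \<and> a j \<noteq> 0"
    and ord: "\<And>w. norm w \<le> r \<Longrightarrow> zorder F w = int (card {j\<in>J. a j = w})"
    and z: "norm z < 1"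
  shows "F (r * z) = (\<Prod>j\<in>J. blaschke_factor (a j / r) z) * exp (1 / (2 * of_real pi) *
    (LINT t:{-pi..pi}|lborel. (cis t + z) / (cis t - z) * of_real (ln (norm (F (r * cis t))))))"
proof -
  have ne: "\<exists>w\<in>ball 0 1. F w \<noteq> 0" using F0 by (auto intro!: bexI[of _ 0])
  have sub: "cball 0 r \<subseteq> ball (0::complex) 1" using r by auto
  have aU: "a j \<in> cball 0 r" if "j \<in> J" for j using a[OF that] by simp
  have ordU: "zorder F w = int (card {j \<in> J. a j = w})" if "w \<in> cball 0 r" for w using ord that by simp
  obtain g where g: "g holomorphic_on ball 0 1" "\<And>z. z \<in> ball 0 1 \<Longrightarrow> F z = (\<Prod>j\<in>J. z - a j) * g z"
    "\<And>w. w \<in> cball 0 r \<Longrightarrow> g w \<noteq> 0"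
    by (rule holomorphic_factor_zeros[OF J hol open_ball connected_ball sub ne aU ordU]) (assumption | rule that)+
  define b where "b = (\<lambda>j. a j / r)"
  have b: "norm (b j) < 1" "b j \<noteq> 0" "of_real r * b j = a j" if "j \<in> J" for j
    using a[OF that] r by (auto simp: b_def norm_divide)
  \<comment> \<open>The cofactor of the Blaschke factor in \<open>r * z - a j\<close>; it has no
    zero in the closed disc.\<close>
  define q where "q = (\<lambda>j (z::complex). - (of_real r * b j / of_real (norm (b j))) * (1 - cnj (b j) * z))"
  define G where "G = (\<lambda>z::complex. g (r * z) * (\<Prod>j\<in>J. q j z))"
  have rz: "norm (of_real r * z) < 1" if "norm z < 1 / r" for z :: complex
    using that r by (simp add: norm_mult field_simps)
  have one: "norm z < 1 / r" if "norm z \<le> 1" for z :: complex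
    using that r by (simp add: field_simps) (smt (verit) mult_left_le norm_ge_zero mult.commute)
  have G: "G holomorphic_on ball 0 (1 / r)"
  proof -
    have "(g \<circ> (\<lambda>z::complex. of_real r * z)) holomorphic_on ball 0 (1 / r)"
      by (rule holomorphic_on_compose_gen[OF _ g(1)]) (use rz in \<open>auto intro!: holomorphic_intros\<close>)
    then show ?thesis unfolding G_def q_def o_def by (intro holomorphic_intros)
  qed
  have fac: "r * z - a j = blaschke_factor (b j) z * q j z" if "j \<in> J" "norm z \<le> 1" for j and z :: complex
  proof -
    have "1 - cnj (b j) * z \<noteq> 0" using b[OF that(1)] that by (intro blaschke_denominator_nonzero)
    then show ?thesis using b[OF that(1)] by (simp add: blaschke_factor_def q_def b(3)[OF that(1), symmetric] algebra_simps del: b(3)) (simp add: field_simps)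
  qed
  have FG: "F (r * z) = (\<Prod>j\<in>J. blaschke_factor (b j) z) * G z" if "norm z \<le> 1" for z :: complex
  proof -
    have "F (r * z) = (\<Prod>j\<in>J. r * z - a j) * g (r * z)"
      using rz[OF one[OF that]] by (intro g(2)) simp
    also have "(\<Prod>j\<in>J. r * z - a j) = (\<Prod>j\<in>J. blaschke_factor (b j) z * q j z)"
      using fac that by (intro prod.cong) auto
    finally show ?thesis by (simp add: G_def prod.distrib)
  qed
  have Gnz: "G z \<noteq> 0" if "norm z \<le> 1" for z :: complex
  proof -
    have "norm (of_real r * z) \<le> r" using that r by (simp add: norm_mult mult_left_le)
    then have "g (r * z) \<noteq> 0" by (intro g(3)) simp
    moreover have "q j z \<noteq> 0" if "j \<in> J" for j
      using b(1,2)[OF that] r blaschke_denominator_nonzero[of "b j" z] \<open>norm z \<le> 1\<close> by (simp add: q_def)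
    ultimately show ?thesis using J by (simp add: G_def)
  qed
  define P where "P = (\<Prod>j\<in>J. norm (b j))"
  define c where "c = 1 / P"
  have P: "P > 0" unfolding P_def using b by (intro prod_pos) auto
  then have c: "c > 0" unfolding c_def by simp
  have "(\<Prod>j\<in>J. blaschke_factor (b j) 0) = of_real P"
    unfolding P_def of_real_prod using b by (intro prod.cong) (auto simp: blaschke_factor_def)
  then have G0: "G 0 = of_real c" using FG[of 0] F0 P by (simp add: c_def field_simps)
  have nG: "norm (G (cis t)) = norm (F (r * cis t))" for t
  proof -
    have "norm (\<Prod>j\<in>J. blaschke_factor (b j) (cis t)) = 1"
      unfolding prod_norm[symmetric] using norm_blaschke_factor_circle b by (intro prod.neutral) auto
    then show ?thesis using FG[of "cis t"] by (simp add: norm_mult)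
  qed
  have "1 / r > 1" using r by simp
  from nonvanishing_poisson[OF G this Gnz G0 c z] FG[of z] z show ?thesis
    by (simp add: nG b_def)
qed

text \<open>Helly's selection theorem in its form for probability measures. The lower bound 1 keeps
  the masses away from 0, so that the densities can be normalized.\<close>

lemma helly_interval:
  fixes h :: "nat \<Rightarrow> real \<Rightarrow> real" and a b :: real
  defines "L \<equiv> restrict_space lborel {a..b}"
  assumes ab: "a < b" and cont: "\<And>n. continuous_on UNIV (h n)" and ge1: "\<And>n t. h n t \<ge> 1"
    and K: "\<And>n. integral\<^sup>L L (h n) \<le> K"
  obtains s \<nu> where "strict_mono (s :: nat \<Rightarrow> nat)" "finite_measure \<nu>" "sets \<nu> = sets (restrict_space borel {a..b})"
    "\<forall>k :: real \<Rightarrow> complex. continuous_on UNIV k \<longrightarrow> bounded (range k) \<longrightarrow>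
       (\<lambda>n. LINT t|L. k t * of_real (h (s n) t)) \<longlonglongrightarrow> integral\<^sup>L \<nu> k"
proof -
  have spL: "space L = {a..b}" by (simp add: L_def space_restrict_space)
  have eL: "emeasure L (space L) = ennreal (b - a)"
    using ab by (simp add: L_def space_restrict_space emeasure_restrict_space)
  interpret L: finite_measure L by (rule finite_measureI) (simp add: eL)
  have mL: "measure L (space L) = b - a" using ab eL by (simp add: measure_def)
  have contm: "f \<in> borel_measurable L" if "continuous_on UNIV f" for f :: "real \<Rightarrow> 'c::{banach, second_countable_topology}"
    unfolding L_def by (rule measurable_restrict_space1) (use borel_measurable_continuous_onI[OF that] in simp)
  have [measurable]: "h n \<in> borel_measurable L" for n by (rule contm[OF cont])
  have idm: "(\<lambda>t::real. t) \<in> borel_measurable L" by (rule contm) (rule continuous_on_id)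
  have int: "integrable L (h n)" for n
  proof -
    have "compact (h n ` {a..b})" by (rule compact_continuous_image[OF continuous_on_subset[OF cont]]) auto
    from compact_imp_bounded[OF this] obtain B where B: "\<And>t. t \<in> {a..b} \<Longrightarrow> norm (h n t) \<le> B"
      unfolding bounded_iff by (metis image_eqI)
    show ?thesis by (rule L.integrable_const_bound[of _ B]) (use B spL in auto)
  qed
  define m where "m = (\<lambda>n. integral\<^sup>L L (h n))"
  have m_ge: "m n \<ge> b - a" for n
  proof -
    have "integral\<^sup>L L (\<lambda>_. 1) \<le> integral\<^sup>L L (h n)" by (rule integral_mono) (use int ge1 in auto)
    then show ?thesis by (simp add: m_def mL)
  qed
  have m_pos: "m n > 0" for n using m_ge[of n] ab by linarith
  \<comment> \<open>The normalizing masses must converge as well, to a positive limit; this costs a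
    first subsequence.\<close>
  have "compact {b - a..K}" by simp
  moreover have "m n \<in> {b - a..K}" for n using m_ge K by (simp add: m_def)
  ultimately obtain s0 m0 where s0: "m0 \<in> {b - a..K}" "strict_mono s0" "(m \<circ> s0) \<longlonglongrightarrow> m0"
    unfolding compact_def by metis
  have m0: "m0 > 0" using s0(1) ab by auto
  define P0 where "P0 = (\<lambda>n. density L (\<lambda>t. ennreal (h n t / m n)))"
  define P where "P = (\<lambda>n. distr (P0 n) borel (\<lambda>t. t))"
  have h_nn: "0 \<le> h n t / m n" for n t using ge1[of n t] m_pos[of n] by simp
  have prob0: "prob_space (P0 n)" for n
  proof
    have "emeasure (P0 n) (space (P0 n)) = (\<integral>\<^sup>+t. ennreal (h n t / m n) \<partial>L)"
      unfolding P0_def by (subst emeasure_density) (auto intro!: nn_integral_cong)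
    also have "\<dots> = ennreal (LINT t|L. h n t / m n)"
      by (rule nn_integral_eq_integral) (use int h_nn in auto)
    also have "(LINT t|L. h n t / m n) = 1" using m_pos[of n] by (simp add: m_def)
    finally show "emeasure (P0 n) (space (P0 n)) = 1" by simp
  qed
  have idm0: "(\<lambda>t. t) \<in> borel_measurable (P0 n)" for n using idm by (simp add: P0_def)
  have rd: "real_distribution (P n)" for n
    unfolding P_def by (rule prob_space.real_distribution_distr[OF prob0 idm0])
  have intP: "integral\<^sup>L (P n) k = (LINT t|L. (h n t / m n) *\<^sub>R k t)"
    if "continuous_on UNIV k" for n and k :: "real \<Rightarrow> 'c::{banach, second_countable_topology}"
  proof -
    have "integral\<^sup>L (P n) k = integral\<^sup>L (P0 n) k"
      unfolding P_def by (rule integral_distr[OF idm0]) (rule borel_measurable_continuous_onI[OF that])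
    also have "\<dots> = (LINT t|L. (h n t / m n) *\<^sub>R k t)"
      unfolding P0_def by (rule integral_density[OF contm[OF that]]) (use h_nn in auto)
    finally show ?thesis .
  qed
  have "tight P"
    unfolding tight_def
  proof (intro conjI allI impI rd)
    fix e :: real assume e: "e > 0"
    \<comment> \<open>Tightness is stated with half-open intervals, so the left end is moved to a -
      1 to include the point a.\<close>
    have "measure (P n) {a - 1<..b} = 1" for n
    proof -
      have "measure (P n) {a - 1<..b} = measure (P0 n) ((\<lambda>t. t) -` {a - 1<..b} \<inter> space (P0 n))"
        unfolding P_def by (rule measure_distr[OF idm0]) simp
      also have "(\<lambda>t. t) -` {a - 1<..b} \<inter> space (P0 n) = space (P0 n)"
        by (auto simp: P0_def spL)
      finally show ?thesis using prob_space.prob_space[OF prob0] by simp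
    qed
    then show "\<exists>a b. a < b \<and> (\<forall>n. 1 - e < measure (P n) {a<..b})"
      using e ab by (intro exI[of _ "a - 1"] exI[of _ b]) auto
  qed
  from tight_imp_convergent_subsubsequence[OF this s0(2)]
  obtain r M where r: "strict_mono r" "real_distribution M" "weak_conv_m (P \<circ> s0 \<circ> r) M" by auto
  interpret M: real_distribution M by (rule r(2))
  define s where "s = s0 \<circ> r"
  have s: "strict_mono s" unfolding s_def by (rule strict_mono_o[OF s0(2) r(1)])
  have ms: "(\<lambda>n. m (s n)) \<longlonglongrightarrow> m0"
    using LIMSEQ_subseq_LIMSEQ[OF s0(3) r(1)] by (simp add: s_def o_def)
  have lim: "(\<lambda>n. LINT t|L. (h (s n) t / m (s n)) *\<^sub>R k t) \<longlonglongrightarrow> integral\<^sup>L M k"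
    if k: "continuous_on UNIV k" "\<And>t. norm (k t) \<le> B" for k :: "real \<Rightarrow> 'c::{banach, second_countable_topology}" and B
  proof -
    have "(\<lambda>n. integral\<^sup>L ((P \<circ> s0 \<circ> r) n) k) \<longlonglongrightarrow> integral\<^sup>L M k"
    proof (rule weak_conv_imp_integral_bdd_continuous_conv)
      show "real_distribution ((P \<circ> s0 \<circ> r) n)" for n by (simp add: rd)
      show "isCont k x" for x using k(1) by (simp add: continuous_on_eq_continuous_at)
    qed (fact r(2) r(3) k(2))+
    then show ?thesis by (simp add: intP[OF k(1)] s_def)
  qed
  have AE: "AE t in M. t \<in> {a..b}"
  proof -
    \<comment> \<open>The truncated distance to \<open>{a..b}\<close> vanishes exactly on that
      interval, and its integrals against the approximating measures are 0; so the limit measure is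
      concentrated there.\<close>
    define k where "k = (\<lambda>t. max 0 (min 1 (max (a - t) (t - b))))"
    have kc: "continuous_on UNIV k" unfolding k_def by (intro continuous_intros)
    have kb: "norm (k t) \<le> 1" for t by (simp add: k_def)
    have k0: "k t = 0 \<longleftrightarrow> t \<in> {a..b}" for t by (auto simp: k_def)
    have "(LINT t|L. (h (s n) t / m (s n)) *\<^sub>R k t) = 0" for n
      by (rule integral_eq_zero_AE, rule AE_I2) (simp add: spL k0)
    then have "integral\<^sup>L M k = 0" using lim[OF kc kb] by (simp only: LIMSEQ_const_iff)
    moreover have "integrable M k"
      by (rule M.integrable_const_bound[of _ 1]) (use kb borel_measurable_continuous_onI[OF kc] in auto)
    moreover have "AE t in M. 0 \<le> k t" by (simp add: k_def)
    ultimately have "AE t in M. k t = 0" using integral_nonneg_eq_0_iff_AE by metis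
    then show ?thesis by (simp add: k0)
  qed
  \<comment> \<open>The limit mass \<open>m0\<close> undoes the normalization.\<close>
  define \<nu> where "\<nu> = density (restrict_space M {a..b}) (\<lambda>_. ennreal m0)"
  have SM: "{a..b} \<inter> space M \<in> sets M" by simp
  have fin: "finite_measure \<nu>"
  proof (rule finite_measureI)
    have "emeasure \<nu> (space \<nu>) = ennreal m0 * emeasure (restrict_space M {a..b}) {a..b}"
      unfolding \<nu>_def by (subst emeasure_density_const) (auto simp: space_restrict_space sets_restrict_space_iff)
    also have "\<dots> = ennreal m0 * ennreal (measure M {a..b})"
      by (subst emeasure_restrict_space) (auto simp: M.emeasure_eq_measure)
    finally show "emeasure \<nu> (space \<nu>) \<noteq> \<infinity>" by (simp add: ennreal_mult_eq_top_iff)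
  qed
  have sets: "sets \<nu> = sets (restrict_space borel {a..b})"
    unfolding \<nu>_def sets_density by (rule sets_restrict_space_cong) simp
  show thesis
  proof (rule that[OF s fin sets], intro allI impI)
    fix k :: "real \<Rightarrow> complex" assume k0: "continuous_on UNIV k" "bounded (range k)"
    then obtain B where k: "continuous_on UNIV k" "\<And>t. norm (k t) \<le> B"
      by (auto simp: bounded_iff)
    have [measurable]: "k \<in> borel_measurable borel" by (rule borel_measurable_continuous_onI[OF k(1)])
    have "(\<lambda>n. of_real (m (s n)) * (LINT t|L. (h (s n) t / m (s n)) *\<^sub>R k t)) \<longlonglongrightarrow> of_real m0 * integral\<^sup>L M k"
      by (intro tendsto_mult tendsto_of_real ms lim[OF k])
    moreover have "of_real (m (s n)) * (LINT t|L. (h (s n) t / m (s n)) *\<^sub>R k t) = (LINT t|L. k t * of_real (h (s n) t))" for n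
      using m_pos[of "s n"] by (subst integral_mult_right_zero[symmetric]) (simp add: scaleR_conv_of_real mult_ac)
    moreover have "integral\<^sup>L \<nu> k = of_real m0 * integral\<^sup>L M k"
    proof -
      have "integral\<^sup>L \<nu> k = integral\<^sup>L (restrict_space M {a..b}) (\<lambda>t. m0 *\<^sub>R k t)"
        unfolding \<nu>_def using m0 by (intro integral_density measurable_restrict_space1) auto
      also have "\<dots> = integral\<^sup>L M (\<lambda>t. indicator {a..b} t *\<^sub>R m0 *\<^sub>R k t)"
        by (rule integral_restrict_space[OF SM])
      also have "\<dots> = integral\<^sup>L M (\<lambda>t. of_real m0 * k t)"
        proof (rule integral_cong_AE)
        show "AE t in M. indicator {a..b} t *\<^sub>R m0 *\<^sub>R k t = of_real m0 * k t"
          using AE by eventually_elim (simp add: scaleR_conv_of_real)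
      qed auto
      finally show ?thesis by simp
    qed
    ultimately show "(\<lambda>n. LINT t|L. k t * of_real (h (s n) t)) \<longlonglongrightarrow> integral\<^sup>L \<nu> k" by simp
  qed
qed

text \<open>Near zeros of v nothing dominates \<open>ln (u n)\<close>, so mass may concentrate
  there: integrals against k then converge only up to the correction by sigma. Subtracting the
  logarithm from a constant makes the densities positive, which is what weak compactness
  requires.\<close>

lemma log_integral_limit:
  fixes u :: "nat \<Rightarrow> real \<Rightarrow> real" and v :: "real \<Rightarrow> real" and a b M :: real
  defines "L \<equiv> restrict_space lborel {a..b}" and "Z \<equiv> {t\<in>{a..b}. v t = 0}"
  assumes ab: "a < b" and M: "1 \<le> M"
    and uc: "\<And>n. continuous_on UNIV (u n)" and up: "\<And>n t. 0 < u n t" and uM: "\<And>n t. u n t \<le> M"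
    and uni: "uniform_limit UNIV u v sequentially"
    and mean: "\<And>n. 0 \<le> (LINT t|L. ln (u n t))"
  obtains s \<sigma> where "strict_mono (s :: nat \<Rightarrow> nat)" "finite_measure \<sigma>" "sets \<sigma> = sets (restrict_space borel {a..b})"
    "Z \<in> null_sets lborel" "emeasure \<sigma> (space \<sigma> - Z) = 0" "integrable L (\<lambda>t. ln (v t))"
    "\<forall>k :: real \<Rightarrow> complex. continuous_on UNIV k \<longrightarrow> bounded (range k) \<longrightarrow>
       (\<lambda>n. LINT t|L. k t * of_real (ln (u (s n) t))) \<longlonglongrightarrow> (LINT t|L. k t * of_real (ln (v t))) - integral\<^sup>L \<sigma> k"
proof -
  have vc: "continuous_on UNIV v" by (rule uniform_limit_theorem[OF _ uni]) (use uc in auto)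
  have ulim: "(\<lambda>n. u n t) \<longlonglongrightarrow> v t" for t by (rule tendsto_uniform_limitI[OF uni]) simp
  have v0: "0 \<le> v t" for t by (rule LIMSEQ_le_const[OF ulim]) (use up less_imp_le in blast)
  have vM: "v t \<le> M" for t by (rule LIMSEQ_le_const2[OF ulim]) (use uM in blast)
  have spL: "space L = {a..b}" by (simp add: L_def space_restrict_space)
  have eL: "emeasure L (space L) = ennreal (b - a)"
    using ab by (simp add: L_def space_restrict_space emeasure_restrict_space)
  interpret L: finite_measure L by (rule finite_measureI) (simp add: eL)
  have mL: "measure L (space L) = b - a" using ab eL by (simp add: measure_def)
  have meas: "f \<in> borel_measurable L" if "f \<in> borel_measurable borel" for f :: "real \<Rightarrow> 'c::{banach, second_countable_topology}"
    unfolding L_def by (rule measurable_restrict_space1) (use that in simp)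
  have cint: "integrable L f" if "continuous_on UNIV f" for f :: "real \<Rightarrow> 'c::{banach, second_countable_topology}"
  proof -
    have "compact (f ` {a..b})" by (rule compact_continuous_image[OF continuous_on_subset[OF that]]) auto
    from compact_imp_bounded[OF this] obtain B where B: "\<And>t. t \<in> {a..b} \<Longrightarrow> norm (f t) \<le> B"
      unfolding bounded_iff by (metis image_eqI)
    show ?thesis by (rule L.integrable_const_bound[of _ B]) (use B spL meas borel_measurable_continuous_onI[OF that] in auto)
  qed
  have [measurable]: "v \<in> borel_measurable borel" by (rule borel_measurable_continuous_onI[OF vc])
  \<comment> \<open>The extra 1 above the maximum of the logarithms yields the lower bound 1
    demanded by \<open>helly_interval\<close>.\<close>
  define C where "C = ln M + 1"
  define h where "h = (\<lambda>n t. C - ln (u n t))"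
  \<comment> \<open>Since \<open>ln 0 = 0\<close>, h' has the finite value C at zeros of v, where h
    n tends to infinity; the two agree in the limit only off the zeros, which turn out to form a
    null set.\<close>
  define h' where "h' = (\<lambda>t. C - ln (v t))"
  have [measurable]: "h' \<in> borel_measurable borel" unfolding h'_def by measurable
  have lnuc: "continuous_on UNIV (\<lambda>t. ln (u n t))" for n
    using up[of n] by (intro continuous_on_ln uc) (metis less_irrefl)
  have hc: "continuous_on UNIV (h n)" for n unfolding h_def by (intro continuous_on_diff continuous_on_const lnuc)
  have h1: "h n t \<ge> 1" for n t
    using ln_mono[OF uM up, of n t] by (simp add: h_def C_def)
  have h'1: "h' t \<ge> 1" for t
  proof (cases "v t = 0")
    case True
    then show ?thesis using M by (simp add: h'_def C_def)
  next
    case False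
    then have "0 < v t" using v0[of t] by simp
    then show ?thesis using ln_mono[OF vM[of t]] by (simp add: h'_def C_def)
  qed
  have hlim: "(\<lambda>n. h n t) \<longlonglongrightarrow> h' t" if "v t \<noteq> 0" for t
    unfolding h_def h'_def by (intro tendsto_intros ulim that)
  have hK: "integral\<^sup>L L (h n) \<le> C * (b - a)" for n
  proof -
    have "integral\<^sup>L L (h n) = (LINT t|L. C) - (LINT t|L. ln (u n t))"
      unfolding h_def by (rule Bochner_Integration.integral_diff) (auto intro: cint lnuc)
    then show ?thesis using mean[of n] by (simp add: mL mult.commute)
  qed
  obtain s \<nu> where s: "strict_mono s" and fin: "finite_measure \<nu>" and sets: "sets \<nu> = sets (restrict_space borel {a..b})"
    and lim0: "\<forall>k :: real \<Rightarrow> complex. continuous_on UNIV k \<longrightarrow> bounded (range k) \<longrightarrow>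
       (\<lambda>n. LINT t|L. k t * of_real (h (s n) t)) \<longlonglongrightarrow> integral\<^sup>L \<nu> k"
    by (rule helly_interval[where h = h, OF ab hc h1 hK[unfolded L_def], folded L_def]) (rule that)
  have lim: "(\<lambda>n. LINT t|L. k t * of_real (h (s n) t)) \<longlonglongrightarrow> integral\<^sup>L \<nu> k"
    if "continuous_on UNIV k" "\<And>t. norm (k t) \<le> B" for k :: "real \<Rightarrow> complex" and B
    by (rule lim0[rule_format, OF that(1) boundedI[of _ B]]) (use that(2) in auto)
  interpret \<nu>: finite_measure \<nu> by (rule fin)
  have sp\<nu>: "space \<nu> = {a..b}" using sets_eq_imp_space_eq[OF sets] by (simp add: space_restrict_space)
  have meas\<nu>: "f \<in> borel_measurable \<nu>" if "f \<in> borel_measurable borel" for f :: "real \<Rightarrow> 'c::{banach, second_countable_topology}"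
    unfolding measurable_cong_sets[OF sets refl] by (rule measurable_restrict_space1[OF that])
  have AE0: "AE t in L. v t \<noteq> 0" and h'int: "integrable L h'"
  proof -
    \<comment> \<open>Fatou is applied to the true limit g, which is infinite at the zeros of v.
      Finiteness of its integral makes the zeros a null set, and only then may g be exchanged for
      h'.\<close>
    define g where "g = (\<lambda>t. liminf (\<lambda>n. ennreal (h n t)))"
    have [measurable]: "h n \<in> borel_measurable borel" for n by (rule borel_measurable_continuous_onI[OF hc])
    have hL: "(\<lambda>t. ennreal (h n t)) \<in> borel_measurable L" for n
      unfolding L_def by (rule measurable_restrict_space1) measurable
    have gm: "g \<in> borel_measurable L" unfolding g_def by (rule borel_measurable_liminf[OF hL])
    have "(\<integral>\<^sup>+t. g t \<partial>L) \<le> liminf (\<lambda>n. \<integral>\<^sup>+t. ennreal (h n t) \<partial>L)"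
      unfolding g_def by (rule nn_integral_liminf[OF hL])
    also have "\<dots> \<le> ennreal (C * (b - a))"
    proof (rule Liminf_le)
      have "(\<integral>\<^sup>+t. ennreal (h n t) \<partial>L) = ennreal (integral\<^sup>L L (h n))" for n
        by (rule nn_integral_eq_integral[OF cint[OF hc]]) (use h1 in \<open>auto intro!: AE_I2 order_trans[OF zero_le_one]\<close>)
      then show "\<forall>\<^sub>F n in sequentially. (\<integral>\<^sup>+t. ennreal (h n t) \<partial>L) \<le> ennreal (C * (b - a))"
        using hK by (simp add: ennreal_leI)
    qed simp
    finally have gfin: "(\<integral>\<^sup>+t. g t \<partial>L) \<noteq> \<infinity>" by (auto simp: top_unique)
    have g0: "g t = \<infinity>" if "v t = 0" for t
    proof -
      have "filterlim (\<lambda>n. u n t) (at_right 0) sequentially"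
      proof -
        have "u n t \<noteq> 0" for n using up[of n t] by simp
        then show ?thesis using ulim[of t] up that by (auto simp: filterlim_at)
      qed
      then have "filterlim (\<lambda>n. ln (u n t)) at_bot sequentially"
        by (rule filterlim_compose[OF ln_at_0])
      then have "filterlim (\<lambda>n. - ln (u n t)) at_top sequentially" by (simp add: filterlim_uminus_at_top)
      then have "filterlim (\<lambda>n. C + - ln (u n t)) at_top sequentially"
        by (rule filterlim_tendsto_add_at_top[OF tendsto_const])
      then have "(\<lambda>n. ennreal (h n t)) \<longlonglongrightarrow> \<infinity>"
        by (simp add: h_def ennreal_tendsto_top_eq_at_top)
      then show ?thesis unfolding g_def by (rule lim_imp_Liminf[OF sequentially_bot])
    qed
    have g1: "g t = ennreal (h' t)" if "v t \<noteq> 0" for t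
      unfolding g_def by (rule lim_imp_Liminf[OF sequentially_bot tendsto_ennrealI[OF hlim[OF that]]])
    have "AE t in L. g t \<noteq> \<infinity>" by (rule nn_integral_noteq_infinite[OF gm gfin])
    then show AE: "AE t in L. v t \<noteq> 0" by eventually_elim (use g0 in auto)
    have "(\<integral>\<^sup>+t. ennreal (h' t) \<partial>L) = (\<integral>\<^sup>+t. g t \<partial>L)"
      by (rule nn_integral_cong_AE) (use AE g1 in \<open>auto elim: eventually_mono\<close>)
    then show "integrable L h'"
      using gfin h'1 by (intro integrableI_nonneg meas AE_I2) (auto simp: less_top intro: order_trans[OF zero_le_one])
  qed
  have lnint: "integrable L (\<lambda>t. ln (v t))"
  proof -
    have "integrable L (\<lambda>t. C - h' t)" by (intro Bochner_Integration.integrable_diff h'int) auto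
    then show ?thesis by (simp add: h'_def)
  qed
  have Zm [measurable]: "Z \<in> sets borel" unfolding Z_def by measurable
  have Znull: "Z \<in> null_sets lborel"
  proof -
    have "AE t in lborel. t \<in> {a..b} \<longrightarrow> v t \<noteq> 0"
      using AE0 unfolding L_def by (subst (asm) AE_restrict_space_iff) auto
    then have "AE t in lborel. t \<notin> Z" by eventually_elim (auto simp: Z_def)
    then show ?thesis using Zm by (simp add: AE_iff_null_sets)
  qed
  have Z\<nu>: "Z \<in> sets \<nu>" unfolding sets using Zm by (auto simp: sets_restrict_space_iff Z_def)
  define \<sigma> where "\<sigma> = density \<nu> (\<lambda>t. ennreal (indicator Z t))"
  have off: "(LINT t|\<nu>. indicator (- Z) t *\<^sub>R k t) = (LINT t|L. k t * of_real (h' t))"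
    if k: "continuous_on UNIV k" "\<And>t. norm (k t) \<le> B" for k :: "real \<Rightarrow> complex" and B
  proof -
    have B: "0 \<le> B" using order_trans[OF norm_ge_zero k(2)] .
    have [measurable]: "k \<in> borel_measurable borel" by (rule borel_measurable_continuous_onI[OF k(1)])
    \<comment> \<open>Cut-offs that vanish near the zeros of \<open>v\<close>, so that dominated convergence applies to \<open>\<psi> j * ln (u n)\<close>.\<close>
    define \<psi> where "\<psi> = (\<lambda>j::nat. \<lambda>t. max 0 (min 1 (real (Suc j) * v t - 1)))"
    have \<psi>c: "continuous_on UNIV (\<psi> j)" for j unfolding \<psi>_def by (intro continuous_intros vc)
    have [measurable]: "\<psi> j \<in> borel_measurable borel" for j by (rule borel_measurable_continuous_onI[OF \<psi>c])
    have \<psi>01: "0 \<le> \<psi> j t" "\<psi> j t \<le> 1" for j t by (auto simp: \<psi>_def)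
    define k' where "k' = (\<lambda>j t. k t * of_real (\<psi> j t))"
    have k'c: "continuous_on UNIV (k' j)" for j unfolding k'_def by (intro continuous_intros k \<psi>c)
    have [measurable]: "k' j \<in> borel_measurable borel" for j by (rule borel_measurable_continuous_onI[OF k'c])
    have k'B: "norm (k' j t) \<le> B" for j t
      using mult_mono[OF k(2) \<psi>01(2) B \<psi>01(1)] \<psi>01(1)[of j t] by (simp add: k'_def norm_mult)
    have eq: "integral\<^sup>L \<nu> (k' j) = (LINT t|L. k' j t * of_real (h' t))" for j
    proof -
      \<comment> \<open>The cut-off is nonzero only where v > 2 e. Once u n is within e of v, it is
        at least e there, so h is at most \<open>C - ln e\<close>.\<close>
      define e where "e = 1 / (2 * real (Suc j))"
      have e: "e > 0" by (simp add: e_def)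
      obtain N where N: "\<And>n t. n \<ge> N \<Longrightarrow> \<bar>u n t - v t\<bar> < e"
        using uniform_limitD[OF uni e] by (auto simp: eventually_sequentially dist_real_def)
      have "(\<lambda>n. LINT t|L. k' j t * of_real (h (s (n + N)) t)) \<longlonglongrightarrow> (LINT t|L. k' j t * of_real (h' t))"
      proof (rule integral_dominated_convergence)
        show "(\<lambda>t. k' j t * of_real (h' t)) \<in> borel_measurable L" by (rule meas) measurable
        show "(\<lambda>t. k' j t * of_real (h (s (n + N)) t)) \<in> borel_measurable L" for n
          by (rule meas[OF borel_measurable_continuous_onI]) (intro continuous_intros k'c hc)
        show "integrable L (\<lambda>_. B * (C - ln e))" by simp
        show "AE t in L. (\<lambda>n. k' j t * of_real (h (s (n + N)) t)) \<longlonglongrightarrow> k' j t * of_real (h' t)"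
        proof (rule AE_I2)
          fix t
          show "(\<lambda>n. k' j t * of_real (h (s (n + N)) t)) \<longlonglongrightarrow> k' j t * of_real (h' t)"
          proof (cases "v t = 0")
            case True
            then show ?thesis by (simp add: k'_def \<psi>_def)
          next
            case False
            have "(\<lambda>n. h (s (n + N)) t) \<longlonglongrightarrow> h' t"
              by (rule LIMSEQ_ignore_initial_segment[OF LIMSEQ_subseq_LIMSEQ[OF hlim[OF False] s, unfolded o_def]])
            then show ?thesis by (intro tendsto_intros)
          qed
        qed
        show "AE t in L. norm (k' j t * of_real (h (s (n + N)) t)) \<le> B * (C - ln e)" for n
        proof (rule AE_I2)
          fix t
          have B': "0 \<le> B * (C - ln e)"
          proof -
            have "e \<le> 1" by (simp add: e_def)
            then have "ln e \<le> 0" using e by simp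
            moreover have "0 \<le> C" using M by (simp add: C_def)
            ultimately show ?thesis using B by simp
          qed
          show "norm (k' j t * of_real (h (s (n + N)) t)) \<le> B * (C - ln e)"
          proof (cases "\<psi> j t = 0")
            case True
            then show ?thesis using B' by (simp add: k'_def)
          next
            case False
            then have "1 < real (Suc j) * v t" by (auto simp: \<psi>_def max_def min_def split: if_splits)
            then have "2 * e < v t" by (simp add: e_def field_simps)
            moreover have "N \<le> s (n + N)" using strict_mono_imp_increasing[OF s, of "n + N"] by linarith
            ultimately have "e \<le> u (s (n + N)) t" using N[of "s (n + N)" t] by linarith
            then have "ln e \<le> ln (u (s (n + N)) t)" using e by (rule ln_mono)
            then have "\<bar>h (s (n + N)) t\<bar> \<le> C - ln e" using h1[of "s (n + N)" t] by (simp add: h_def)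
            then show ?thesis unfolding norm_mult norm_of_real
              by (intro mult_mono k'B B) auto
          qed
        qed
      qed
      moreover have "(\<lambda>n. LINT t|L. k' j t * of_real (h (s (n + N)) t)) \<longlonglongrightarrow> integral\<^sup>L \<nu> (k' j)"
        by (rule LIMSEQ_ignore_initial_segment[OF lim[OF k'c k'B]])
      ultimately show ?thesis by (rule LIMSEQ_unique[rotated])
    qed
    have h'0: "0 \<le> h' t" for t using h'1[of t] by linarith
    have \<psi>lim: "(\<lambda>j. \<psi> j t) \<longlonglongrightarrow> 1" if "v t \<noteq> 0" for t
    proof (rule tendsto_eventually)
      have vt: "v t > 0" using that v0[of t] by simp
      obtain j0 where j0: "2 / v t < real j0" using reals_Archimedean2 by blast
      show "\<forall>\<^sub>F j in sequentially. \<psi> j t = 1"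
        unfolding eventually_sequentially
      proof (intro exI allI impI)
        fix j assume "j0 \<le> j"
        then have "2 / v t < real (Suc j)" using j0 by linarith
        then have "2 < real (Suc j) * v t" using vt by (simp add: field_simps)
        then show "\<psi> j t = 1" by (simp add: \<psi>_def)
      qed
    qed
    \<comment> \<open>The cut-offs tend to the indicator of the complement of Z. The dominating
      function is B for the limit measure, and \<open>B * h'\<close> for Lebesgue measure, where the
      integrability from Fatou enters.\<close>
    have "(\<lambda>j. integral\<^sup>L \<nu> (k' j)) \<longlonglongrightarrow> (LINT t|\<nu>. indicator (- Z) t *\<^sub>R k t)"
    proof (rule integral_dominated_convergence)
      show "(\<lambda>t. indicator (- Z) t *\<^sub>R k t) \<in> borel_measurable \<nu>" by (rule meas\<nu>) measurable
      show "k' j \<in> borel_measurable \<nu>" for j by (rule meas\<nu>) measurable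
      show "integrable \<nu> (\<lambda>_. B)" by simp
      show "AE t in \<nu>. norm (k' j t) \<le> B" for j using k'B by simp
      show "AE t in \<nu>. (\<lambda>j. k' j t) \<longlonglongrightarrow> indicator (- Z) t *\<^sub>R k t"
      proof (rule AE_I2)
        fix t assume "t \<in> space \<nu>"
        then have t: "t \<in> {a..b}" by (simp add: sp\<nu>)
        show "(\<lambda>j. k' j t) \<longlonglongrightarrow> indicator (- Z) t *\<^sub>R k t"
        proof (cases "v t = 0")
          case True
          then show ?thesis using t by (simp add: k'_def \<psi>_def Z_def)
        next
          case False
          then have "(\<lambda>j. k t * of_real (\<psi> j t)) \<longlonglongrightarrow> k t * of_real 1" by (intro tendsto_intros \<psi>lim)
          then show ?thesis using False by (simp add: k'_def Z_def)
        qed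
      qed
    qed
    moreover have "(\<lambda>j. LINT t|L. k' j t * of_real (h' t)) \<longlonglongrightarrow> (LINT t|L. k t * of_real (h' t))"
    proof (rule integral_dominated_convergence)
      show "(\<lambda>t. k t * of_real (h' t)) \<in> borel_measurable L" by (rule meas) measurable
      show "(\<lambda>t. k' j t * of_real (h' t)) \<in> borel_measurable L" for j by (rule meas) measurable
      show "integrable L (\<lambda>t. B * h' t)" by (intro integrable_mult_right h'int)
      show "AE t in L. norm (k' j t * of_real (h' t)) \<le> B * h' t" for j
        using h'0 by (intro AE_I2) (auto simp: norm_mult intro!: mult_right_mono k'B)
      show "AE t in L. (\<lambda>j. k' j t * of_real (h' t)) \<longlonglongrightarrow> k t * of_real (h' t)"
        using AE0
      proof eventually_elim
        case (elim t)
        then have "(\<lambda>j. k t * of_real (\<psi> j t) * of_real (h' t)) \<longlonglongrightarrow> k t * of_real 1 * of_real (h' t)"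
          by (intro tendsto_intros \<psi>lim)
        then show ?case by (simp add: k'_def)
      qed
    qed
    ultimately show ?thesis unfolding eq by (rule LIMSEQ_unique)
  qed
  show thesis
  proof (rule that[OF s _ _ Znull _ lnint, rotated 3], intro allI impI)
    show "sets \<sigma> = sets (restrict_space borel {a..b})" by (simp add: \<sigma>_def sets)
    have em: "emeasure \<sigma> X = emeasure \<nu> (Z \<inter> X)" if "X \<in> sets \<nu>" for X
      unfolding \<sigma>_def using emeasure_restricted[OF Z\<nu> that] by (simp add: ennreal_indicator)
    show "finite_measure \<sigma>" by (rule finite_measureI) (simp add: \<sigma>_def em[unfolded \<sigma>_def])
    show "emeasure \<sigma> (space \<sigma> - Z) = 0"
      using em[of "space \<nu> - Z"] Z\<nu> by (simp add: \<sigma>_def)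
    fix k :: "real \<Rightarrow> complex" assume k0: "continuous_on UNIV k" "bounded (range k)"
    then obtain B where k: "continuous_on UNIV k" "\<And>t. norm (k t) \<le> B"
      by (auto simp: bounded_iff)
    have [measurable]: "k \<in> borel_measurable borel" by (rule borel_measurable_continuous_onI[OF k(1)])
    have ki: "integrable L k" by (rule cint[OF k(1)])
    have "integral\<^sup>L \<sigma> k = (LINT t|\<nu>. indicator Z t *\<^sub>R k t)"
      unfolding \<sigma>_def using Zm by (intro integral_density meas\<nu>) auto
    moreover have "integral\<^sup>L \<nu> k = (LINT t|\<nu>. indicator (- Z) t *\<^sub>R k t) + (LINT t|\<nu>. indicator Z t *\<^sub>R k t)"
    proof -
      have i: "integrable \<nu> (\<lambda>t. indicator X t *\<^sub>R k t)" if "X \<in> sets borel" for X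
        using that order_trans[OF norm_ge_zero k(2)]
        by (intro \<nu>.integrable_const_bound[of _ B] meas\<nu> AE_I2) (auto simp: indicator_def k(2))
      have "integral\<^sup>L \<nu> k = (LINT t|\<nu>. indicator (- Z) t *\<^sub>R k t + indicator Z t *\<^sub>R k t)"
        by (rule Bochner_Integration.integral_cong) (auto simp: indicator_def)
      also have "\<dots> = (LINT t|\<nu>. indicator (- Z) t *\<^sub>R k t) + (LINT t|\<nu>. indicator Z t *\<^sub>R k t)"
        using Zm by (intro Bochner_Integration.integral_add i) auto
      finally show ?thesis .
    qed
    ultimately have \<nu>: "integral\<^sup>L \<nu> k = (LINT t|L. k t * of_real (h' t)) + integral\<^sup>L \<sigma> k"
      using off[OF k] by simp
    have B: "0 \<le> B" using order_trans[OF norm_ge_zero k(2)] .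
    have kh': "integrable L (\<lambda>t. k t * of_real (h' t))"
    proof (rule Bochner_Integration.integrable_bound)
      show "integrable L (\<lambda>t. B * h' t)" by (intro integrable_mult_right h'int)
      show "(\<lambda>t. k t * of_real (h' t)) \<in> borel_measurable L" by (rule meas) measurable
      show "AE t in L. norm (k t * of_real (h' t)) \<le> norm (B * h' t)"
        using B by (intro AE_I2) (auto simp: norm_mult abs_mult intro!: mult_right_mono k(2))
    qed
    have e1: "(LINT t|L. k t * of_real (ln (v t))) = of_real C * integral\<^sup>L L k - (LINT t|L. k t * of_real (h' t))"
    proof -
      have "(LINT t|L. k t * of_real (ln (v t))) = (LINT t|L. of_real C * k t - k t * of_real (h' t))"
        by (simp add: h'_def algebra_simps)
      also have "\<dots> = (LINT t|L. of_real C * k t) - (LINT t|L. k t * of_real (h' t))"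
        by (intro Bochner_Integration.integral_diff kh' integrable_mult_right ki)
      finally show ?thesis by simp
    qed
    have e2: "(LINT t|L. k t * of_real (ln (u (s n) t))) = of_real C * integral\<^sup>L L k - (LINT t|L. k t * of_real (h (s n) t))" for n
    proof -
      have "(LINT t|L. k t * of_real (ln (u (s n) t))) = (LINT t|L. of_real C * k t - k t * of_real (h (s n) t))"
        by (simp add: h_def algebra_simps)
      also have "\<dots> = (LINT t|L. of_real C * k t) - (LINT t|L. k t * of_real (h (s n) t))"
        by (intro Bochner_Integration.integral_diff cint continuous_intros k hc)
      finally show ?thesis by simp
    qed
    have "(\<lambda>n. of_real C * integral\<^sup>L L k - (LINT t|L. k t * of_real (h (s n) t))) \<longlonglongrightarrow> of_real C * integral\<^sup>L L k - integral\<^sup>L \<nu> k"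
      by (intro tendsto_intros lim[OF k])
    then show "(\<lambda>n. LINT t|L. k t * of_real (ln (u (s n) t))) \<longlonglongrightarrow> (LINT t|L. k t * of_real (ln (v t))) - integral\<^sup>L \<sigma> k"
      unfolding e1 e2 \<nu> by (simp add: algebra_simps)
  qed
qed

text \<open>A product is 1 plus the sum of (partial product) times (next factor - 1). Partial
  products have modulus at most 1, so the terms are dominated by w and Tannery's theorem applies to
  the sum.\<close>

lemma tendsto_prodinf_dominated:
  fixes T :: "nat \<Rightarrow> nat \<Rightarrow> complex"
  assumes lim: "\<And>j. (\<lambda>n. T n j) \<longlonglongrightarrow> b j" and T1: "\<And>n j. norm (T n j) \<le> 1"
    and w: "\<And>n j. norm (T n j - 1) \<le> w j" "summable w" and fin: "\<And>n. finite {j. T n j \<noteq> 1}"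
  shows "(\<lambda>n. \<Prod>j | T n j \<noteq> 1. T n j) \<longlonglongrightarrow> prodinf b"
proof -
  have tele: "(\<Prod>j<m. f j) = 1 + (\<Sum>k<m. (\<Prod>j<k. f j) * (f k - 1))" for f :: "nat \<Rightarrow> complex" and m
    by (induction m) (auto simp: algebra_simps)
  define a where "a = (\<lambda>k n. (\<Prod>j<k. T n j) * (T n k - 1))"
  define c where "c = (\<lambda>k. (\<Prod>j<k. b j) * (b k - 1))"
  have a_le: "norm (a k n) \<le> w k" for k n
  proof -
    have "norm (\<Prod>j<k. T n j) \<le> 1" unfolding prod_norm[symmetric] by (rule prod_le_1) (simp add: T1)
    then have "norm (\<Prod>j<k. T n j) * norm (T n k - 1) \<le> 1 * w k" by (intro mult_mono w) auto
    then show ?thesis by (simp add: a_def norm_mult)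
  qed
  have alim: "(\<lambda>n. a k n) \<longlonglongrightarrow> c k" for k unfolding a_def c_def by (intro tendsto_intros lim)
  have "(\<lambda>n. suminf (\<lambda>k. a k n)) \<longlonglongrightarrow> suminf c"
    using tannerys_theorem[OF alim always_eventually w(2) sequentially_bot] a_le by (simp add: split_def)
  moreover have "1 + suminf (\<lambda>k. a k n) = (\<Prod>j | T n j \<noteq> 1. T n j)" for n
  proof -
    obtain m where m: "{j. T n j \<noteq> 1} \<subseteq> {..<m}" using fin[of n] by (metis finite_nat_bounded)
    have "suminf (\<lambda>k. a k n) = (\<Sum>k<m. a k n)" by (rule suminf_finite) (use m in \<open>auto simp: a_def\<close>)
    moreover have "(\<Prod>j | T n j \<noteq> 1. T n j) = (\<Prod>j<m. T n j)"
      by (rule prod.mono_neutral_left) (use m in auto)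
    ultimately show ?thesis using tele[of "T n" m] by (simp add: a_def)
  qed
  ultimately have "(\<lambda>n. \<Prod>j | T n j \<noteq> 1. T n j) \<longlonglongrightarrow> 1 + suminf c"
    using tendsto_add[OF tendsto_const, of "\<lambda>n. suminf (\<lambda>k. a k n)" "suminf c" sequentially 1] by simp
  moreover have "prodinf b = 1 + suminf c"
  proof -
    have "norm (b j - 1) \<le> w j" for j
      by (rule LIMSEQ_le_const2[OF tendsto_norm[OF tendsto_diff[OF lim tendsto_const]]]) (use w(1) in blast)
    then have "summable (\<lambda>j. norm (b j - 1))" by (intro summable_comparison_test[OF _ w(2)]) auto
    then have "convergent_prod b"
      by (intro abs_convergent_prod_imp_convergent_prod summable_imp_abs_convergent_prod)
    then have "(\<lambda>n. \<Prod>j\<le>n. b j) \<longlonglongrightarrow> prodinf b" by (rule convergent_prod_LIMSEQ)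
    then have p: "(\<lambda>n. \<Prod>j<n. b j) \<longlonglongrightarrow> prodinf b" by (simp add: LIMSEQ_lessThan_iff_atMost)
    have "norm (c k) \<le> w k" for k
      by (rule LIMSEQ_le_const2[OF tendsto_norm[OF alim]]) (use a_le in blast)
    then have "summable c" by (intro summable_comparison_test[OF _ w(2)]) auto
    then have "(\<lambda>n. 1 + (\<Sum>k<n. c k)) \<longlonglongrightarrow> 1 + suminf c" by (intro tendsto_intros summable_LIMSEQ)
    moreover have "(\<Prod>j<n. b j) = 1 + (\<Sum>k<n. c k)" for n unfolding c_def by (rule tele)
    ultimately have "(\<lambda>n. \<Prod>j<n. b j) \<longlonglongrightarrow> 1 + suminf c" by (simp only:)
    with p show ?thesis by (rule LIMSEQ_unique)
  qed
  ultimately show ?thesis by simp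
qed

section \<open>Estimates for Blaschke factors and limits of Blaschke products\<close>

lemma norm_blaschke_factor_le_1:
  assumes "norm a < 1" "a \<noteq> 0" "norm z < 1"
  shows "norm (blaschke_factor a z) \<le> 1"
proof -
  have "norm (blaschke_factor a z) = norm (Moebius_function 0 a z)"
    using assms(2) norm_minus_commute[of a z]
    by (simp only: blaschke_factor_def Moebius_function_simple norm_mult norm_divide norm_of_real) simp
  then show ?thesis using Moebius_function_norm_lt_1[OF assms(1,3), of 0] by simp
qed

text \<open>Rotating a onto the positive axis turns z into w, and then the factor minus 1 is - (1 -
  |a|)(1 + w) / (1 - |a| w).\<close>

lemma norm_blaschke_factor_minus_1_le:
  assumes a: "norm a < 1" "a \<noteq> 0" and z: "norm z < 1"
  shows "norm (blaschke_factor a z - 1) \<le> 2 / (1 - norm z) * (1 - norm a)"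
proof -
  define e where "e = a / of_real (norm a)"
  define w where "w = cnj e * z"
  have e: "a = of_real (norm a) * e" "norm e = 1" using a(2) by (auto simp: e_def norm_divide)
  have ee: "e * cnj e = 1" using e(2) by (simp add: complex_norm_square[symmetric])
  have ne: "e \<noteq> 0" using e(2) by auto
  have nw: "norm w = norm z" using e(2) by (simp add: w_def norm_mult)
  have den: "1 - cnj a * z = 1 - of_real (norm a) * w"
    by (subst e(1)) (simp add: w_def)
  have dnz: "1 - of_real (norm a) * w \<noteq> 0" using blaschke_denominator_nonzero[of a z] a z den by simp
  have "of_real (norm a) / a * (a - z) = of_real (norm a) - w"
  proof -
    have "of_real (norm a) / a = cnj e" using ee ne a(2) by (simp add: e_def field_simps)
    then have "of_real (norm a) / a * (a - z) = cnj e * (of_real (norm a) * e - z)" using e(1) by simp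
    also have "\<dots> = of_real (norm a) * (e * cnj e) - w" by (simp add: w_def algebra_simps)
    finally show ?thesis by (simp add: ee)
  qed
  then have "blaschke_factor a z = (of_real (norm a) - w) / (1 - of_real (norm a) * w)"
    unfolding blaschke_factor_def den by (metis times_divide_eq_right)
  then have "blaschke_factor a z - 1 = - (of_real (1 - norm a) * (1 + w)) / (1 - of_real (norm a) * w)"
    using dnz by (simp add: field_simps)
  then have "norm (blaschke_factor a z - 1) = (1 - norm a) * norm (1 + w) / norm (1 - of_real (norm a) * w)"
    using a(1) by (simp only: norm_divide norm_minus_cancel norm_mult norm_of_real abs_of_nonneg diff_ge_0_iff_ge less_imp_le)
  also have "\<dots> \<le> (1 - norm a) * 2 / (1 - norm z)"
  proof (rule frac_le)
    show "(1 - norm a) * norm (1 + w) \<le> (1 - norm a) * 2"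
      using a(1) norm_triangle_ineq[of 1 w] z nw by (intro mult_left_mono) auto
    have "norm (of_real (norm a) * w) \<le> 1 * norm z"
      unfolding norm_mult nw using a(1) by (intro mult_right_mono) auto
    then show "1 - norm z \<le> norm (1 - of_real (norm a) * w)"
      using norm_triangle_ineq2[of 1 "of_real (norm a) * w"] by simp
  qed (use a z in auto)
  finally show ?thesis by (simp add: field_simps)
qed

text \<open>For a fixed finite set of zeros the bound A survives r -> 1, which gives the Blaschke
  condition. The sum of 1 - |zs j| is then a majorant, up to a factor depending on z, for all
  rescaled products at once.\<close>

lemma blaschke_product_limit:
  fixes zs :: "nat \<Rightarrow> complex" and r :: "nat \<Rightarrow> real"
  assumes zs: "\<And>j. enat j < N \<Longrightarrow> zs j \<noteq> 0 \<and> norm (zs j) < 1"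
    and r: "\<And>n. 0 < r n" "\<And>n. r n < 1" "r \<longlonglongrightarrow> 1"
    and fin: "\<And>n. finite {j. enat j < N \<and> norm (zs j) < r n}"
    and bnd: "\<And>n. (\<Sum>j | enat j < N \<and> norm (zs j) < r n. 1 - norm (zs j) / r n) \<le> A"
    and z: "norm z < 1"
  shows "(\<lambda>n. \<Prod>j | enat j < N \<and> norm (zs j) < r n. blaschke_factor (zs j / r n) z) \<longlonglongrightarrow> blaschke_product N zs z"
proof -
  define J where "J = (\<lambda>n. {j. enat j < N \<and> norm (zs j) < r n})"
  define T where "T = (\<lambda>n j. if j \<in> J n then blaschke_factor (zs j / r n) z else 1)"
  define b where "b = (\<lambda>j. if enat j < N then blaschke_factor (zs j) z else 1)"
  define q where "q = (\<lambda>j. if enat j < N then 1 - norm (zs j) else 0)"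
  define w where "w = (\<lambda>j. 2 / (1 - norm z) * q j)"
  have q0: "0 \<le> q j" for j using zs[of j] by (auto simp: q_def)
  have evJ: "\<forall>\<^sub>F n in sequentially. j \<in> J n" if "enat j < N" for j
    using order_tendstoD(1)[OF r(3), of "norm (zs j)"] zs[OF that] that by (auto simp: J_def)
  have "summable q"
  proof (rule summableI_nonneg_bounded[OF q0])
    fix m
    define X where "X = {j\<in>{..<m}. enat j < N}"
    have X: "finite X" "\<And>j. j \<in> X \<Longrightarrow> enat j < N" by (auto simp: X_def)
    have "(\<Sum>i<m. q i) = (\<Sum>j\<in>X. 1 - norm (zs j))"
      unfolding q_def X_def by (rule sum.inter_filter[symmetric]) simp
    also have "\<dots> \<le> A"
    proof (rule LIMSEQ_le_const2)
      have "(\<lambda>n. \<Sum>j\<in>X. 1 - norm (zs j) / r n) \<longlonglongrightarrow> (\<Sum>j\<in>X. 1 - norm (zs j) / 1)"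
        by (intro tendsto_intros r(3)) simp
      then show "(\<lambda>n. \<Sum>j\<in>X. 1 - norm (zs j) / r n) \<longlonglongrightarrow> (\<Sum>j\<in>X. 1 - norm (zs j))" by simp
      have "\<forall>\<^sub>F n in sequentially. \<forall>j\<in>X. j \<in> J n"
        using X evJ by (intro eventually_ball_finite) auto
      then have "\<forall>\<^sub>F n in sequentially. (\<Sum>j\<in>X. 1 - norm (zs j) / r n) \<le> A"
      proof eventually_elim
        case (elim n)
        have "(\<Sum>j\<in>X. 1 - norm (zs j) / r n) \<le> (\<Sum>j\<in>J n. 1 - norm (zs j) / r n)"
          using elim fin[of n] r(1)[of n] by (intro sum_mono2) (auto simp: J_def field_simps)
        then show ?case using bnd[of n] by (simp add: J_def)
      qed
      then show "\<exists>n0. \<forall>n\<ge>n0. (\<Sum>j\<in>X. 1 - norm (zs j) / r n) \<le> A" by (simp add: eventually_sequentially)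
    qed
    finally show "(\<Sum>i<m. q i) \<le> A" .
  qed
  then have w: "summable w" unfolding w_def by (rule summable_mult)
  have Jz: "norm (zs j / r n) < 1" "zs j / r n \<noteq> 0" "enat j < N" "1 - norm (zs j / r n) \<le> q j" if "j \<in> J n" for j n
  proof -
    have j: "enat j < N" "norm (zs j) < r n" using that by (auto simp: J_def)
    show "norm (zs j / r n) < 1" using j r(1)[of n] by (simp add: norm_divide)
    show "zs j / r n \<noteq> 0" using zs[OF j(1)] r(1)[of n] by simp
    show "enat j < N" by (rule j)
    \<comment> \<open>Division by r n < 1 moves zeros outward, so their distance to the circle does
      not exceed the one before rescaling.\<close>
    have "norm (zs j) * r n \<le> norm (zs j)" using r(1,2)[of n] by (intro mult_left_le) auto
    then show "1 - norm (zs j / r n) \<le> q j" using j r(1)[of n] by (simp add: q_def norm_divide field_simps)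
  qed
  have TJ: "{j. T n j \<noteq> 1} \<subseteq> J n" for n by (auto simp: T_def)
  have finJ: "finite (J n)" for n using fin by (simp add: J_def)
  have "(\<lambda>n. \<Prod>j | T n j \<noteq> 1. T n j) \<longlonglongrightarrow> prodinf b"
  proof (rule tendsto_prodinf_dominated)
    show "(\<lambda>n. T n j) \<longlonglongrightarrow> b j" for j
    proof (cases "enat j < N")
      case True
      have "1 - cnj (zs j / of_real 1) * z \<noteq> 0" using blaschke_denominator_nonzero[of "zs j" z] zs[OF True] z by simp
      then have "(\<lambda>n. blaschke_factor (zs j / r n) z) \<longlonglongrightarrow> blaschke_factor (zs j / of_real 1) z"
        using zs[OF True] unfolding blaschke_factor_def by (intro tendsto_intros r(3)) auto
      then have "(\<lambda>n. blaschke_factor (zs j / r n) z) \<longlonglongrightarrow> b j" using True by (simp add: b_def)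
      moreover have "\<forall>\<^sub>F n in sequentially. blaschke_factor (zs j / r n) z = T n j"
        using evJ[OF True] by eventually_elim (simp add: T_def)
      ultimately show ?thesis by (rule Lim_transform_eventually)
    next
      case False
      then show ?thesis by (simp add: T_def J_def b_def)
    qed
    show "norm (T n j) \<le> 1" for n j
      using norm_blaschke_factor_le_1[OF Jz(1,2) z] by (simp add: T_def)
    show "norm (T n j - 1) \<le> w j" for n j
    proof (cases "j \<in> J n")
      case True
      have "norm (T n j - 1) \<le> 2 / (1 - norm z) * (1 - norm (zs j / r n))"
        using norm_blaschke_factor_minus_1_le[OF Jz(1,2)[OF True] z] True by (simp add: T_def)
      also have "\<dots> \<le> w j" unfolding w_def using Jz(4)[OF True] z by (intro mult_left_mono) auto
      finally show ?thesis .
    next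
      case False
      then show ?thesis using q0[of j] z by (simp add: T_def w_def)
    qed
    show "finite {j. T n j \<noteq> 1}" for n by (rule finite_subset[OF TJ finJ])
  qed (rule w)
  moreover have "(\<Prod>j | T n j \<noteq> 1. T n j) = (\<Prod>j\<in>J n. blaschke_factor (zs j / r n) z)" for n
  proof -
    have "(\<Prod>j | T n j \<noteq> 1. T n j) = (\<Prod>j\<in>J n. T n j)"
      by (rule prod.mono_neutral_left) (use TJ finJ in auto)
    then show ?thesis by (simp add: T_def)
  qed
  moreover have "prodinf b = blaschke_product N zs z"
    unfolding blaschke_product_def b_def blaschke_factor_def ..
  ultimately show ?thesis by (simp add: J_def)
qed

section \<open>Zero-free circles, boundary values and Jensen's formula\<close>

lemma exists_zero_free_radius:
  assumes hol: "F holomorphic_on ball 0 1" and F0: "F 0 = 1" and x: "0 \<le> x" "x < 1"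
  obtains r where "x < r" "r < 1" "\<And>w. norm w = r \<Longrightarrow> F w \<noteq> 0"
    "finite {w\<in>cball 0 r. F w = 0}"
proof -
  have fin: "finite {w\<in>cball 0 y. F w = 0}" if y: "y < 1" for y
  proof (cases "F constant_on ball 0 1")
    case True
    then obtain c where c: "\<And>w. w \<in> ball 0 1 \<Longrightarrow> F w = c" by (auto simp: constant_on_def)
    have "c = 1" using c[of 0] F0 by simp
    then have empty: "{w\<in>cball 0 y. F w = 0} = {}" using c y by auto
    show ?thesis unfolding empty by (rule finite.emptyI)
  next
    case False
    show ?thesis
      by (rule holomorphic_compact_finite_zeros[OF hol open_ball connected_ball compact_cball _ False]) (use y in auto)
  qed
  obtain y where y: "x < y" "y < 1" using dense[OF x(2)] by blast
  \<comment> \<open>Finitely many zeros occupy finitely many radii, so the interval contains a free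
    one.\<close>
  have "infinite {x<..<y}" using y(1) by (rule infinite_Ioo)
  then have "infinite ({x<..<y} - norm ` {w\<in>cball 0 y. F w = 0})"
    using fin[OF y(2)] by (intro Diff_infinite_finite) auto
  then have "{x<..<y} - norm ` {w\<in>cball 0 y. F w = 0} \<noteq> {}" by (rule infinite_imp_nonempty)
  then obtain r where "r \<in> {x<..<y} - norm ` {w\<in>cball 0 y. F w = 0}" unfolding ex_in_conv[symmetric] ..
  then have r: "r \<in> {x<..<y}" "r \<notin> norm ` {w\<in>cball 0 y. F w = 0}" by (simp_all only: Diff_iff not_False_eq_True)
  show thesis
  proof (rule that[of r])
    show "F w \<noteq> 0" if "norm w = r" for w using r that by force
    show "finite {w\<in>cball 0 r. F w = 0}" by (rule fin) (use r y in auto)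
  qed (use r y in auto)
qed

lemma boundary_value_eq:
  assumes cont: "continuous_on (cball 0 1) F" and eq: "\<And>z. norm z < 1 \<Longrightarrow> D z = F z"
  shows "boundary_value D t = F (cis t)"
proof -
  have "cis t islimpt ball 0 1" by (simp add: islimpt_ball)
  then have nt: "\<not> trivial_limit (at (cis t) within ball 0 1)" by (simp add: trivial_limit_within)
  have "(F \<longlongrightarrow> F (cis t)) (at (cis t) within cball 0 1)"
    using cont by (simp add: continuous_on_def)
  then have "(F \<longlongrightarrow> F (cis t)) (at (cis t) within ball 0 1)"
    by (rule tendsto_within_subset) (rule ball_subset_cball)
  moreover have "\<forall>\<^sub>F z in at (cis t) within ball 0 1. F z = D z"
    unfolding eventually_at_filter using eq by (auto intro: always_eventually)
  ultimately have "(D \<longlongrightarrow> F (cis t)) (at (cis t) within ball 0 1)" by (rule Lim_transform_eventually)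
  then show ?thesis unfolding boundary_value_def by (rule tendsto_Lim[OF nt])
qed

text \<open>Poisson-Jensen at z = 0, where the kernel is 1 and each Blaschke factor equals the
  modulus of its zero; then take logarithms.\<close>

lemma jensen_formula:
  fixes F :: "complex \<Rightarrow> complex" and a :: "'j \<Rightarrow> complex"
  assumes hol: "F holomorphic_on ball 0 1" and F0: "F 0 = 1" and r: "0 < r" "r < 1"
    and nz: "\<And>w. norm w = r \<Longrightarrow> F w \<noteq> 0" and J: "finite J"
    and a: "\<And>j. j \<in> J \<Longrightarrow> norm (a j) < r \<and> a j \<noteq> 0"
    and ord: "\<And>w. norm w \<le> r \<Longrightarrow> zorder F w = int (card {j\<in>J. a j = w})"
  shows "(LINT t:{-pi..pi}|lborel. ln (norm (F (r * cis t)))) = - 2 * pi * (\<Sum>j\<in>J. ln (norm (a j) / r))"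
proof -
  define I where "I = (LINT t:{-pi..pi}|lborel. ln (norm (F (r * cis t))))"
  have E: "exp (1 / (2 * of_real pi) * complex_of_real I) = of_real (exp (I / (2 * pi)))"
    by (simp flip: exp_of_real)
  have "1 = (\<Prod>j\<in>J. blaschke_factor (a j / r) 0) * exp (1 / (2 * of_real pi) *
    (LINT t:{-pi..pi}|lborel. of_real (ln (norm (F (r * cis t))))))"
    using poisson_jensen[OF hol F0 r nz J a ord, of 0] F0 by simp
  also have "(\<Prod>j\<in>J. blaschke_factor (a j / r) 0) = of_real (\<Prod>j\<in>J. norm (a j) / r)"
    unfolding of_real_prod using a r by (intro prod.cong) (auto simp: blaschke_factor_def norm_divide)
  also have "(LINT t:{-pi..pi}|lborel. complex_of_real (ln (norm (F (r * cis t))))) = of_real I"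
    unfolding I_def by (rule set_integral_complex_of_real)
  finally have "complex_of_real 1 = of_real ((\<Prod>j\<in>J. norm (a j) / r) * exp (I / (2 * pi)))"
    by (simp only: E of_real_mult of_real_1)
  then have 1: "1 = (\<Prod>j\<in>J. norm (a j) / r) * exp (I / (2 * pi))" by (simp only: of_real_eq_iff)
  have pos: "0 < norm (a j) / r" if "j \<in> J" for j using a[OF that] r by simp
  then have P: "0 < (\<Prod>j\<in>J. norm (a j) / r)" by (rule prod_pos)
  have "ln 1 = ln (\<Prod>j\<in>J. norm (a j) / r) + ln (exp (I / (2 * pi)))"
    by (subst 1, rule ln_mult_pos[OF P]) simp
  also have "ln (\<Prod>j\<in>J. norm (a j) / r) = (\<Sum>j\<in>J. ln (norm (a j) / r))"
    by (rule ln_prod[OF J]) (use pos less_irrefl in metis)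
  finally show ?thesis by (simp add: I_def field_simps)
qed

lemma jensen_inequality_disc:
  fixes F :: "complex \<Rightarrow> complex"
  assumes hol: "F holomorphic_on ball 0 1" and F0: "F 0 = 1" and r: "0 < r" "r < 1"
    and nz: "\<And>w. norm w = r \<Longrightarrow> F w \<noteq> 0" and fin: "finite {w\<in>cball 0 r. F w = 0}"
  shows "0 \<le> (LINT t:{-pi..pi}|lborel. ln (norm (F (r * cis t))))"
proof -
  define Z where "Z = {w\<in>cball 0 r. F w = 0}"
  \<comment> \<open>No enumeration is given here, so pairs of a zero and a copy number serve as
    indices and account for multiplicity.\<close>
  define J where "J = (SIGMA w:Z. {..<nat (zorder F w)})"
  have ne: "\<exists>w\<in>ball 0 1. F w \<noteq> 0" using F0 by (auto intro!: bexI[of _ 0])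
  have J: "finite J" unfolding J_def using fin by (auto simp: Z_def)
  have a: "norm (fst j) < r \<and> fst j \<noteq> 0" if "j \<in> J" for j
  proof -
    have "fst j \<in> Z" using that by (auto simp: J_def)
    then have "norm (fst j) \<le> r" "F (fst j) = 0" by (auto simp: Z_def)
    moreover have "norm (fst j) \<noteq> r" using nz \<open>F (fst j) = 0\<close> by blast
    moreover have "fst j \<noteq> 0" using \<open>F (fst j) = 0\<close> F0 by (metis zero_neq_one)
    ultimately show ?thesis by simp
  qed
  have ord: "zorder F w = int (card {j\<in>J. fst j = w})" if "norm w \<le> r" for w
  proof -
    have w: "w \<in> ball 0 1" using that r by simp
    note zo = conjunct1[OF zorder_exist_zero[OF hol open_ball connected_ball w ne]]
    have fiber: "{j\<in>J. fst j = w} = (if F w = 0 then {w} \<times> {..<nat (zorder F w)} else {})"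
      using that by (auto simp: J_def Z_def)
    show ?thesis using zo unfolding fiber by (cases "F w = 0") (simp_all add: card_cartesian_product)
  qed
  have "(\<Sum>j\<in>J. ln (norm (fst j) / r)) \<le> 0"
    using a r by (intro sum_nonpos) (auto simp: less_imp_le)
  moreover have "(LINT t:{-pi..pi}|lborel. ln (norm (F (r * cis t)))) = - 2 * pi * (\<Sum>j\<in>J. ln (norm (fst j) / r))"
    by (rule jensen_formula[OF hol F0 r nz J a ord])
  ultimately show ?thesis by (simp add: mult_nonneg_nonpos)
qed

text \<open>The measure is obtained from F alone, before any enumeration is fixed, so one sigma
  serves for all lists of zeros.\<close>

lemma canonical_factorization:
  fixes F D :: "complex \<Rightarrow> complex"
  assumes cont: "continuous_on (cball 0 1) F" and hol: "F holomorphic_on ball 0 1" and F0: "F 0 = 1"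
    and eq: "\<And>z. norm z < 1 \<Longrightarrow> D z = F z"
  shows "\<exists>\<sigma>. finite_borel_measure_on {-pi..pi} \<sigma> \<and> lebesgue_singular \<sigma> \<and>
           (\<forall>N zs. enumerates_zeros D N zs \<longrightarrow>
             (\<forall>z. norm z < 1 \<longrightarrow>
               D z = blaschke_product N zs z * exp (- K_sing \<sigma> z) * exp (K_outer D z))) \<and>
           log_boundary_L1 D \<and>
           measure_support \<sigma> \<subseteq> {t \<in> {-pi..pi}. boundary_value D t = 0}"
proof -
  have bv: "boundary_value D t = F (cis t)" for t by (rule boundary_value_eq[OF cont eq])
  have "compact (F ` cball 0 1)" by (rule compact_continuous_image[OF cont compact_cball])
  from compact_imp_bounded[OF this] obtain M0 where M0: "\<And>z. z \<in> cball 0 1 \<Longrightarrow> norm (F z) \<le> M0"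
    unfolding bounded_iff by (metis image_eqI)
  define M where "M = max 1 M0"
  have M: "1 \<le> M" "\<And>z. norm z \<le> 1 \<Longrightarrow> norm (F z) \<le> M" using M0 by (auto simp: M_def le_max_iff_disj)
  \<comment> \<open>Only lower bounds that force the radii to 1; the actual \<open>r n\<close> is
    chosen above \<open>x n\<close> so that its circle carries no zero.\<close>
  define x where "x = (\<lambda>n. 1 - 1 / (real n + 2))"
  have x: "0 \<le> x n" "x n < 1" for n by (auto simp: x_def field_simps)
  have "\<exists>r. \<forall>n. x n < r n \<and> r n < 1 \<and> (\<forall>w. norm w = r n \<longrightarrow> F w \<noteq> 0) \<and> finite {w\<in>cball 0 (r n). F w = 0}"
    by (rule choice, rule allI, rule exists_zero_free_radius[OF hol F0 x]) blast
  then obtain r where r: "\<And>n. x n < r n" "\<And>n. r n < 1" "\<And>n w. norm w = r n \<Longrightarrow> F w \<noteq> 0"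
    "\<And>n. finite {w\<in>cball 0 (r n). F w = 0}" by blast
  have r0: "0 < r n" for n using r(1)[of n] x(1)[of n] by linarith
  have r1: "r \<longlonglongrightarrow> 1"
  proof (rule tendsto_sandwich)
    have "x \<longlonglongrightarrow> 1 - 0" unfolding x_def by (intro tendsto_intros) real_asymp
    then show "x \<longlonglongrightarrow> 1" by simp
    show "\<forall>\<^sub>F n in sequentially. x n \<le> r n" using r(1) by (simp add: less_imp_le)
    show "\<forall>\<^sub>F n in sequentially. r n \<le> 1" using r(2) by (simp add: less_imp_le)
  qed simp
  have rc: "norm (of_real (r n) * cis t) = r n" for n t using r0[of n] by (simp add: norm_mult)
  define u where "u = (\<lambda>n t. norm (F (of_real (r n) * cis t)))"
  define v where "v = (\<lambda>t. norm (F (cis t)))"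
  define L where "L = restrict_space lborel {-pi..pi}"
  have L: "integral\<^sup>L L f = (LINT t:{-pi..pi}|lborel. f t)" for f :: "real \<Rightarrow> 'c::{banach, second_countable_topology}"
    unfolding L_def set_lebesgue_integral_def by (rule integral_restrict_space) simp
  have uc: "continuous_on UNIV (u n)" for n unfolding u_def
    using r(2)[of n] rc by (intro continuous_on_norm continuous_on_compose2[OF cont] continuous_intros) auto
  have vc: "continuous_on UNIV v" unfolding v_def
    by (intro continuous_on_norm continuous_on_compose2[OF cont] continuous_intros) auto
  have up: "0 < u n t" for n t using r(3)[OF rc] by (simp add: u_def)
  have uM: "u n t \<le> M" for n t using M(2) rc[of n t] r(2)[of n] by (simp add: u_def)
  have uni: "uniform_limit UNIV u v sequentially"
  proof (rule uniform_limitI)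
    fix e :: real assume e: "e > 0"
    have "uniformly_continuous_on (cball 0 1) F" by (rule compact_uniformly_continuous[OF cont compact_cball])
    then obtain d where d: "d > 0" "\<And>z w. z \<in> cball 0 1 \<Longrightarrow> w \<in> cball 0 1 \<Longrightarrow> dist w z < d \<Longrightarrow> dist (F w) (F z) < e"
      unfolding uniformly_continuous_on_def using e by metis
    have "\<forall>\<^sub>F n in sequentially. dist (r n) 1 < d" by (rule tendstoD[OF r1 d(1)])
    then show "\<forall>\<^sub>F n in sequentially. \<forall>t\<in>UNIV. dist (u n t) (v t) < e"
    proof eventually_elim
      case (elim n)
      show ?case
      proof
        fix t
        have "of_real (r n) * cis t - cis t = of_real (r n - 1) * cis t" by (simp add: algebra_simps)
        then have "norm (of_real (r n) * cis t - cis t) = \<bar>r n - 1\<bar>" by (simp only: norm_mult norm_of_real norm_cis mult_1_right)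
        then have "dist (of_real (r n) * cis t) (cis t) < d" using elim by (simp add: dist_norm)
        then have "dist (F (of_real (r n) * cis t)) (F (cis t)) < e"
          using rc[of n t] r(2)[of n] by (intro d(2)) auto
        then show "dist (u n t) (v t) < e"
          using norm_triangle_ineq3[of "F (of_real (r n) * cis t)" "F (cis t)"]
          by (simp add: u_def v_def dist_norm)
      qed
    qed
  qed
  have mean: "0 \<le> (LINT t|L. ln (u n t))" for n
    unfolding L u_def using jensen_inequality_disc[OF hol F0 r0 r(2,3,4)] .
  define Z where "Z = {t\<in>{-pi..pi}. v t = 0}"
  have pi: "- pi < pi" by simp
  obtain s \<sigma> where s: "strict_mono (s :: nat \<Rightarrow> nat)" and \<sigma>: "finite_measure \<sigma>" "sets \<sigma> = sets (restrict_space borel {-pi..pi})"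
    and Z: "Z \<in> null_sets lborel" "emeasure \<sigma> (space \<sigma> - Z) = 0" and lni: "integrable L (\<lambda>t. ln (v t))"
    and lim: "\<forall>k :: real \<Rightarrow> complex. continuous_on UNIV k \<longrightarrow> bounded (range k) \<longrightarrow>
       (\<lambda>n. LINT t|L. k t * of_real (ln (u (s n) t))) \<longlonglongrightarrow> (LINT t|L. k t * of_real (ln (v t))) - integral\<^sup>L \<sigma> k"
    by (rule log_integral_limit[where u = u, OF pi M(1) uc up uM uni mean[unfolded L_def], folded L_def Z_def]) (rule that)
  have sp: "space \<sigma> = {-pi..pi}" using sets_eq_imp_space_eq[OF \<sigma>(2)] by (simp add: space_restrict_space)
  show ?thesis
  proof (intro exI[of _ \<sigma>] conjI allI impI)
    show "finite_borel_measure_on {-pi..pi} \<sigma>" using \<sigma> by (simp add: finite_borel_measure_on_def)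
    show "lebesgue_singular \<sigma>" using Z by (auto simp: lebesgue_singular_def)
    show "log_boundary_L1 D"
      unfolding log_boundary_L1_def bv
    proof
      have "AE t in lborel. t \<notin> Z" using Z(1) by (rule AE_not_in)
      then show "AE t in lborel. t \<in> {-pi<..<pi} \<longrightarrow> F (cis t) \<noteq> 0"
        by eventually_elim (auto simp: Z_def v_def)
      have "set_integrable lborel {-pi..pi} (\<lambda>t. ln (norm (F (cis t))))"
        using lni unfolding L_def v_def set_integrable_def by (subst (asm) integrable_restrict_space) auto
      then show "set_integrable lborel {-pi<..<pi} (\<lambda>t. ln (norm (F (cis t))))"
        by (rule set_integrable_subset) auto
    qed
    show "measure_support \<sigma> \<subseteq> {t \<in> {-pi..pi}. boundary_value D t = 0}"
    proof
      fix t assume t: "t \<in> measure_support \<sigma>"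
      have tpi: "t \<in> {-pi..pi}" using t by (simp add: measure_support_def sp)
      \<comment> \<open>Off its zeros v is locally nonzero by continuity, and sigma has no mass
        there; so no such point belongs to the support.\<close>
      define U where "U = {t. v t \<noteq> 0}"
      have "open U"
        unfolding U_def using vc by (intro open_Collect_neq continuous_on_const) auto
      have UZ: "U \<inter> space \<sigma> = space \<sigma> - Z" by (auto simp: U_def Z_def sp)
      have "v t = 0"
      proof (rule ccontr)
        assume "v t \<noteq> 0"
        then have "t \<in> U" by (simp add: U_def)
        then have "emeasure \<sigma> (U \<inter> space \<sigma>) > 0" using t \<open>open U\<close> by (simp add: measure_support_def)
        then show False using Z(2) by (simp add: UZ)
      qed
      then show "t \<in> {t \<in> {-pi..pi}. boundary_value D t = 0}" using tpi by (simp add: bv v_def)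
    qed
    fix N zs and z :: complex
    assume en: "enumerates_zeros D N zs" and z: "norm z < 1"
    have ne: "\<exists>w\<in>ball 0 1. F w \<noteq> 0" using F0 by (auto intro!: bexI[of _ 0])
    have zo: "zorder D w = zorder F w" if "w \<in> ball 0 1" for w
    proof (rule zorder_cong)
      have "\<forall>\<^sub>F z in nhds w. z \<in> ball 0 1" using that by (intro eventually_nhds_in_open) auto
      then show "\<forall>\<^sub>F z in at w. D z = F z"
        unfolding eventually_at_filter by eventually_elim (use eq in auto)
    qed simp
    have zs: "zs j \<noteq> 0 \<and> norm (zs j) < 1" "F (zs j) = 0" if "enat j < N" for j
    proof -
      have "zs j \<in> ball 0 1" "D (zs j) = 0" using en that by (auto simp: enumerates_zeros_def)
      then show "F (zs j) = 0" using eq[of "zs j"] by simp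
      then show "zs j \<noteq> 0 \<and> norm (zs j) < 1" using \<open>zs j \<in> ball 0 1\<close> F0 by auto
    qed
    have mult: "finite {j. enat j < N \<and> zs j = w}" "int (card {j. enat j < N \<and> zs j = w}) = zorder F w"
      if "w \<in> ball 0 1" "F w = 0" for w
      using en that eq[of w] zo[of w] by (auto simp: enumerates_zeros_def)
    define J where "J = (\<lambda>n. {j. enat j < N \<and> norm (zs j) < r n})"
    have finJ: "finite (J n)" for n
    proof (rule finite_subset)
      show "J n \<subseteq> (\<Union>w\<in>{w\<in>cball 0 (r n). F w = 0}. {j. enat j < N \<and> zs j = w})"
        using zs by (auto simp: J_def)
      show "finite (\<Union>w\<in>{w\<in>cball 0 (r n). F w = 0}. {j. enat j < N \<and> zs j = w})"
        using r(4) mult(1) r(2)[of n] by (intro finite_UN_I) auto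
    qed
    have aJ: "norm (zs j) < r n \<and> zs j \<noteq> 0" if "j \<in> J n" for j n using that zs by (auto simp: J_def)
    have ordJ: "zorder F w = int (card {j\<in>J n. zs j = w})" if w: "norm w \<le> r n" for w n
    proof (cases "F w = 0")
      case True
      have wb: "w \<in> ball 0 1" using w r(2)[of n] by simp
      have "norm w \<noteq> r n" using r(3) True by blast
      then have "norm w < r n" using w by simp
      then have "{j\<in>J n. zs j = w} = {j. enat j < N \<and> zs j = w}" by (auto simp: J_def)
      then show ?thesis using mult(2)[OF wb True] by simp
    next
      case False
      have wb: "w \<in> ball 0 1" using w r(2)[of n] by simp
      have empty: "{j\<in>J n. zs j = w} = {}" using False zs(2) by (auto simp: J_def)
      show ?thesis using conjunct1[OF zorder_exist_zero[OF hol open_ball connected_ball wb ne]] False unfolding empty by simp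
    qed
    have blim: "(\<lambda>n. \<Prod>j\<in>J n. blaschke_factor (zs j / r n) z) \<longlonglongrightarrow> blaschke_product N zs z"
      unfolding J_def
    proof (rule blaschke_product_limit[OF zs(1) r0 r(2) r1 _ _ z])
      show "finite {j. enat j < N \<and> norm (zs j) < r n}" for n using finJ by (simp add: J_def)
      show "(\<Sum>j | enat j < N \<and> norm (zs j) < r n. 1 - norm (zs j) / r n) \<le> ln M" for n
      proof -
        have pos: "0 < norm (zs j) / r n" if "j \<in> J n" for j using aJ[OF that] r0[of n] by simp
        \<comment> \<open>1 - y <= - ln y turns the sum into one governed by Jensen's formula; since
          |F| <= M, its mean is at most ln M.\<close>
        have "(\<Sum>j\<in>J n. 1 - norm (zs j) / r n) \<le> (\<Sum>j\<in>J n. - ln (norm (zs j) / r n))"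
          using ln_le_minus_one[OF pos] by (intro sum_mono) force
        also have "\<dots> = (LINT t:{-pi..pi}|lborel. ln (u n t)) / (2 * pi)"
        proof -
          have "(LINT t:{-pi..pi}|lborel. ln (u n t)) = - 2 * pi * (\<Sum>j\<in>J n. ln (norm (zs j) / r n))"
            unfolding u_def by (rule jensen_formula[OF hol F0 r0 r(2,3) finJ aJ ordJ])
          then show ?thesis by (simp add: sum_negf)
        qed
        also have "(LINT t:{-pi..pi}|lborel. ln (u n t)) \<le> (LINT t:{-pi..pi}|lborel. ln M)"
        proof (rule set_integral_mono)
          have "continuous_on {-pi..pi} (\<lambda>t. ln (u n t))"
          proof (intro continuous_on_ln continuous_on_subset[OF uc])
            show "\<forall>t\<in>{-pi..pi}. u n t \<noteq> 0" using less_imp_neq[OF up[of n]] by metis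
          qed simp
          then show "set_integrable lborel {-pi..pi} (\<lambda>t. ln (u n t))" by (rule borel_integrable_atLeastAtMost')
          show "set_integrable lborel {-pi..pi} (\<lambda>t. ln M)" by (rule borel_integrable_atLeastAtMost') simp
          show "ln (u n t) \<le> ln M" for t by (rule ln_mono[OF uM up])
        qed
        also have "(LINT t:{-pi..pi}|lborel. ln M) = 2 * pi * ln M"
          unfolding set_lebesgue_integral_def by simp
        finally show ?thesis by (simp add: J_def divide_right_mono)
      qed
    qed
    define k where "k = (\<lambda>t. (cis t + z) / (cis t - z))"
    have kc: "continuous_on UNIV k" unfolding k_def using cis_neq[OF z] by (intro continuous_intros) auto
    have kB0: "norm (k t) \<le> 2 / (1 - norm z)" for t
      unfolding k_def norm_divide
    proof (rule frac_le)
      show "norm (cis t + z) \<le> 2" using norm_triangle_ineq[of "cis t" z] z by simp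
      show "1 - norm z \<le> norm (cis t - z)" using norm_triangle_ineq2[of "cis t" z] by simp
    qed (use z in auto)
    have kB: "bounded (range k)" by (rule boundedI[of _ "2 / (1 - norm z)"]) (use kB0 in auto)
    have pj: "F (r n * z) = (\<Prod>j\<in>J n. blaschke_factor (zs j / r n) z) *
        exp (1 / (2 * of_real pi) * (LINT t|L. k t * of_real (ln (u n t))))" for n
      unfolding L k_def u_def by (rule poisson_jensen[OF hol F0 r0 r(2,3) finJ aJ ordJ z])
    have "(\<lambda>n. (\<Prod>j\<in>J (s n). blaschke_factor (zs j / r (s n)) z) *
        exp (1 / (2 * of_real pi) * (LINT t|L. k t * of_real (ln (u (s n) t)))))
      \<longlonglongrightarrow> blaschke_product N zs z *
        exp (1 / (2 * of_real pi) * ((LINT t|L. k t * of_real (ln (v t))) - integral\<^sup>L \<sigma> k))"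
      by (intro tendsto_intros lim[rule_format, OF kc kB] LIMSEQ_subseq_LIMSEQ[OF blim s, unfolded o_def])
    then have "(\<lambda>n. F (r (s n) * z)) \<longlonglongrightarrow> blaschke_product N zs z *
        exp (1 / (2 * of_real pi) * ((LINT t|L. k t * of_real (ln (v t))) - integral\<^sup>L \<sigma> k))"
      by (simp only: pj)
    moreover have "(\<lambda>n. F (r (s n) * z)) \<longlonglongrightarrow> F z"
    proof -
      have "isCont F z"
        using holomorphic_on_imp_continuous_on[OF hol] z by (simp add: continuous_on_eq_continuous_at)
      moreover have "(\<lambda>n. of_real (r (s n)) * z) \<longlonglongrightarrow> of_real 1 * z"
        by (intro tendsto_intros LIMSEQ_subseq_LIMSEQ[OF r1 s, unfolded o_def])
      ultimately show ?thesis using isCont_tendsto_compose[of z F "\<lambda>n. of_real (r (s n)) * z"] by simp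
    qed
    ultimately have "F z = blaschke_product N zs z *
        exp (1 / (2 * of_real pi) * ((LINT t|L. k t * of_real (ln (v t))) - integral\<^sup>L \<sigma> k))"
      by (rule LIMSEQ_unique[rotated])
    moreover have "1 / (2 * of_real pi) * ((LINT t|L. k t * of_real (ln (v t))) - integral\<^sup>L \<sigma> k) = - K_sing \<sigma> z + K_outer D z"
      unfolding K_sing_def K_outer_def bv L k_def v_def by (simp add: diff_divide_distrib)
    ultimately have "F z = blaschke_product N zs z * exp (- K_sing \<sigma> z + K_outer D z)" by simp
    then show "D z = blaschke_product N zs z * exp (- K_sing \<sigma> z) * exp (K_outer D z)"
      using eq[OF z] by (simp only: exp_add mult.assoc)
  qed
qed

theorem corollary1p2:
  fixes V :: "int ^ 'd::finite \<Rightarrow> complex" and p :: real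
  assumes "CARD('d) \<ge> 3"
    and "V \<in> lspace p"
    and "1 \<le> p"
    and "p < (if CARD('d) = 3 then 6 / 5 else 4 / 3)"
  shows "\<exists>\<sigma>. finite_borel_measure_on {-pi..pi} \<sigma> \<and> lebesgue_singular \<sigma> \<and>
           (\<forall>N zs. enumerates_zeros (disc_det V) N zs \<longrightarrow>
             (\<forall>z. norm z < 1 \<longrightarrow>
               disc_det V z =
                 blaschke_product N zs z * exp (- K_sing \<sigma> z) * exp (K_outer (disc_det V) z))) \<and>
           log_boundary_L1 (disc_det V) \<and>
           measure_support \<sigma> \<subseteq> {t \<in> {-pi..pi}. boundary_value (disc_det V) t = 0}"
proof -
  obtain F where F: "disc_algebra F" "\<And>z. norm z < 1 \<Longrightarrow> disc_det V z = F z" "F 0 = 1"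
    by (rule disc_det_extension[OF assms]) (rule that)
  then have "continuous_on (cball 0 1) F" "F holomorphic_on ball 0 1" by (auto simp: disc_algebra_def)
  from canonical_factorization[OF this F(3,2)] show ?thesis .
qed

end
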